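(* Let $0<q<1$ and fix an admissible quadruple $(a,b,c,d)$: $a>0>b$ and the pair $(c,d)$ satisfies one of: $d=\bar c\in\mathbb C\setminus\mathbb R$; or $aq^m<c,d<aq^{m-1}$ for some $m\in\mathbb Z$; or $bq^{m-1}<c,d<bq^m$ for some $m\in\mathbb Z$. For $M\in\mathbb Z_{\ge0}$ put $$\varepsilon=\frac{q^{M+1}}{\sqrt{-ab}},\quad \zeta=\sqrt{-b/a},\quad L=M,\quad R=-M,\quad (s_0,s_1,s_2,s_3)=\left(\varepsilon c,\varepsilon d,-\frac q{\varepsilon a},-\frac q{\varepsilon b}\right).$$ Let $M^{qR}_{q,\zeta,s_0,s_1,s_2,s_3}$ be the $q$-Racah orthogonality measure, which lives on point configurations on the grid $\Delta^{qR}_{M,-M}=\{-\zeta^{-1}q^{-M},-\zeta^{-1}q^{1-M},\dots\}\sqcup\{\dots,\zeta q^{1-M},\zeta q^{-M}\}$, and let $\widetilde M^{qR}_{q,\zeta,s_0,s_1,s_2,s_3}$ be its pushforward under $X\mapsto X\varepsilon$; it lives on the space $\Omega^{bqJ}$ of point configurations on $\Delta^{bqJ}_{a,b}=\{b^{-1}q,b^{-1}q^2,\dots\}\sqcup\{\dots,a^{-1}q^2,a^{-1}q\}=\varepsilon\,\Delta^{qR}_{M,-M}$. Then, as $M\to\infty$, the measures $\widetilde M^{qR}_{q,\zeta,s_0,s_1,s_2,s_3}$ converge weakly to the big $q$-Jacobi orthogonality measure $M^{bqJ}_{q,a,b,c,d}$ on $\Omega^{bqJ}$.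
   Context: Spaces of configurations (subsets) on a countable grid $\Delta$ carry the compact topology of $\{0,1\}^\Delta$. Symmetric functions are evaluated at configurations through $p_k(X)=\sum_{x\in X}x^k$, $k\ge1$ (the sums converge for these grids). $X\varepsilon=\{x\varepsilon:x\in X\}$. Orthogonality measures (known to exist and be unique). (1) For a quadruple with $s_2=-\zeta q^R$, $s_3=\zeta^{-1}q^{-L}$, $\zeta>0$, $L\ge R$ integers, and $(s_0,s_1)$ satisfying one of: $s_0=\overline{s_1}\in\mathbb C\setminus\mathbb R$; $\zeta^{-1}q^{m+1}<s_0,s_1<\zeta^{-1}q^m$ for some $m\in\mathbb Z$; $-\zeta q^m<s_0,s_1<-\zeta q^{m+1}$ for some $m\in\mathbb Z$ (the quadruple in the claim satisfies this), $M^{qR}_{q,\zeta,s_0,s_1,s_2,s_3}$ is the unique probability measure on configurations on $\{-\zeta^{-1}q^{-L+i}\}_{i\ge0}\sqcup\{\zeta q^{R+i}\}_{i\ge0}$ with $\int\Phi^{qR}_\lambda(X;q;s_0,s_1,s_2,s_3)\,dM^{qR}=\delta_{\lambda,\emptyset}$ for all partitions $\lambda$. (2) $M^{bqJ}_{q,a,b,c,d}$ is the unique probability measure on $\Omega^{bqJ}$ for which the functions $\Phi^{bqJ}_\lambda(\cdot;q;a,b,c,d)$, $\lambda$ ranging over all partitions, form an orthogonal basis of $L^2(\Omega^{bqJ},M^{bqJ}_{q,a,b,c,d})$; since $\Phi^{bqJ}_\emptyset=1$ it satisfies $\int\Phi^{bqJ}_\lambda\,dM^{bqJ}=\delta_{\lambda,\emptyset}$.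 Notation: $(x;q)_n=\prod_{k=0}^{n-1}(1-xq^k)$ for $n\ge0$, $(x_1,\dots,x_m;q)_n=\prod_j(x_j;q)_n$. $\ell(\lambda)$ is the number of nonzero parts, $|\lambda|=\sum\lambda_i$, $\mathbb Y(N)$ is the set of partitions with at most $N$ nonzero parts. $\mathrm{Sym}$ is the algebra of symmetric functions over $\mathbb C$, $\mathrm{Sym}(N)$ the symmetric polynomials in $N$ variables, the subscript $\le d$ means degree at most $d$. $V(x_1,\dots,x_N)=\prod_{i<j}(x_i-x_j)$. For variables $X=(x_1,x_2,\dots)$, $F(Xr)=F(rx_1,rx_2,\dots)$. Convergence: $F_N\in\mathrm{Sym}(N)$ converges to $F\in\mathrm{Sym}$ if $\sup_N\deg F_N<\infty$ and, for every sufficiently large $d$, $\iota_{d,N}(F_N)\to F$ in the finite-dimensional space $\mathrm{Sym}_{\le d}$, where for $N\ge d$, $\iota_{d,N}:\mathrm{Sym}_{\le d}(N)\to\mathrm{Sym}_{\le d}$ is the inverse of the isomorphism $F\mapsto F(x_1,\dots,x_N,0,0,\dots)$. Interpolation functions: $(x\mid c_0,c_1,\dots)^m=\prod_{i=0}^{m-1}(x-c_i)$; for $\mu\in\mathbb Y(N)$, $s_{\mu|N}(x_1,\dots,x_N\mid c_0,c_1,\dots)=\det[(x_j\mid c_0,c_1,\dots)^{\mu_i+N-i}]_{i,j=1}^N/V(x_1,\dots,x_N)$. $I^A_\mu(\cdot;q)\in\mathrm{Sym}$ is the limit as $N\to\infty$ (which exists) of $s_{\mu|N}(\cdot\mid q^{N-1},q^{N-2},\dots)$;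 for $s\ne0$, $I^{BC}_\mu(\cdot;q;s)\in\mathrm{Sym}$ is the limit (which exists) of $s_{\mu|N}(\cdot\mid c^{(N)}_0,c^{(N)}_1,\dots)$ with $c_i^{(N)}=s^{-1}q^{N-1-i}-sq^i$. $\Phi^{qR}_\lambda(\cdot;q;s_0,s_1,s_2,s_3)=\sum_{\mu\subseteq\lambda}\sigma^{qR}(\lambda,\mu)\,I^{BC}_\mu(\cdot;q;s_0)$ with $$\sigma^{qR}(\lambda,\mu)=s_0^{|\mu|-|\lambda|}\det\left[\frac{(-s_0s_1q^{\mu_k+1-k},-s_0s_2q^{\mu_k+1-k},-s_0s_3q^{\mu_k+1-k};q)_{\lambda_j-j-\mu_k+k}}{q^{(\mu_k+1-k)(\lambda_j-j-\mu_k+k)}\,(q,\,s_0s_1s_2s_3q^{\lambda_j+\mu_k+1-j-k};q)_{\lambda_j-j-\mu_k+k}}\right]_{j,k=1}^{\ell(\lambda)}.$$ $\Phi^{bqJ}_\lambda(X;q;a,b,c,d)=\sum_{\mu\subseteq\lambda}\sigma^{bqJ}(\lambda,\mu)\,I^A_\mu(Xc;q)$ with $$\sigma^{bqJ}(\lambda,\mu)=c^{-|\lambda|}\det\left[\frac{\left(\frac caq^{\mu_k+2-k},\frac cbq^{\mu_k+2-k};q\right)_{\lambda_j-j-\mu_k+k}}{q^{(\mu_k+1-k)(\lambda_j-j-\mu_k+k)}\left(q,\frac{cd}{ab}q^{\lambda_j+\mu_k+3-j-k};q\right)_{\lambda_j-j-\mu_k+k}}\right]_{j,k=1}^{\ell(\lambda)}.$$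 In both determinants an entry with $\lambda_j-j-\mu_k+k<0$ is $0$, and the empty determinant is $1$. *)

theory Defs
  imports
    "HOL-Probability.Probability"
    "HOL-Library.Poly_Mapping"
    "Jordan_Normal_Form.Determinant"
begin

section \<open>Partitions\<close>

text \<open>A partition is the list of its nonzero parts. Parts are indexed from 0,
  so \<open>part \<nu> i\<close> is $\nu_{i+1}$. The names \<open>\<nu>\<close>, \<open>\<mu>\<close> stand for the usual
  $\lambda$, $\mu$.\<close>

definition is_partition :: "nat list \<Rightarrow> bool" where
  "is_partition \<nu> \<longleftrightarrow> sorted_wrt (\<ge>) \<nu> \<and> 0 \<notin> set \<nu>"

definition part :: "nat list \<Rightarrow> nat \<Rightarrow> nat" where
  "part \<nu> i = (if i < length \<nu> then \<nu> ! i else 0)"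

definition subpartitions :: "nat list \<Rightarrow> nat list set" where
  "subpartitions \<nu> = {\<mu>. is_partition \<mu> \<and> (\<forall>i. part \<mu> i \<le> part \<nu> i)}"


section \<open>Polynomials and symmetric functions\<close>

text \<open>Monomials and polynomials in the variables $x_0, x_1, \dots$\<close>

type_synonym monom = "nat \<Rightarrow>\<^sub>0 nat"
type_synonym mpoly = "monom \<Rightarrow>\<^sub>0 complex"

definition Var :: "nat \<Rightarrow> mpoly" where
  "Var i = Poly_Mapping.single (Poly_Mapping.single i 1) 1"

definition Const :: "complex \<Rightarrow> mpoly" where
  "Const c = Poly_Mapping.single 0 c"

definition mdeg :: "monom \<Rightarrow> nat" where
  "mdeg m = (\<Sum>i\<in>Poly_Mapping.keys m. Poly_Mapping.lookup m i)"

text \<open>\<open>mp_eval h f P\<close> substitutes \<open>f i\<close> for the \<open>i\<close>-th variable of \<open>P\<close>;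
  \<open>h\<close> embeds the coefficients into the target ring.\<close>

definition mp_eval :: "(complex \<Rightarrow> 'r) \<Rightarrow> (nat \<Rightarrow> 'r) \<Rightarrow> mpoly \<Rightarrow> 'r::comm_ring_1" where
  "mp_eval h f P = (\<Sum>m\<in>Poly_Mapping.keys P. h (Poly_Mapping.lookup P m) *
     (\<Prod>i\<in>Poly_Mapping.keys m. f i ^ Poly_Mapping.lookup m i))"

text \<open>The symmetric polynomials in $x_0, \dots, x_{N-1}$ of degree at most \<open>d\<close>.\<close>

definition sym_poly_le :: "nat \<Rightarrow> nat \<Rightarrow> mpoly set" where
  "sym_poly_le N d = {P.
     (\<forall>m\<in>Poly_Mapping.keys P. Poly_Mapping.keys m \<subseteq> {..<N} \<and> mdeg m \<le> d) \<and>
     (\<forall>\<pi> m. \<pi> permutes {..<N} \<longrightarrow>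
        Poly_Mapping.lookup P (Poly_Mapping.map_key \<pi> m) = Poly_Mapping.lookup P m)}"

text \<open>Symmetric functions are the formal power series in infinitely many variables
  (given by their coefficients) of bounded degree that are invariant under permutations
  of the variables.\<close>

type_synonym symfun = "monom \<Rightarrow> complex"

definition Sym_le :: "nat \<Rightarrow> symfun set" where
  "Sym_le d = {F. (\<forall>m. F m \<noteq> 0 \<longrightarrow> mdeg m \<le> d) \<and>
     (\<forall>\<pi> m. bij \<pi> \<longrightarrow> F (Poly_Mapping.map_key \<pi> m) = F m)}"

definition Sym :: "symfun set" where
  "Sym = (\<Union>d. Sym_le d)"

text \<open>$F(x_0, \dots, x_{N-1}, 0, 0, \dots)$\<close>

definition sym_restrict :: "nat \<Rightarrow> symfun \<Rightarrow> mpoly" where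
  "sym_restrict N F =
     Abs_poly_mapping (\<lambda>m. if Poly_Mapping.keys m \<subseteq> {..<N} then F m else 0)"

text \<open>$F(r x_0, r x_1, \dots)$\<close>

definition sym_scale :: "complex \<Rightarrow> symfun \<Rightarrow> symfun" where
  "sym_scale r F = (\<lambda>m. r ^ mdeg m * F m)"

definition sym_iota :: "nat \<Rightarrow> nat \<Rightarrow> mpoly \<Rightarrow> symfun" where
  "sym_iota d N = inv_into (Sym_le d) (sym_restrict N)"

text \<open>Convergence of symmetric polynomials in \<open>N\<close> variables to a symmetric function. In the
  finite-dimensional space \<open>Sym_le d\<close> convergence is convergence of all coefficients.
  Only large \<open>N\<close> matter, because the sequences below are meaningful
  only when \<open>N\<close> is at least the length of a given partition.\<close>

definition sym_converges :: "(nat \<Rightarrow> mpoly) \<Rightarrow> symfun \<Rightarrow> bool" where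
  "sym_converges P F \<longleftrightarrow>
     (\<exists>D. \<forall>\<^sub>F N in sequentially. P N \<in> sym_poly_le N D) \<and>
     (\<forall>\<^sub>F d in sequentially. F \<in> Sym_le d \<and>
        (\<forall>m. (\<lambda>N. sym_iota d N (P N) m) \<longlonglongrightarrow> F m))"


section \<open>Evaluation at configurations\<close>

definition power_sum :: "nat \<Rightarrow> real set \<Rightarrow> complex" where
  "power_sum k X = (\<Sum>\<^sub>\<infinity>x\<in>X. of_real x ^ k)"

text \<open>The expression of a symmetric function as a polynomial in the power sums, the
  \<open>i\<close>-th variable standing for $p_{i+1}$. An identity holds in \<open>Sym\<close> iff it holds after
  restriction to \<open>N\<close> variables for every \<open>N\<close>.\<close>

definition power_sum_expr :: "symfun \<Rightarrow> mpoly" where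
  "power_sum_expr F =
     (THE P. \<forall>N. sym_restrict N F = mp_eval Const (\<lambda>i. \<Sum>j<N. Var j ^ (i + 1)) P)"

definition sym_eval :: "symfun \<Rightarrow> real set \<Rightarrow> complex" where
  "sym_eval F X = mp_eval (\<lambda>c. c) (\<lambda>i. power_sum (i + 1) X) (power_sum_expr F)"


section \<open>Interpolation symmetric functions\<close>

definition vandermonde :: "nat \<Rightarrow> mpoly" where
  "vandermonde N = (\<Prod>j<N. \<Prod>i<j. Var i - Var j)"

text \<open>The quotient of the two alternating polynomials is taken in the polynomial ring.\<close>

definition interp_poly :: "nat \<Rightarrow> nat list \<Rightarrow> (nat \<Rightarrow> complex) \<Rightarrow> mpoly" where
  "interp_poly N \<mu> c = (THE P. P * vandermonde N =
     Determinant.det (mat N N (\<lambda>(i, j). \<Prod>l<part \<mu> i + (N - 1 - i). Var j - Const (c l))))"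

definition I_A :: "real \<Rightarrow> nat list \<Rightarrow> symfun" where
  "I_A q \<mu> = (THE F. F \<in> Sym \<and> sym_converges
     (\<lambda>N. interp_poly N \<mu> (\<lambda>i. of_real (q powi (int N - 1 - int i)))) F)"

definition I_BC :: "real \<Rightarrow> complex \<Rightarrow> nat list \<Rightarrow> symfun" where
  "I_BC q s \<mu> = (THE F. F \<in> Sym \<and> sym_converges
     (\<lambda>N. interp_poly N \<mu> (\<lambda>i.
        inverse s * of_real (q powi (int N - 1 - int i)) - s * of_real (q ^ i))) F)"


section \<open>The symmetric functions of q-Racah and big q-Jacobi type\<close>

definition qpoch :: "real \<Rightarrow> complex \<Rightarrow> nat \<Rightarrow> complex" where
  "qpoch q x n = (\<Prod>k<n. 1 - x * of_real (q ^ k))"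

text \<open>With 0-based indices \<open>j\<close>, \<open>k\<close> the exponent $\mu_k + 1 - k$ becomes \<open>part \<mu> k - k\<close> and
  $\nu_j + \mu_k + 1 - j - k$ becomes \<open>part \<nu> j + part \<mu> k - 1 - j - k\<close>.\<close>

definition sigma_qR ::
  "real \<Rightarrow> complex \<Rightarrow> complex \<Rightarrow> complex \<Rightarrow> complex \<Rightarrow> nat list \<Rightarrow> nat list \<Rightarrow> complex" where
  "sigma_qR q s0 s1 s2 s3 \<nu> \<mu> =
     s0 powi (int (sum_list \<mu>) - int (sum_list \<nu>)) *
     Determinant.det (mat (length \<nu>) (length \<nu>) (\<lambda>(j, k).
       let e = int (part \<mu> k) - int k;
           n = int (part \<nu> j) - int j - int (part \<mu> k) + int k;
           t = of_real (q powi e)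
       in if n < 0 then 0
          else qpoch q (- s0 * s1 * t) (nat n) * qpoch q (- s0 * s2 * t) (nat n) *
               qpoch q (- s0 * s3 * t) (nat n) /
               (of_real (q powi (e * n)) * qpoch q (of_real q) (nat n) *
                qpoch q (s0 * s1 * s2 * s3 *
                  of_real (q powi (int (part \<nu> j) + int (part \<mu> k) - 1 - int j - int k)))
                  (nat n))))"

definition sigma_bqJ ::
  "real \<Rightarrow> real \<Rightarrow> real \<Rightarrow> complex \<Rightarrow> complex \<Rightarrow> nat list \<Rightarrow> nat list \<Rightarrow> complex" where
  "sigma_bqJ q a b c d \<nu> \<mu> =
     c powi (- int (sum_list \<nu>)) *
     Determinant.det (mat (length \<nu>) (length \<nu>) (\<lambda>(j, k).
       let e = int (part \<mu> k) - int k;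
           n = int (part \<nu> j) - int j - int (part \<mu> k) + int k;
           t = of_real (q powi (e + 1))
       in if n < 0 then 0
          else qpoch q (c / of_real a * t) (nat n) * qpoch q (c / of_real b * t) (nat n) /
               (of_real (q powi (e * n)) * qpoch q (of_real q) (nat n) *
                qpoch q (c * d / of_real (a * b) *
                  of_real (q powi (int (part \<nu> j) + int (part \<mu> k) + 1 - int j - int k)))
                  (nat n))))"

definition Phi_qR ::
  "real \<Rightarrow> complex \<Rightarrow> complex \<Rightarrow> complex \<Rightarrow> complex \<Rightarrow> nat list \<Rightarrow> symfun" where
  "Phi_qR q s0 s1 s2 s3 \<nu> =
     (\<lambda>m. \<Sum>\<mu>\<in>subpartitions \<nu>. sigma_qR q s0 s1 s2 s3 \<nu> \<mu> * I_BC q s0 \<mu> m)"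

definition Phi_bqJ ::
  "real \<Rightarrow> real \<Rightarrow> real \<Rightarrow> complex \<Rightarrow> complex \<Rightarrow> nat list \<Rightarrow> symfun" where
  "Phi_bqJ q a b c d \<nu> =
     (\<lambda>m. \<Sum>\<mu>\<in>subpartitions \<nu>. sigma_bqJ q a b c d \<nu> \<mu> * sym_scale c (I_A q \<mu>) m)"


section \<open>Spaces of configurations\<close>

text \<open>The space of all subsets of \<open>\<Delta>\<close>, with the product topology of $\{0,1\}^\Delta$
  transported along the identification of a subset with its indicator.\<close>

definition conf_topology :: "real set \<Rightarrow> real set topology" where
  "conf_topology \<Delta> = pullback_topology (Pow \<Delta>) (\<lambda>X. \<lambda>x\<in>\<Delta>. x \<in> X)
     (product_topology (\<lambda>_. discrete_topology (UNIV :: bool set)) \<Delta>)"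

definition conf_borel :: "real set \<Rightarrow> real set measure" where
  "conf_borel \<Delta> = sigma (Pow \<Delta>) {U. openin (conf_topology \<Delta>) U}"

definition conf_prob :: "real set \<Rightarrow> real set measure \<Rightarrow> bool" where
  "conf_prob \<Delta> M \<longleftrightarrow> prob_space M \<and> sets M = sets (conf_borel \<Delta>)"

text \<open>Continuous functions are bounded here, since the space of configurations is compact.\<close>

definition conf_weak_conv :: "real set \<Rightarrow> (nat \<Rightarrow> real set measure) \<Rightarrow> real set measure \<Rightarrow> bool" where
  "conf_weak_conv \<Delta> Ms M \<longleftrightarrow>
     (\<forall>f. continuous_map (conf_topology \<Delta>) euclideanreal f \<longrightarrow>
        (\<lambda>n. integral\<^sup>L (Ms n) f) \<longlonglongrightarrow> integral\<^sup>L M f)"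

definition grid_qR :: "real \<Rightarrow> real \<Rightarrow> int \<Rightarrow> int \<Rightarrow> real set" where
  "grid_qR q \<zeta> L R =
     {- inverse \<zeta> * q powi (- L + int i) | i. True} \<union> {\<zeta> * q powi (R + int i) | i. True}"

definition grid_bqJ :: "real \<Rightarrow> real \<Rightarrow> real \<Rightarrow> real set" where
  "grid_bqJ q a b = {inverse b * q ^ (i + 1) | i. True} \<union> {inverse a * q ^ (i + 1) | i. True}"


lemma grid_qR_scaled:
  fixes M :: nat and q a b :: real
  assumes "0 < q" "b < 0" "0 < a"
  defines "\<epsilon> \<equiv> q ^ (M + 1) / sqrt (- (a * b))" and "\<zeta> \<equiv> sqrt (- b / a)"
  shows "(\<lambda>x. x * \<epsilon>) ` grid_qR q \<zeta> (int M) (- int M) = grid_bqJ q a b"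
proof -
  define u where "u = sqrt a"
  define v where "v = sqrt (- b)"
  have uv: "u > 0" "v > 0" "a = u * u" "b = - (v * v)"
    using assms by (auto simp: u_def v_def)
  have z: "\<zeta> = v / u"
    unfolding \<zeta>_def u_def v_def by (rule real_sqrt_divide)
  have e: "\<epsilon> = q ^ (M + 1) / (u * v)"
    unfolding \<epsilon>_def u_def v_def by (simp flip: real_sqrt_mult)
  have p: "q powi (- int M + int i) * q ^ (M + 1) = q ^ (i + 1)" for i
  proof -
    have "q powi (- int M + int i) * q ^ (M + 1) = q powi (- int M + int i) * q powi int (M + 1)"
      by (simp only: power_int_of_nat)
    also have "\<dots> = q powi (- int M + int i + int (M + 1))"
      using assms(1) by (subst power_int_add) auto
    also have "- int M + int i + int (M + 1) = int (i + 1)" by simp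
    finally show ?thesis by (simp only: power_int_of_nat)
  qed
  have 1: "- inverse \<zeta> * q powi (- int M + int i) * \<epsilon> = inverse b * q ^ (i + 1)" for i
  proof -
    have "- inverse \<zeta> * q powi (- int M + int i) * \<epsilon> =
        (- inverse \<zeta> / (u * v)) * (q powi (- int M + int i) * q ^ (M + 1))"
      by (simp add: e)
    also have "- inverse \<zeta> / (u * v) = inverse b"
      using uv(1,2) by (simp add: z uv(4) field_simps)
    finally show ?thesis by (simp only: p)
  qed
  have 2: "\<zeta> * q powi (- int M + int i) * \<epsilon> = inverse a * q ^ (i + 1)" for i
  proof -
    have "\<zeta> * q powi (- int M + int i) * \<epsilon> =
        (\<zeta> / (u * v)) * (q powi (- int M + int i) * q ^ (M + 1))"
      by (simp add: e)
    also have "\<zeta> / (u * v) = inverse a"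
      using uv(1,2) by (simp add: z uv(3) field_simps)
    finally show ?thesis by (simp only: p)
  qed
  have "(\<lambda>x. x * \<epsilon>) ` grid_qR q \<zeta> (int M) (- int M) =
      {- inverse \<zeta> * q powi (- int M + int i) * \<epsilon> | i. True} \<union>
      {\<zeta> * q powi (- int M + int i) * \<epsilon> | i. True}"
    unfolding grid_qR_def by blast
  then show ?thesis
    by (simp only: 1 2 grid_bqJ_def)
qed


section \<open>Orthogonality measures\<close>

definition is_qR_measure ::
  "real \<Rightarrow> real \<Rightarrow> int \<Rightarrow> int \<Rightarrow> complex \<Rightarrow> complex \<Rightarrow> complex \<Rightarrow> complex \<Rightarrow> real set measure \<Rightarrow> bool"
where
  "is_qR_measure q \<zeta> L R s0 s1 s2 s3 M \<longleftrightarrow>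
     conf_prob (grid_qR q \<zeta> L R) M \<and>
     (\<forall>\<nu>. is_partition \<nu> \<longrightarrow>
        has_bochner_integral M (sym_eval (Phi_qR q s0 s1 s2 s3 \<nu>)) (if \<nu> = [] then 1 else 0))"

text \<open>An orthogonal basis of the Hilbert space $L^2(M)$ of complex-valued functions: pairwise
  orthogonal nonzero elements whose linear span is dense.\<close>

definition orthogonal_basis_L2 :: "'a measure \<Rightarrow> 'i set \<Rightarrow> ('i \<Rightarrow> 'a \<Rightarrow> complex) \<Rightarrow> bool" where
  "orthogonal_basis_L2 M I f \<longleftrightarrow>
     (\<forall>i\<in>I. f i \<in> borel_measurable M \<and> integrable M (\<lambda>x. (cmod (f i x))\<^sup>2) \<and>
        (LINT x|M. (cmod (f i x))\<^sup>2) \<noteq> 0) \<and>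
     (\<forall>i\<in>I. \<forall>j\<in>I. i \<noteq> j \<longrightarrow> (LINT x|M. f i x * cnj (f j x)) = 0) \<and>
     (\<forall>g e. g \<in> borel_measurable M \<and> integrable M (\<lambda>x. (cmod (g x))\<^sup>2) \<and> 0 < e \<longrightarrow>
        (\<exists>S w. finite S \<and> S \<subseteq> I \<and>
           (LINT x|M. (cmod (g x - (\<Sum>i\<in>S. w i * f i x)))\<^sup>2) < e))"

definition is_bqJ_measure ::
  "real \<Rightarrow> real \<Rightarrow> real \<Rightarrow> complex \<Rightarrow> complex \<Rightarrow> real set measure \<Rightarrow> bool" where
  "is_bqJ_measure q a b c d M \<longleftrightarrow>
     conf_prob (grid_bqJ q a b) M \<and>
     orthogonal_basis_L2 M {\<nu>. is_partition \<nu>} (\<lambda>\<nu>. sym_eval (Phi_bqJ q a b c d \<nu>))"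

definition admissible_bqJ :: "real \<Rightarrow> real \<Rightarrow> real \<Rightarrow> complex \<Rightarrow> complex \<Rightarrow> bool" where
  "admissible_bqJ q a b c d \<longleftrightarrow> b < 0 \<and> 0 < a \<and>
     ((d = cnj c \<and> c \<notin> \<real>) \<or>
      (\<exists>m::int. \<exists>c' d'. c = of_real c' \<and> d = of_real d' \<and>
         c' \<in> {a * q powi m<..<a * q powi (m - 1)} \<and> d' \<in> {a * q powi m<..<a * q powi (m - 1)}) \<or>
      (\<exists>m::int. \<exists>c' d'. c = of_real c' \<and> d = of_real d' \<and>
         c' \<in> {b * q powi (m - 1)<..<b * q powi m} \<and> d' \<in> {b * q powi (m - 1)<..<b * q powi m}))"

end

theory Submission
  imports Defs "HOL-Computational_Algebra.Formal_Power_Series"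
begin

text \<open>All symmetric functions are written as polynomials in the power sums. By a
  Jacobi--Trudi identity the interpolation polynomials are determinants of a fixed size in
  complete functions, which Newton's recursion expresses through the power sums of the variables
  minus those of the nodes; hence $I^A_\mu$ and $I^{BC}_\mu$ exist and depend polynomially on
  $s$ and $s^{-1}$. It follows that $\varepsilon^{|\lambda|} \Phi^{qR}_\lambda(X/\varepsilon)$
  converges to $\Phi^{bqJ}_\lambda(X)$ coefficientwise, so the integrals of $\Phi^{bqJ}_\lambda$
  with respect to the scaled measures tend to $\delta_{\lambda,\emptyset}$. Being orthogonal, the
  $\Phi^{bqJ}_\lambda$ with $|\lambda| \le d$ are linearly independent, and by counting they span
  the polynomials in the power sums of weight at most $d$. These are uniformly dense in the
  continuous functions by Stone--Weierstrass, because the moments determine a configuration.\<close>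

section \<open>Polynomials in the power sums\<close>

text \<open>The objects \<open>power_sum_expr\<close>, \<open>interp_poly\<close>,
  \<open>I_A\<close> and \<open>I_BC\<close> are definite descriptions, which mean something only
  after existence and uniqueness are proved. The normal form \<open>sym_of P\<close> serves all of
  them: \<open>power_sum_expr\<close> returns \<open>P\<close> by algebraic independence of the
  power sums, and \<open>sym_iota\<close> undoes the restriction to N variables in degrees up to N.
  After that N survives only in the power sums of the nodes, and these converge.

  The scaling works because the nodes of \<open>I_BC\<close> at s = \<epsilon> c, multiplied by
  \<epsilon>, are c^(-1) q^(N-1-l) - \<epsilon>^2 c q^l. The second progression dies out and the
  nodes of \<open>I_A\<close> divided by c remain; the prefactor \<epsilon>^|\<lambda>| makes all
  other powers of \<epsilon> cancel.

  Test functions and measures both move with M, so coefficientwise convergence must be paired with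
  bounds that hold uniformly over all probability measures on the compact space. Drawing
  independence from orthogonality replaces a computation of the leading terms of the \<Phi>.\<close>

lemma mpoly_sum_singles:
  fixes P :: mpoly
  shows "P = (\<Sum>m\<in>Poly_Mapping.keys P. Poly_Mapping.single m (Poly_Mapping.lookup P m))"
  by (rule poly_mapping_eqI)
    (auto simp: lookup_sum lookup_single when_def in_keys_iff)

lemma mpoly_induct [case_names single add]:
  fixes P :: mpoly
  assumes single: "\<And>m c. Q (Poly_Mapping.single m c)"
    and add: "\<And>P R. Q P \<Longrightarrow> Q R \<Longrightarrow> Q (P + R)"
  shows "Q P"
proof -
  have zero: "Q 0"
    using single[of 0 0] by simp
  have "Q (\<Sum>m\<in>A. Poly_Mapping.single m (Poly_Mapping.lookup P m))" if "finite A" for A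
    using that by induction (auto simp: zero single add)
  from this[of "Poly_Mapping.keys P"] show ?thesis
    by (simp flip: mpoly_sum_singles)
qed

interpretation Const: comm_ring_hom Const
  by unfold_locales (auto simp: Const_def single_add mult_single)

lemma comm_ring_hom_ident: "comm_ring_hom (\<lambda>c::'a::comm_ring_1. c)"
  by unfold_locales auto

definition monom_eval :: "(nat \<Rightarrow> 'r) \<Rightarrow> monom \<Rightarrow> 'r::comm_ring_1" where
  "monom_eval f m = (\<Prod>i\<in>Poly_Mapping.keys m. f i ^ Poly_Mapping.lookup m i)"

lemma monom_eval_superset:
  assumes "finite A" "Poly_Mapping.keys m \<subseteq> A"
  shows "monom_eval f m = (\<Prod>i\<in>A. f i ^ Poly_Mapping.lookup m i)"
  unfolding monom_eval_def using assms by (intro prod.mono_neutral_left) (auto simp: in_keys_iff)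

lemma monom_eval_zero [simp]: "monom_eval f 0 = 1"
  by (simp add: monom_eval_def)

lemma monom_eval_single: "monom_eval f (Poly_Mapping.single i n) = f i ^ n"
  by (cases "n = 0") (auto simp: monom_eval_def)

lemma monom_eval_add: "monom_eval f (m + n) = monom_eval f m * monom_eval f n"
proof -
  let ?A = "Poly_Mapping.keys m \<union> Poly_Mapping.keys n"
  have "Poly_Mapping.keys (m + n) \<subseteq> ?A"
    by (rule Poly_Mapping.keys_add)
  then show ?thesis
    by (simp add: monom_eval_superset[of ?A] lookup_add power_add prod.distrib)
qed

lemma mp_eval_superset:
  assumes "finite K" "Poly_Mapping.keys P \<subseteq> K" "h 0 = 0"
  shows "mp_eval h f P = (\<Sum>m\<in>K. h (Poly_Mapping.lookup P m) * monom_eval f m)"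
  unfolding mp_eval_def monom_eval_def using assms
  by (intro sum.mono_neutral_left) (auto simp: in_keys_iff)

lemma mp_eval_single:
  assumes "h 0 = 0"
  shows "mp_eval h f (Poly_Mapping.single m c) = h c * monom_eval f m"
  using assms by (subst mp_eval_superset[of "{m}"]) auto

lemma comm_ring_hom_mp_eval:
  assumes "comm_ring_hom h"
  shows "comm_ring_hom (mp_eval h f)"
proof -
  interpret h: comm_ring_hom h by fact
  have add: "mp_eval h f (P + R) = mp_eval h f P + mp_eval h f R" for P R
  proof -
    let ?K = "Poly_Mapping.keys P \<union> Poly_Mapping.keys R"
    have "Poly_Mapping.keys (P + R) \<subseteq> ?K"
      by (rule Poly_Mapping.keys_add)
    then show ?thesis
      by (simp add: mp_eval_superset[of ?K] lookup_add h.hom_add distrib_right sum.distrib)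
  qed
  have mult: "mp_eval h f (P * R) = mp_eval h f P * mp_eval h f R" for P R
  proof (induction P rule: mpoly_induct)
    case (single m c)
    show ?case
      by (induction R rule: mpoly_induct)
        (simp_all add: mult_single mp_eval_single monom_eval_add h.hom_mult add algebra_simps)
  qed (simp add: add algebra_simps)
  show ?thesis
  proof
    show "mp_eval h f 1 = 1"
      unfolding single_one[symmetric] by (subst mp_eval_single) auto
    show "mp_eval h f 0 = 0"
      by (simp add: mp_eval_def)
  qed (auto simp: add mult)
qed

lemma mp_eval_Var:
  assumes "comm_ring_hom h"
  shows "mp_eval h f (Var i) = f i"
proof -
  interpret h: comm_ring_hom h by fact
  show ?thesis
    by (simp add: Var_def mp_eval_single monom_eval_single)
qed

lemma mp_eval_Const:
  assumes "comm_ring_hom h"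
  shows "mp_eval h f (Const c) = h c"
proof -
  interpret h: comm_ring_hom h by fact
  show ?thesis
    by (simp add: Const_def mp_eval_single)
qed

lemma hom_mp_eval:
  assumes "comm_ring_hom g"
  shows "g (mp_eval h f P) = mp_eval (\<lambda>c. g (h c)) (\<lambda>i. g (f i)) P"
proof -
  interpret g: comm_ring_hom g by fact
  show ?thesis
    by (simp add: mp_eval_def g.hom_sum g.hom_mult g.hom_prod g.hom_power)
qed

abbreviation subst :: "(nat \<Rightarrow> mpoly) \<Rightarrow> mpoly \<Rightarrow> mpoly" where
  "subst \<equiv> mp_eval Const"

abbreviation eval_at :: "(nat \<Rightarrow> complex) \<Rightarrow> mpoly \<Rightarrow> complex" where
  "eval_at \<equiv> mp_eval (\<lambda>c. c)"

interpretation subst: comm_ring_hom "subst f" for f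
  by (rule comm_ring_hom_mp_eval) (rule Const.comm_ring_hom_axioms)

interpretation eval_at: comm_ring_hom "eval_at x" for x
  by (rule comm_ring_hom_mp_eval) (rule comm_ring_hom_ident)

lemma subst_Var [simp]: "subst f (Var i) = f i"
  by (rule mp_eval_Var) (rule Const.comm_ring_hom_axioms)

lemma subst_Const [simp]: "subst f (Const c) = Const c"
  by (rule mp_eval_Const) (rule Const.comm_ring_hom_axioms)

lemma eval_at_Var [simp]: "eval_at x (Var i) = x i"
  by (rule mp_eval_Var) (rule comm_ring_hom_ident)

lemma eval_at_Const [simp]: "eval_at x (Const c) = c"
  by (rule mp_eval_Const) (rule comm_ring_hom_ident)

lemma eval_at_subst: "eval_at x (subst f P) = eval_at (\<lambda>i. eval_at x (f i)) P"
  by (subst hom_mp_eval) (simp_all add: eval_at.comm_ring_hom_axioms)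

lemma subst_subst: "subst g (subst f P) = subst (\<lambda>i. subst g (f i)) P"
  by (subst hom_mp_eval) (simp_all add: subst.comm_ring_hom_axioms)

lemma subst_Const_mult: "subst f (Const c * P) = Const c * subst f P"
  by (simp add: subst.hom_mult)

lemma single_eq_Const_times: "Poly_Mapping.single m c = Const c * Poly_Mapping.single m 1"
  by (simp add: Const_def mult_single)

lemma single_eq_monom_eval: "Poly_Mapping.single m 1 = monom_eval Var m"
proof -
  have "finite A \<Longrightarrow> (\<Prod>i\<in>A. Var i ^ Poly_Mapping.lookup m i) =
      Poly_Mapping.single (\<Sum>i\<in>A. Poly_Mapping.single i (Poly_Mapping.lookup m i)) 1" for A
  proof (induction rule: finite_induct)
    case (insert i A)
    have "Var i ^ n = Poly_Mapping.single (Poly_Mapping.single i n) 1" for n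
      by (induction n) (auto simp: Var_def mult_single simp flip: single_add)
    then show ?case
      using insert by (simp add: mult_single)
  qed simp
  moreover have "(\<Sum>i\<in>Poly_Mapping.keys m. Poly_Mapping.single i (Poly_Mapping.lookup m i)) = m"
    by (rule poly_mapping_eqI) (auto simp: lookup_sum lookup_single when_def in_keys_iff)
  ultimately show ?thesis
    by (simp add: monom_eval_def)
qed

section \<open>Algebraic independence of the power sums\<close>

lemma base_representation_unique:
  fixes B :: nat and u v :: "nat \<Rightarrow> nat"
  assumes "\<And>i. i < n \<Longrightarrow> u i < B" "\<And>i. i < n \<Longrightarrow> v i < B"
    and "(\<Sum>i<n. B ^ i * u i) = (\<Sum>i<n. B ^ i * v i)" "i < n"
  shows "u i = v i"
  using assms
proof (induction n arbitrary: u v i)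
  case (Suc n)
  have split: "(\<Sum>i<Suc n. B ^ i * w i) = w 0 + B * (\<Sum>i<n. B ^ i * w (Suc i))" for w :: "nat \<Rightarrow> nat"
    by (simp only: sum.lessThan_Suc_shift) (simp add: sum_distrib_left algebra_simps)
  have eq: "u 0 + B * (\<Sum>i<n. B ^ i * u (Suc i)) = v 0 + B * (\<Sum>i<n. B ^ i * v (Suc i))"
    using Suc.prems(3) by (simp only: split)
  \<comment> \<open>The lowest digit is the residue modulo \<open>B\<close>; cancelling it leaves
    the shifted digit sequences.\<close>
  have "u 0 < B" "v 0 < B"
    using Suc.prems(1,2) by auto
  then have "u 0 = v 0"
    using arg_cong[OF eq, of "\<lambda>x. x mod B"] by simp
  moreover from this eq have "(\<Sum>i<n. B ^ i * u (Suc i)) = (\<Sum>i<n. B ^ i * v (Suc i))"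
    using \<open>u 0 < B\<close> by simp
  then have "u (Suc i) = v (Suc i)" if "i < n" for i
    using Suc.prems(1,2) that by (intro Suc.IH[of "\<lambda>i. u (Suc i)" "\<lambda>i. v (Suc i)"]) auto
  ultimately show ?case
    using Suc.prems(4) by (cases i) auto
qed simp

text \<open>The Kronecker substitution $x_i = t^{B^i}$ reduces the claim to one variable.\<close>

lemma mpoly_eq_0_if_eval_at_eq_0:
  assumes "\<And>x. eval_at x P = 0"
  shows "P = 0"
proof (rule ccontr)
  assume "P \<noteq> 0"
  define K where "K = Poly_Mapping.keys P"
  have fin: "finite K" by (simp add: K_def)
  define V where "V = (\<Union>m\<in>K. Poly_Mapping.keys m)"
  have "finite V" by (auto simp: V_def fin)
  then obtain n where n: "V \<subseteq> {..<n}"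
    using finite_nat_iff_bounded by auto
  \<comment> \<open>\<open>B\<close> will exceed every exponent that occurs, so exponent vectors
    become distinct base-\<open>B\<close> expansions and no two monomials of \<open>P\<close>
    collide.\<close>
  define E where "E = (\<Union>m\<in>K. Poly_Mapping.lookup m ` {..<n})"
  have "finite E" by (auto simp: E_def fin)
  then obtain B where B: "E \<subseteq> {..<B}"
    using finite_nat_iff_bounded by auto
  define e where "e m = (\<Sum>i<n. B ^ i * Poly_Mapping.lookup m i)" for m :: monom
  have inj: "inj_on e K"
  proof (rule inj_onI)
    fix m m' assume m: "m \<in> K" "m' \<in> K" "e m = e m'"
    show "m = m'"
    proof (rule poly_mapping_eqI)
      fix i
      show "Poly_Mapping.lookup m i = Poly_Mapping.lookup m' i"
      proof (cases "i < n")
        case True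
        show ?thesis
          by (rule base_representation_unique[of n _ B])
            (use m B True in \<open>auto simp: E_def e_def\<close>)
      next
        case False
        then have "i \<notin> Poly_Mapping.keys m" "i \<notin> Poly_Mapping.keys m'"
          using n m unfolding V_def by auto
        then show ?thesis by (simp add: in_keys_iff)
      qed
    qed
  qed
  define p where "p = (\<Sum>m\<in>K. Polynomial.monom (Poly_Mapping.lookup P m) (e m))"
  have "poly p t = eval_at (\<lambda>i. t ^ (B ^ i)) P" for t
  proof -
    have "monom_eval (\<lambda>i. t ^ (B ^ i)) m = t ^ e m" if "m \<in> K" for m
    proof -
      have "Poly_Mapping.keys m \<subseteq> {..<n}"
        using n that by (auto simp: V_def)
      then show ?thesis
        by (simp add: monom_eval_superset[of "{..<n}"] e_def power_sum power_mult)
    qed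
    then show ?thesis
      by (simp add: p_def poly_sum poly_monom mp_eval_superset[of K] fin K_def)
  qed
  then have "poly p = (\<lambda>_. 0)"
    using assms by auto
  then have p0: "p = 0"
    by (metis poly_0 ext poly_eq_poly_eq_iff)
  obtain m where m: "m \<in> K"
    using \<open>P \<noteq> 0\<close> unfolding K_def by fastforce
  have "coeff p (e m) = (\<Sum>m'\<in>K. if m' = m then Poly_Mapping.lookup P m' else 0)"
    unfolding p_def coeff_sum using inj m by (intro sum.cong) (auto dest: inj_onD)
  also have "\<dots> = Poly_Mapping.lookup P m"
    using m fin by simp
  finally show False
    using p0 m by (simp add: K_def in_keys_iff)
qed

lemma mpoly_eqI_eval_at:
  assumes "\<And>x. eval_at x P = eval_at x R"
  shows "P = R"
  using mpoly_eq_0_if_eval_at_eq_0[of "P - R"] assms by (simp add: eval_at.hom_minus)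

text \<open>The union of the scaled \<open>n\<close>-th roots of unity with a given tuple changes
  $p_n$ without changing $p_1, \dots, p_{n-1}$.\<close>

lemma power_sums_surj:
  fixes y :: "nat \<Rightarrow> complex"
  shows "\<exists>(N::nat) x. \<forall>k<n. (\<Sum>j<N. x j ^ (k + 1)) = y k"
proof (induction n)
  case (Suc n)
  then obtain N :: nat and x where x: "\<And>k. k < n \<Longrightarrow> (\<Sum>j<N. x j ^ (k + 1)) = y k"
    by blast
  \<comment> \<open>Index \<open>k\<close> stands for the exponent k + 1, so adjusting index
    \<open>n\<close> takes the roots of unity of order n + 1.\<close>
  define \<omega> where "\<omega> = cis (2 * pi / real (n + 1))"
  have \<omega>: "\<omega> ^ (n + 1) = 1"
    unfolding \<omega>_def by (subst Complex.DeMoivre) simp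
  have roots: "(\<Sum>l<n + 1. (\<omega> ^ l) ^ (k + 1)) = (if k = n then of_nat (n + 1) else 0)"
    if "k \<le> n" for k
  proof (cases "k = n")
    case True
    have "(\<omega> ^ l) ^ (n + 1) = 1" for l
      by (metis \<omega> mult.commute power_mult power_one)
    then show ?thesis using True by simp
  next
    case False
    define z where "z = \<omega> ^ (k + 1)"
    have z: "(\<omega> ^ l) ^ (k + 1) = z ^ l" for l
      by (simp only: z_def mult.commute flip: power_mult)
    have "z = cis (real (k + 1) * (2 * pi / real (n + 1)))"
      unfolding z_def \<omega>_def by (rule Complex.DeMoivre)
    also have "\<dots> \<noteq> 1"
    proof
      assume "cis (real (k + 1) * (2 * pi / real (n + 1))) = 1"
      then have "cos (real (k + 1) * (2 * pi / real (n + 1))) = 1"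
        by (metis cis.sel(1) one_complex.sel(1))
      then obtain i :: int where i: "real (k + 1) * (2 * pi / real (n + 1)) = real_of_int i * 2 * pi"
        using cos_one_2pi_int by (metis mult.assoc)
      then have "real (k + 1) = real_of_int i * real (n + 1)"
      proof -
        have "real (k + 1) * (2 * pi) = (real_of_int i * real (n + 1)) * (2 * pi)"
          using i by (simp only: times_divide_eq_right) (simp add: divide_eq_eq mult_ac)
        then show ?thesis by (metis mult_right_cancel pi_neq_zero mult_eq_0_iff zero_neq_numeral)
      qed
      then have "real_of_int (int (k + 1)) = real_of_int (i * int (n + 1))"
        by simp
      then have "int (k + 1) = i * int (n + 1)"
        by linarith
      then have "int (n + 1) dvd int (k + 1)" by simp
      then have "n + 1 dvd k + 1" by presburger
      then have "n + 1 \<le> k + 1" by (rule dvd_imp_le) simp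
      with False that show False by simp
    qed
    finally have "z \<noteq> 1" .
    moreover have "z ^ (n + 1) = 1"
      unfolding z_def by (metis \<omega> mult.commute power_mult power_one)
    ultimately have "(\<Sum>l<n + 1. z ^ l) = 0"
      by (subst geometric_sum) simp_all
    then show ?thesis using False by (simp only: z) simp
  qed
  \<comment> \<open>The scaled roots \<open>w * \<omega> ^ l\<close> add (n + 1) w^(n+1) to the last
    power sum, so w^(n+1) = \<open>r\<close> closes the gap.\<close>
  define r where "r = (y n - (\<Sum>j<N. x j ^ (n + 1))) / of_nat (n + 1)"
  obtain w where w: "w ^ (n + 1) = r"
  proof (cases "r = 0")
    case False
    have "exp (Ln r / of_nat (n + 1)) ^ (n + 1) = exp (of_nat (n + 1) * (Ln r / of_nat (n + 1)))"
      by (rule exp_of_nat_mult[symmetric])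
    also have "\<dots> = exp (Ln r)"
      by (simp del: of_nat_Suc of_nat_add)
    also have "\<dots> = r"
      using False by simp
    finally show ?thesis using that by blast
  qed (use that in auto)
  define x' where "x' j = (if j < N then x j else w * \<omega> ^ (j - N))" for j :: nat
  have "(\<Sum>j<N + (n + 1). x' j ^ (k + 1)) = y k" if "k < Suc n" for k
  proof -
    have "(\<Sum>j<N + (n + 1). x' j ^ (k + 1)) =
        (\<Sum>j<N. x j ^ (k + 1)) + (\<Sum>l<n + 1. (w * \<omega> ^ l) ^ (k + 1))"
    proof -
      have "(\<Sum>j<N + m. x' j ^ (k + 1)) =
          (\<Sum>j<N. x' j ^ (k + 1)) + (\<Sum>l<m. x' (N + l) ^ (k + 1))" for m
        by (induction m) (simp_all add: add.assoc)
      from this[of "n + 1"] show ?thesis by (simp add: x'_def)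
    qed
    also have "(\<Sum>l<n + 1. (w * \<omega> ^ l) ^ (k + 1)) = w ^ (k + 1) * (\<Sum>l<n + 1. (\<omega> ^ l) ^ (k + 1))"
      by (simp only: power_mult_distrib sum_distrib_left)
    also have "\<dots> = (if k = n then r * of_nat (n + 1) else 0)"
      using that w by (subst roots) auto
    also have "(\<Sum>j<N. x j ^ (k + 1)) + \<dots> = y k"
      using that x[of k] by (cases "k = n") (auto simp: r_def simp del: of_nat_Suc of_nat_add)
    finally show ?thesis .
  qed
  then show ?case by blast
qed auto

lemma eval_at_cong:
  assumes "\<And>m i. m \<in> Poly_Mapping.keys P \<Longrightarrow> i \<in> Poly_Mapping.keys m \<Longrightarrow> x i = y i"
  shows "eval_at x P = eval_at y P"
  unfolding mp_eval_def using assms by (auto intro!: sum.cong prod.cong)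

abbreviation psum :: "nat set \<Rightarrow> nat \<Rightarrow> mpoly" where
  "psum A \<equiv> \<lambda>i. \<Sum>j\<in>A. Var j ^ (i + 1)"

text \<open>Only finitely many variables occur, and any values prescribed for them are the power
  sums of some complex tuple, so the two polynomials agree at every point. This gives the
  description in \<open>power_sum_expr\<close> at most one solution.\<close>

lemma power_sums_alg_independent:
  assumes "\<And>N. subst (psum {..<N}) P = subst (psum {..<N}) R"
  shows "P = R"
proof (rule mpoly_eqI_eval_at)
  fix y :: "nat \<Rightarrow> complex"
  define V where "V = \<Union> (Poly_Mapping.keys ` (Poly_Mapping.keys P \<union> Poly_Mapping.keys R))"
  have "finite V" by (auto simp: V_def)
  then obtain n where n: "V \<subseteq> {..<n}"
    using finite_nat_iff_bounded by auto
  obtain N :: nat and x where x: "\<And>k. k < n \<Longrightarrow> (\<Sum>j<N. x j ^ (k + 1)) = y k"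
    using power_sums_surj[of n y] by blast
  have *: "eval_at y Q = eval_at x (subst (psum {..<N}) Q)"
    if "\<And>m. m \<in> Poly_Mapping.keys Q \<Longrightarrow> Poly_Mapping.keys m \<subseteq> V" for Q
    unfolding eval_at_subst
  proof (rule eval_at_cong)
    fix m i assume "m \<in> Poly_Mapping.keys Q" "i \<in> Poly_Mapping.keys m"
    then have "i < n" using that n by blast
    from x[OF this] show "y i = eval_at x (psum {..<N} i)"
      by (simp only: eval_at.hom_sum eval_at.hom_power eval_at_Var)
  qed
  have "eval_at y P = eval_at x (subst (psum {..<N}) P)"
    by (rule *) (auto simp: V_def)
  also have "\<dots> = eval_at x (subst (psum {..<N}) R)"
    by (simp only: assms)
  also have "\<dots> = eval_at y R"
    by (rule *[symmetric]) (auto simp: V_def)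
  finally show "eval_at y P = eval_at y R" .
qed

section \<open>Degree and weight filtrations\<close>

definition deg_le :: "(monom \<Rightarrow> nat) \<Rightarrow> nat \<Rightarrow> mpoly \<Rightarrow> bool" where
  "deg_le g d P \<longleftrightarrow> (\<forall>m\<in>Poly_Mapping.keys P. g m \<le> d)"

lemma deg_le_mono: "deg_le g d P \<Longrightarrow> d \<le> e \<Longrightarrow> deg_le g e P"
  by (auto simp: deg_le_def)

lemma deg_le_zero [simp]: "deg_le g d 0"
  by (simp add: deg_le_def)

lemma deg_le_add: "deg_le g d P \<Longrightarrow> deg_le g d R \<Longrightarrow> deg_le g d (P + R)"
  using Poly_Mapping.keys_add[of P R] by (auto simp: deg_le_def)

lemma deg_le_diff: "deg_le g d P \<Longrightarrow> deg_le g d R \<Longrightarrow> deg_le g d (P - R)"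
  by (auto simp: deg_le_def in_keys_iff lookup_minus)

lemma deg_le_sum: "(\<And>i. i \<in> A \<Longrightarrow> deg_le g d (P i)) \<Longrightarrow> deg_le g d (sum P A)"
  by (induction A rule: infinite_finite_induct) (auto intro: deg_le_add)

lemma ex_deg_le: "\<exists>d. deg_le g d P"
  unfolding deg_le_def
  by (rule exI[of _ "\<Sum>m\<in>Poly_Mapping.keys P. g m"]) (auto intro: member_le_sum)

text \<open>Two gradings share these rules: \<open>mdeg\<close> for polynomials in the x_j and
  \<open>weight\<close> for polynomials in the power sums.\<close>

locale monom_weight =
  fixes g :: "monom \<Rightarrow> nat"
  assumes zero [simp]: "g 0 = 0"
    and add: "g (m + n) = g m + g n"
begin

lemma deg_le_Const: "deg_le g d (Const c)"
  by (simp add: deg_le_def Const_def)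

lemma deg_le_mult:
  assumes "deg_le g d P" "deg_le g e R"
  shows "deg_le g (d + e) (P * R)"
  unfolding deg_le_def
proof
  fix m assume "m \<in> Poly_Mapping.keys (P * R)"
  then obtain a b where "m = a + b" "a \<in> Poly_Mapping.keys P" "b \<in> Poly_Mapping.keys R"
    using Poly_Mapping.keys_mult[of P R] by blast
  then show "g m \<le> d + e"
    using assms by (auto simp: deg_le_def add intro: add_mono)
qed

lemma deg_le_Const_mult: "deg_le g d P \<Longrightarrow> deg_le g d (Const c * P)"
  using deg_le_mult[OF deg_le_Const[of 0 c]] by simp

lemma deg_le_power: "deg_le g d P \<Longrightarrow> deg_le g (n * d) (P ^ n)"
proof (induction n)
  case 0
  show ?case using deg_le_Const[of 0 1] by simp
qed (auto intro: deg_le_mult)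

lemma deg_le_prod:
  "(\<And>i. i \<in> A \<Longrightarrow> deg_le g (d i) (P i)) \<Longrightarrow> deg_le g (sum d A) (prod P A)"
proof (induction A rule: infinite_finite_induct)
  case (insert i A)
  then show ?case by (auto intro: deg_le_mult)
qed (use deg_le_Const[of 0 1] in auto)

end

text \<open>Variable \<open>i\<close> stands for the power sum of exponent i + 1, so the weight of a
  monomial is the degree in the x_j of the product of power sums that it denotes.\<close>

definition weight :: "monom \<Rightarrow> nat" where
  "weight m = (\<Sum>i\<in>Poly_Mapping.keys m. (i + 1) * Poly_Mapping.lookup m i)"

lemma mdeg_superset:
  assumes "finite A" "Poly_Mapping.keys m \<subseteq> A"
  shows "mdeg m = (\<Sum>i\<in>A. Poly_Mapping.lookup m i)"
  unfolding mdeg_def using assms by (intro sum.mono_neutral_left) (auto simp: in_keys_iff)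

lemma weight_superset:
  assumes "finite A" "Poly_Mapping.keys m \<subseteq> A"
  shows "weight m = (\<Sum>i\<in>A. (i + 1) * Poly_Mapping.lookup m i)"
  unfolding weight_def using assms by (intro sum.mono_neutral_left) (auto simp: in_keys_iff)

interpretation mdeg: monom_weight mdeg
proof
  fix m n :: monom
  let ?A = "Poly_Mapping.keys m \<union> Poly_Mapping.keys n"
  have "Poly_Mapping.keys (m + n) \<subseteq> ?A"
    by (rule Poly_Mapping.keys_add)
  then show "mdeg (m + n) = mdeg m + mdeg n"
    by (simp add: mdeg_superset[of ?A] lookup_add sum.distrib)
qed (simp add: mdeg_def)

interpretation weight: monom_weight weight
proof
  fix m n :: monom
  let ?A = "Poly_Mapping.keys m \<union> Poly_Mapping.keys n"
  have "Poly_Mapping.keys (m + n) \<subseteq> ?A"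
    by (rule Poly_Mapping.keys_add)
  then show "weight (m + n) = weight m + weight n"
    by (simp add: weight_superset[of ?A] lookup_add sum.distrib algebra_simps)
qed (simp add: weight_def)

lemma deg_le_weight_Var: "deg_le weight (i + 1) (Var i)"
  by (simp add: deg_le_def Var_def weight_def)

lemma deg_le_mdeg_Var: "deg_le mdeg 1 (Var i)"
  by (simp add: deg_le_def Var_def mdeg_def)

lemma deg_le_mdeg_subst_psum:
  assumes "deg_le weight d P"
  shows "deg_le mdeg d (subst (psum A) P)"
proof -
  have "deg_le mdeg d (Const c * monom_eval (psum A) m)" if "weight m \<le> d" for c m
  proof -
    have "deg_le mdeg (n * (i + 1)) (psum A i ^ n)" for n i
      using mdeg.deg_le_power[OF deg_le_mdeg_Var, of "i + 1"]
      by (intro mdeg.deg_le_power deg_le_sum) simp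
    then have "deg_le mdeg (weight m) (monom_eval (psum A) m)"
      unfolding weight_def monom_eval_def
      by (intro mdeg.deg_le_prod) (simp only: mult.commute[of "_ + 1"])
    with that show ?thesis
      by (blast intro: mdeg.deg_le_Const_mult deg_le_mono)
  qed
  then show ?thesis
    using assms unfolding mp_eval_def monom_eval_def[symmetric]
    by (intro deg_le_sum) (auto simp: deg_le_def)
qed

section \<open>Coefficients under restriction, renaming and scaling of the variables\<close>

lemma lookup_Const_mult: "Poly_Mapping.lookup (Const c * P) m = c * Poly_Mapping.lookup P m"
  by (induction P rule: mpoly_induct)
    (simp_all add: Const_def mult_single lookup_single when_def lookup_add algebra_simps)

lemma lookup_subst_restrict:
  "Poly_Mapping.lookup (subst (\<lambda>i. if i \<in> S then Var i else 0) Q) m =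
    (if Poly_Mapping.keys m \<subseteq> S then Poly_Mapping.lookup Q m else 0)"
proof (induction Q rule: mpoly_induct)
  case (single n c)
  have "monom_eval (\<lambda>i. if i \<in> S then Var i else 0) n =
      (if Poly_Mapping.keys n \<subseteq> S then Poly_Mapping.single n 1 else 0)"
  proof (cases "Poly_Mapping.keys n \<subseteq> S")
    case True
    then show ?thesis
      unfolding single_eq_monom_eval by (auto simp: monom_eval_def intro!: prod.cong)
  next
    case False
    then obtain i where "i \<in> Poly_Mapping.keys n" "i \<notin> S" by auto
    then have "monom_eval (\<lambda>i. if i \<in> S then Var i else 0) n = 0"
      unfolding monom_eval_def by (intro prod_zero) (auto simp: in_keys_iff)
    with False show ?thesis by simp
  qed
  then show ?case
    by (auto simp: mp_eval_single lookup_Const_mult lookup_single when_def)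
qed (simp add: subst.hom_add lookup_add)

lemma lookup_map_key: "inj \<pi> \<Longrightarrow> Poly_Mapping.lookup (Poly_Mapping.map_key \<pi> m) i = Poly_Mapping.lookup m (\<pi> i)"
  by (simp add: map_key.rep_eq)

text \<open>Renaming moves the exponent at i to position \<open>\<pi> i\<close>, so the monomial
  sent to \<open>m\<close> is m composed with \<pi>. This is the action by which
  \<open>Sym_le\<close> and \<open>sym_poly_le\<close> express symmetry.\<close>

lemma lookup_subst_bij:
  assumes "bij \<pi>"
  shows "Poly_Mapping.lookup (subst (\<lambda>i. Var (\<pi> i)) Q) m =
    Poly_Mapping.lookup Q (Poly_Mapping.map_key \<pi> m)"
proof (induction Q rule: mpoly_induct)
  case (single n c)
  have inj: "inj \<pi>" "inj (inv_into UNIV \<pi>)"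
    using assms by (auto simp: bij_is_inj bij_imp_bij_inv)
  let ?n = "Poly_Mapping.map_key (inv_into UNIV \<pi>) n"
  have keys: "Poly_Mapping.keys ?n = \<pi> ` Poly_Mapping.keys n"
  proof (rule Set.set_eqI)
    fix j
    obtain i where "j = \<pi> i" using assms by (metis bij_pointE)
    then show "j \<in> Poly_Mapping.keys ?n \<longleftrightarrow> j \<in> \<pi> ` Poly_Mapping.keys n"
      using inj by (simp add: in_keys_iff lookup_map_key inj_image_mem_iff)
  qed
  have "monom_eval (\<lambda>i. Var (\<pi> i)) n = Poly_Mapping.single ?n 1"
    unfolding single_eq_monom_eval monom_eval_def keys
    using inj by (simp add: prod.reindex inj_on_subset[OF inj(1)] lookup_map_key)
  moreover have "?n = m \<longleftrightarrow> n = Poly_Mapping.map_key \<pi> m"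
  proof
    assume "?n = m"
    then show "n = Poly_Mapping.map_key \<pi> m"
      using inj by (metis (no_types, lifting) inv_into_f_f UNIV_I lookup_map_key poly_mapping_eqI)
  next
    assume "n = Poly_Mapping.map_key \<pi> m"
    then show "?n = m"
      using inj bij_is_surj[OF assms] by (metis (no_types, lifting) surj_f_inv_f lookup_map_key poly_mapping_eqI)
  qed
  ultimately show ?case
    by (auto simp: mp_eval_single lookup_Const_mult lookup_single when_def)
qed (simp add: subst.hom_add lookup_add)

lemma lookup_subst_scale:
  "Poly_Mapping.lookup (subst (\<lambda>i. Const r * Var i) Q) m = r ^ mdeg m * Poly_Mapping.lookup Q m"
proof (induction Q rule: mpoly_induct)
  case (single n c)
  have "monom_eval (\<lambda>i. Const r * Var i) n = Const (r ^ mdeg n) * Poly_Mapping.single n 1"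
    unfolding single_eq_monom_eval
    by (simp add: monom_eval_def mdeg_def power_mult_distrib prod.distrib power_sum
        Const.hom_prod Const.hom_power)
  then show ?case
    by (auto simp: mp_eval_single lookup_Const_mult lookup_single when_def)
qed (simp add: subst.hom_add lookup_add algebra_simps)

text \<open>The symmetric function that is the polynomial \<open>P\<close> in the power sums. Variables
  outside the support of a monomial do not affect its coefficient.\<close>

definition sym_of :: "mpoly \<Rightarrow> symfun" where
  "sym_of P = (\<lambda>m. Poly_Mapping.lookup (subst (psum (Poly_Mapping.keys m)) P) m)"

text \<open>Setting the variables outside the support of \<open>m\<close> to zero turns
  \<open>psum A\<close> into the power sums of the support and leaves the coefficient of
  \<open>m\<close> alone.\<close>

lemma sym_of_eq:
  assumes "finite A" "Poly_Mapping.keys m \<subseteq> A"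
  shows "sym_of P m = Poly_Mapping.lookup (subst (psum A) P) m"
proof -
  let ?S = "Poly_Mapping.keys m"
  have "subst (\<lambda>i. if i \<in> ?S then Var i else 0) (subst (psum A) P) = subst (psum ?S) P"
  proof -
    have "subst (\<lambda>i. if i \<in> ?S then Var i else 0) (psum A k) = psum ?S k" for k
    proof -
      have "subst (\<lambda>i. if i \<in> ?S then Var i else 0) (psum A k) =
          (\<Sum>j\<in>A. (if j \<in> ?S then Var j else 0) ^ (k + 1))"
        by (simp only: subst.hom_sum subst.hom_power subst_Var)
      also have "\<dots> = (\<Sum>j\<in>A. if j \<in> ?S then Var j ^ (k + 1) else 0)"
        by (rule sum.cong) auto
      also have "\<dots> = psum (A \<inter> ?S) k"
        using assms(1) by (rule sum.inter_restrict[symmetric])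
      also have "A \<inter> ?S = ?S"
        using assms(2) by blast
      finally show ?thesis .
    qed
    then show ?thesis
      by (simp only: subst_subst)
  qed
  then show ?thesis
    unfolding sym_of_def using lookup_subst_restrict[of ?S "subst (psum A) P" m] by simp
qed

lemma sym_of_sum: "sym_of (\<Sum>i\<in>A. P i) m = (\<Sum>i\<in>A. sym_of (P i) m)"
  by (simp add: sym_of_def subst.hom_sum lookup_sum)

lemma sym_of_Const_mult: "sym_of (Const c * P) m = c * sym_of P m"
  by (simp add: sym_of_def subst.hom_mult lookup_Const_mult)

lemma sym_scale_sym_of:
  "sym_scale r (sym_of P) = sym_of (subst (\<lambda>i. Const (r ^ (i + 1)) * Var i) P)"
proof
  fix m :: monom
  let ?A = "Poly_Mapping.keys m"
  have "subst (\<lambda>i. Const r * Var i) (psum ?A k) = Const (r ^ (k + 1)) * psum ?A k" for k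
    by (simp only: subst.hom_sum subst.hom_power subst_Var power_mult_distrib Const.hom_power
        sum_distrib_left)
  then have "subst (psum ?A) (subst (\<lambda>i. Const (r ^ (i + 1)) * Var i) P) =
      subst (\<lambda>i. Const r * Var i) (subst (psum ?A) P)"
    by (simp only: subst_subst subst_Const_mult subst_Var)
  then show "sym_scale r (sym_of P) m = sym_of (subst (\<lambda>i. Const (r ^ (i + 1)) * Var i) P) m"
    unfolding sym_scale_def sym_of_def by (simp only: lookup_subst_scale)
qed

lemma sym_of_in_Sym_le:
  assumes "deg_le weight d P"
  shows "sym_of P \<in> Sym_le d"
  unfolding Sym_le_def
proof (intro CollectI conjI allI impI)
  fix m :: monom assume "sym_of P m \<noteq> 0"
  then show "mdeg m \<le> d"
    using deg_le_mdeg_subst_psum[OF assms, of "Poly_Mapping.keys m"]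
    by (auto simp: sym_of_def deg_le_def in_keys_iff)
next
  fix \<pi> :: "nat \<Rightarrow> nat" and m :: monom assume bij: "bij \<pi>"
  let ?m = "Poly_Mapping.map_key \<pi> m"
  let ?A = "Poly_Mapping.keys ?m"
  have inj: "inj \<pi>" using bij by (rule bij_is_inj)
  have "subst (\<lambda>i. Var (\<pi> i)) (psum ?A k) = psum (\<pi> ` ?A) k" for k
    using inj by (subst sum.reindex) (auto simp: subst.hom_sum subst.hom_power subst.hom_mult inj_on_def)
  then have "subst (\<lambda>i. Var (\<pi> i)) (subst (psum ?A) P) = subst (psum (\<pi> ` ?A)) P"
    by (simp only: subst_subst)
  then have "sym_of P ?m = Poly_Mapping.lookup (subst (psum (\<pi> ` ?A)) P) m"
    unfolding sym_of_def using lookup_subst_bij[OF bij, of "subst (psum ?A) P" m] by (simp only:)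
  also have "\<dots> = sym_of P m"
  proof (rule sym_of_eq[symmetric])
    show "Poly_Mapping.keys m \<subseteq> \<pi> ` ?A"
    proof
      fix j assume "j \<in> Poly_Mapping.keys m"
      moreover obtain i where "j = \<pi> i" using bij by (metis bij_pointE)
      ultimately show "j \<in> \<pi> ` ?A" by (auto simp: in_keys_iff lookup_map_key[OF inj])
    qed
  qed auto
  finally show "sym_of P ?m = sym_of P m" .
qed

section \<open>Restriction to finitely many variables and its inverse\<close>

lemma finite_monoms_mdeg_le: "finite {m. Poly_Mapping.keys m \<subseteq> {..<N} \<and> mdeg m \<le> d}"
proof -
  let ?M = "{m. Poly_Mapping.keys m \<subseteq> {..<N} \<and> mdeg m \<le> d}"
  have "Poly_Mapping.lookup m i \<le> mdeg m" for m i
  proof (cases "i \<in> Poly_Mapping.keys m")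
    case True
    then show ?thesis unfolding mdeg_def by (rule member_le_sum) simp_all
  next
    case False
    then show ?thesis by (simp add: in_keys_iff)
  qed
  then have "Poly_Mapping.lookup ` ?M \<subseteq>
      {f. \<forall>i. (i \<in> {..<N} \<longrightarrow> f i \<in> {..d}) \<and> (i \<notin> {..<N} \<longrightarrow> f i = 0)}"
  proof (intro subsetI CollectI allI conjI impI)
    fix f i assume "f \<in> Poly_Mapping.lookup ` ?M"
    then obtain m where m: "f = Poly_Mapping.lookup m" "m \<in> ?M" by blast
    then have "f i \<le> mdeg m" "mdeg m \<le> d"
      using \<open>\<And>m i. Poly_Mapping.lookup m i \<le> mdeg m\<close> by auto
    then show "f i \<in> {..d}" by simp
    assume "i \<notin> {..<N}"
    then have "i \<notin> Poly_Mapping.keys m" using m(2) by blast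
    then show "f i = 0" using m(1) by (simp add: in_keys_iff)
  qed
  moreover have "finite {f. \<forall>i. (i \<in> {..<N} \<longrightarrow> f i \<in> {..d}) \<and> (i \<notin> {..<N} \<longrightarrow> f i = (0::nat))}"
    by (rule finite_set_of_finite_funs) auto
  ultimately have "finite (Poly_Mapping.lookup ` ?M)"
    by (rule finite_subset)
  then show ?thesis
    by (rule finite_imageD) (rule inj_onI, simp only: poly_mapping_eq_iff)
qed

text \<open>Bounded degree leaves finitely many monomials in \<open>N\<close> variables, so
  \<open>Abs_poly_mapping\<close> in \<open>sym_restrict\<close> is applied to a function of finite
  support.\<close>

lemma lookup_sym_restrict:
  assumes "F \<in> Sym_le d"
  shows "Poly_Mapping.lookup (sym_restrict N F) m =
    (if Poly_Mapping.keys m \<subseteq> {..<N} then F m else 0)"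
proof -
  have "finite {m. (if Poly_Mapping.keys m \<subseteq> {..<N} then F m else 0) \<noteq> 0}"
    by (rule finite_subset[OF _ finite_monoms_mdeg_le[of N d]])
      (use assms in \<open>auto simp: Sym_le_def split: if_splits\<close>)
  then show ?thesis
    unfolding sym_restrict_def by simp
qed

lemma sym_restrict_sym_of: "sym_restrict N (sym_of P) = subst (psum {..<N}) P"
proof (rule poly_mapping_eqI)
  fix m :: monom
  obtain d where "deg_le weight d P"
    using ex_deg_le by blast
  then have F: "sym_of P \<in> Sym_le d"
    by (rule sym_of_in_Sym_le)
  have "subst (\<lambda>i. if i \<in> {..<N} then Var i else 0) (psum {..<N} k) = psum {..<N} k" for k
    by (simp only: subst.hom_sum subst.hom_power subst_Var) simp
  then have "subst (\<lambda>i. if i \<in> {..<N} then Var i else 0) (subst (psum {..<N}) P) = subst (psum {..<N}) P"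
    by (simp only: subst_subst)
  then have eq: "Poly_Mapping.lookup (subst (psum {..<N}) P) m =
      (if Poly_Mapping.keys m \<subseteq> {..<N} then Poly_Mapping.lookup (subst (psum {..<N}) P) m else 0)"
    using lookup_subst_restrict[of "{..<N}" "subst (psum {..<N}) P" m] by (simp only:)
  show "Poly_Mapping.lookup (sym_restrict N (sym_of P)) m =
      Poly_Mapping.lookup (subst (psum {..<N}) P) m"
  proof (cases "Poly_Mapping.keys m \<subseteq> {..<N}")
    case True
    show ?thesis
      unfolding lookup_sym_restrict[OF F] if_P[OF True] by (rule sym_of_eq[OF finite_lessThan True])
  next
    case False
    show ?thesis
      unfolding lookup_sym_restrict[OF F] if_not_P[OF False]
      using eq unfolding if_not_P[OF False] by (rule sym)
  qed
qed

text \<open>A bijection of \<open>A\<close> onto an initial segment is extended by matching the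
  enumerations of the two infinite complements. A bijection of all indices is required because
  \<open>Sym_le\<close> speaks of invariance under those.\<close>

lemma ex_bij_image_subset_lessThan:
  fixes A :: "nat set"
  assumes "finite A" "card A \<le> N"
  shows "\<exists>\<pi>. bij \<pi> \<and> \<pi> ` A \<subseteq> {..<N}"
proof -
  let ?B = "{0..<card A}"
  obtain f where f: "bij_betw f A ?B"
    using ex_bij_betw_finite_nat[OF assms(1)] by blast
  have inf: "infinite (- A)" "infinite (- ?B)"
    using assms(1) by (simp_all only: finite_compl infinite_UNIV_nat finite_atLeastLessThan not_False_eq_True)
  obtain g where g: "bij_betw g (- A) (- ?B)"
    using bij_betw_trans[OF bij_betw_inv_into[OF bij_enumerate[OF inf(1)]] bij_enumerate[OF inf(2)]]
    by blast
  define \<pi> where "\<pi> i = (if i \<in> A then f i else g i)" for i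
  have 1: "bij_betw \<pi> A ?B"
    using f bij_betw_cong[of A \<pi> f ?B] by (simp add: \<pi>_def)
  have 2: "bij_betw \<pi> (- A) (- ?B)"
    using g bij_betw_cong[of "- A" \<pi> g "- ?B"] by (simp add: \<pi>_def)
  have "bij_betw \<pi> (A \<union> - A) (?B \<union> - ?B)"
    by (rule bij_betw_combine[OF 1 2]) auto
  then have "bij \<pi>" by (simp only: Compl_partition)
  moreover have "\<pi> ` A \<subseteq> {..<N}"
    unfolding bij_betw_imp_surj_on[OF 1] using assms(2) by (simp add: atLeast0LessThan)
  ultimately show ?thesis by (intro exI conjI)
qed

text \<open>A monomial of degree at most \<open>d\<close> involves at most \<open>d\<close>
  variables, and a permutation moves these among the first \<open>N\<close>, where the restriction
  shows its coefficient. Hence \<open>inv_into\<close> in \<open>sym_iota\<close> recovers the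
  symmetric function.\<close>

lemma inj_on_sym_restrict:
  assumes "d \<le> N"
  shows "inj_on (sym_restrict N) (Sym_le d)"
proof (rule inj_onI, rule ext)
  fix F G and m :: monom assume F: "F \<in> Sym_le d" and G: "G \<in> Sym_le d"
    and eq: "sym_restrict N F = sym_restrict N G"
  show "F m = G m"
  proof (cases "mdeg m \<le> d")
    case False
    then have "F m = 0" "G m = 0"
      using F G unfolding Sym_le_def by blast+
    then show ?thesis by simp
  next
    case True
    have "card (Poly_Mapping.keys m) \<le> mdeg m"
      unfolding mdeg_def card_eq_sum by (intro sum_mono) (auto simp: in_keys_iff)
    then obtain \<pi> where \<pi>: "bij \<pi>" "\<pi> ` Poly_Mapping.keys m \<subseteq> {..<N}"
      using ex_bij_image_subset_lessThan[of "Poly_Mapping.keys m" N] True assms by auto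
    let ?m = "Poly_Mapping.map_key (inv_into UNIV \<pi>) m"
    have inv: "bij (inv_into UNIV \<pi>)" using \<pi>(1) by (rule bij_imp_bij_inv)
    have keys: "Poly_Mapping.keys ?m \<subseteq> {..<N}"
    proof
      fix i assume "i \<in> Poly_Mapping.keys ?m"
      then have "inv_into UNIV \<pi> i \<in> Poly_Mapping.keys m"
        by (simp add: in_keys_iff lookup_map_key[OF bij_is_inj[OF inv]])
      then have "\<pi> (inv_into UNIV \<pi> i) \<in> {..<N}" using \<pi>(2) by blast
      then show "i \<in> {..<N}" using \<pi>(1) by (simp add: bij_is_surj surj_f_inv_f)
    qed
    have "F ?m = G ?m"
      using lookup_sym_restrict[OF F, of N ?m] lookup_sym_restrict[OF G, of N ?m] keys eq
      by (metis (no_types))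
    moreover have "F ?m = F m" "G ?m = G m"
      using F G inv unfolding Sym_le_def by blast+
    ultimately show ?thesis by metis
  qed
qed

text \<open>Convergence in the sense of \<open>sym_converges\<close> is thereby reduced to
  convergence of the polynomials in the power sums.\<close>

lemma sym_iota_subst_psum:
  assumes "deg_le weight d P" "d \<le> N"
  shows "sym_iota d N (subst (psum {..<N}) P) = sym_of P"
  unfolding sym_iota_def sym_restrict_sym_of[symmetric]
  by (rule inv_into_f_f[OF inj_on_sym_restrict[OF assms(2)] sym_of_in_Sym_le[OF assms(1)]])

lemma subst_psum_in_sym_poly_le:
  assumes "deg_le weight d P"
  shows "subst (psum {..<N}) P \<in> sym_poly_le N d"
  unfolding sym_poly_le_def
proof (intro CollectI conjI ballI allI impI)
  fix m :: monom assume m: "m \<in> Poly_Mapping.keys (subst (psum {..<N}) P)"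
  then show "mdeg m \<le> d"
    using deg_le_mdeg_subst_psum[OF assms, of "{..<N}"] by (auto simp: deg_le_def)
  show "Poly_Mapping.keys m \<subseteq> {..<N}"
    using m unfolding sym_restrict_sym_of[symmetric] in_keys_iff[of m]
      lookup_sym_restrict[OF sym_of_in_Sym_le[OF assms]]
    by (auto split: if_splits)
next
  fix \<pi> and m :: monom assume \<pi>: "\<pi> permutes {..<N}"
  have "subst (\<lambda>i. Var (\<pi> i)) (psum {..<N} k) = psum {..<N} k" for k
  proof -
    have "subst (\<lambda>i. Var (\<pi> i)) (psum {..<N} k) = (\<Sum>j<N. Var (\<pi> j) ^ (k + 1))"
      by (simp only: subst.hom_sum subst.hom_power subst_Var)
    also have "\<dots> = (\<Sum>j<N. Var j ^ (k + 1))"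
      by (rule sum.permute[OF \<pi>, unfolded o_def, symmetric])
    finally show ?thesis .
  qed
  then have "subst (\<lambda>i. Var (\<pi> i)) (subst (psum {..<N}) P) = subst (psum {..<N}) P"
    by (simp only: subst_subst)
  then show "Poly_Mapping.lookup (subst (psum {..<N}) P) (Poly_Mapping.map_key \<pi> m) =
      Poly_Mapping.lookup (subst (psum {..<N}) P) m"
    using lookup_subst_bij[OF permutes_bij[OF \<pi>], of "subst (psum {..<N}) P" m] by (simp only:)
qed

lemma power_sum_expr_sym_of: "power_sum_expr (sym_of P) = P"
  unfolding power_sum_expr_def sym_restrict_sym_of
proof (rule the_equality)
  fix R assume eq: "\<forall>N. subst (psum {..<N}) P = subst (psum {..<N}) R"
  have "P = R"
    by (rule power_sums_alg_independent) (rule eq[rule_format])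
  then show "R = P" ..
qed (intro allI refl)

lemma sym_eval_sym_of: "sym_eval (sym_of P) X = eval_at (\<lambda>i. power_sum (i + 1) X) P"
  unfolding sym_eval_def power_sum_expr_sym_of by (rule refl)

section \<open>Jacobi--Trudi determinants for interpolation polynomials\<close>

text \<open>With u the formal variable this is 1 - x u, and \<open>fps_geo x\<close> is its inverse.
  The inverse is given by its coefficients because the ring need not be a field.\<close>

definition fps_lin :: "'a::comm_ring_1 \<Rightarrow> 'a fps" where
  "fps_lin x = 1 - fps_const x * fps_X"

definition fps_geo :: "'a::comm_ring_1 \<Rightarrow> 'a fps" where
  "fps_geo x = Abs_fps (\<lambda>n. x ^ n)"

lemma fps_lin_nth: "fps_nth (fps_lin x) n = (if n = 0 then 1 else if n = 1 then - x else 0)"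
  by (auto simp: fps_lin_def fps_X_nth)

lemma fps_lin_mult_nth:
  "fps_nth (fps_lin x * F) (Suc n) = fps_nth F (Suc n) - x * fps_nth F n"
  by (simp add: fps_lin_def left_diff_distrib mult.assoc)

lemma fps_lin_mult_geo: "fps_lin x * fps_geo x = 1"
proof (rule fps_ext)
  fix n show "fps_nth (fps_lin x * fps_geo x) n = fps_nth 1 n"
    by (cases n) (simp_all add: fps_lin_mult_nth fps_lin_nth fps_geo_def)
qed

text \<open>Multiplying by 1 - c u replaces the coefficient F_r by F_r - c F_(r-1), so each factor
  trades one power of x for x - c. The coefficients below index \<open>n\<close> follow another
  pattern, hence the restriction on \<open>r\<close>.\<close>

lemma fps_prod_lin_mult_geo_nth_ge:
  "n \<le> r \<Longrightarrow> fps_nth ((\<Prod>l<n. fps_lin (c l)) * fps_geo x) r = x ^ (r - n) * (\<Prod>l<n. x - c l)"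
proof (induction n arbitrary: r)
  case (Suc n)
  then obtain s where r: "r = Suc s" "n \<le> s"
    by (cases r) auto
  have "(\<Prod>l<Suc n. fps_lin (c l)) * fps_geo x = fps_lin (c n) * ((\<Prod>l<n. fps_lin (c l)) * fps_geo x)"
    by (simp only: prod.lessThan_Suc mult_ac)
  then have "fps_nth ((\<Prod>l<Suc n. fps_lin (c l)) * fps_geo x) r =
      x ^ (Suc s - n) * (\<Prod>l<n. x - c l) - c n * (x ^ (s - n) * (\<Prod>l<n. x - c l))"
    using r Suc.IH[of "Suc s"] Suc.IH[of s] by (simp only: fps_lin_mult_nth)
  with r show ?case
    by (simp add: Suc_diff_le algebra_simps)
qed (simp add: fps_geo_def)

lemma fps_prod_lin_mult_geo_nth:
  "fps_nth ((\<Prod>l<n. fps_lin (c l)) * fps_geo x) n = (\<Prod>l<n. x - c l)"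
  using fps_prod_lin_mult_geo_nth_ge[of n n c x] by simp

lemma fps_prod_lin_nth_eq_0:
  assumes "finite A" "card A < m"
  shows "fps_nth (\<Prod>l\<in>A. fps_lin (c l)) m = 0"
  using assms
proof (induction arbitrary: m rule: finite_induct)
  case (insert a A)
  then obtain n where "m = Suc n" by (cases m) auto
  with insert show ?case by (simp add: fps_lin_mult_nth)
qed simp

lemma fps_nth_0_prod: "fps_nth (prod F A) 0 = (\<Prod>a\<in>A. fps_nth (F a) 0)"
  by (induction A rule: infinite_finite_induct) auto

text \<open>The complete symmetric function h_m of the difference of the alphabets x and c.\<close>

definition bialt_coeff :: "nat \<Rightarrow> (nat \<Rightarrow> 'a) \<Rightarrow> nat \<Rightarrow> (nat \<Rightarrow> 'a) \<Rightarrow> nat \<Rightarrow> 'a::comm_ring_1" where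
  "bialt_coeff N x n c m = fps_nth ((\<Prod>l<n. fps_lin (c l)) * (\<Prod>l<N. fps_geo (x l))) m"

text \<open>Up to the sign (-1)^m, the elementary symmetric polynomial e_m in the variables other
  than x_k.\<close>

definition omit_elem :: "nat \<Rightarrow> (nat \<Rightarrow> 'a) \<Rightarrow> nat \<Rightarrow> nat \<Rightarrow> 'a::comm_ring_1" where
  "omit_elem N x k m = fps_nth (\<Prod>l\<in>{..<N} - {k}. fps_lin (x l)) m"

lemma bialt_coeff_0: "bialt_coeff N x n c 0 = 1"
  by (simp add: bialt_coeff_def fps_nth_0_prod fps_lin_nth fps_geo_def)

text \<open>Each factor $1/(1 - x_k u)$ of the generating function of the complete symmetric
  polynomials is recovered by multiplying with the $1 - x_l u$, $l \neq k$.\<close>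

lemma prod_diff_eq_sum:
  fixes x :: "nat \<Rightarrow> 'a::comm_ring_1"
  assumes "k < N"
  shows "(\<Prod>l<n. x k - c l) =
    (\<Sum>j<N. (if N - 1 - j \<le> n then bialt_coeff N x n c (n - (N - 1 - j)) else 0) *
      omit_elem N x k (N - 1 - j))"
proof -
  define C where "C = (\<Prod>l<n. fps_lin (c l))"
  define H where "H = (\<Prod>l<N. fps_geo (x l))"
  define E where "E = (\<Prod>l\<in>{..<N} - {k}. fps_lin (x l))"
  have "H = fps_geo (x k) * (\<Prod>l\<in>{..<N} - {k}. fps_geo (x l))"
    unfolding H_def using assms by (intro prod.remove) auto
  moreover have "E * (\<Prod>l\<in>{..<N} - {k}. fps_geo (x l)) = 1"
    unfolding E_def by (simp add: fps_lin_mult_geo flip: prod.distrib)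
  ultimately have geo: "fps_geo (x k) = E * H"
    by (metis mult.left_commute mult.right_neutral)
  \<comment> \<open>\<open>E\<close> has only N - 1 linear factors, which allows the summation range
    m \<le> n to be exchanged for m < N.\<close>
  have E0: "fps_nth E m = 0" if "N \<le> m" for m
    unfolding E_def using that assms by (intro fps_prod_lin_nth_eq_0) auto
  have "(\<Prod>l<n. x k - c l) = fps_nth (E * (C * H)) n"
    unfolding fps_prod_lin_mult_geo_nth[symmetric] C_def[symmetric] geo by (simp only: mult.left_commute)
  also have "\<dots> = (\<Sum>m=0..n. fps_nth E m * fps_nth (C * H) (n - m))"
    by (rule fps_mult_nth)
  also have "\<dots> = (\<Sum>m\<in>{..<N} \<union> {0..n}. (if m \<le> n then fps_nth (C * H) (n - m) else 0) * fps_nth E m)"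
    by (intro sum.mono_neutral_cong_left) auto
  also have "\<dots> = (\<Sum>m<N. (if m \<le> n then fps_nth (C * H) (n - m) else 0) * fps_nth E m)"
    by (intro sum.mono_neutral_right) (auto simp: E0)
  \<comment> \<open>The reversal m = N - 1 - j is chosen so that \<open>bialt_mat\<close> is upper
    unitriangular when \<open>n i\<close> is N - 1 - i.\<close>
  also have "\<dots> = (\<Sum>j<N. (if N - 1 - j \<le> n then fps_nth (C * H) (n - (N - 1 - j)) else 0) *
      fps_nth E (N - 1 - j))"
    by (subst sum.nat_diff_reindex[symmetric]) (simp cong: if_cong)
  finally show ?thesis
    by (simp only: bialt_coeff_def omit_elem_def C_def H_def E_def)
qed

abbreviation bialt_mat :: "nat \<Rightarrow> (nat \<Rightarrow> 'a) \<Rightarrow> (nat \<Rightarrow> nat) \<Rightarrow> (nat \<Rightarrow> nat \<Rightarrow> 'a) \<Rightarrow> 'a::comm_ring_1 mat" where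
  "bialt_mat N x n c \<equiv> mat N N (\<lambda>(i, j).
     if N - 1 - j \<le> n i then bialt_coeff N x (n i) (c i) (n i - (N - 1 - j)) else 0)"

text \<open>The expansion \<open>prod_diff_eq_sum\<close> is a matrix product whose second factor
  depends neither on the exponents nor on the nodes. Every row may have nodes of its own, a freedom
  that \<open>det_omit_elem\<close> exploits.\<close>

lemma det_bialternant_factor:
  fixes x :: "nat \<Rightarrow> 'a::comm_ring_1"
  shows "det (mat N N (\<lambda>(i, k). \<Prod>l<n i. x k - c i l)) =
    det (bialt_mat N x n c) * det (mat N N (\<lambda>(j, k). omit_elem N x k (N - 1 - j)))"
proof -
  let ?E = "mat N N (\<lambda>(j, k). omit_elem N x k (N - 1 - j))"
  have "mat N N (\<lambda>(i, k). \<Prod>l<n i. x k - c i l) = bialt_mat N x n c * ?E"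
    by (rule eq_matI) (auto simp: scalar_prod_def prod_diff_eq_sum atLeast0LessThan)
  then show ?thesis
    by (simp add: det_mult[of _ N])
qed

lemma det_upper_unitriangular:
  fixes A :: "'a::comm_ring_1 mat"
  assumes "A \<in> carrier_mat n n"
    and "\<And>i j. j < i \<Longrightarrow> i < n \<Longrightarrow> A $$ (i, j) = 0" "\<And>i. i < n \<Longrightarrow> A $$ (i, i) = 1"
  shows "det A = 1"
proof -
  have "upper_triangular A"
    using assms by (intro upper_triangularI) auto
  then have "det A = (\<Prod>i = 0..<dim_row A. A $$ (i, i))"
    using det_upper_triangular[OF _ assms(1)] by (simp add: prod_list_diag_prod)
  then show ?thesis
    using assms by simp
qed

text \<open>As this matrix is the same for all nodes, one convenient choice evaluates it: with the
  nodes x_(i+1), ..., x_(N-1) in row i, the left side of \<open>det_bialternant_factor\<close> is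
  lower triangular and \<open>bialt_mat\<close> is unitriangular.\<close>

lemma det_omit_elem:
  fixes x :: "nat \<Rightarrow> 'a::comm_ring_1"
  shows "det (mat N N (\<lambda>(j, k). omit_elem N x k (N - 1 - j))) = (\<Prod>j<N. \<Prod>i<j. x i - x j)"
proof -
  define n where "n i = N - 1 - i" for i
  define c where "c i l = x (i + 1 + l)" for i l
  let ?L = "mat N N (\<lambda>(i, k). \<Prod>l<n i. x k - c i l)"
  have "det (bialt_mat N x n c) = 1"
    by (rule det_upper_unitriangular[of _ N]) (auto simp: n_def bialt_coeff_0)
  then have "det (mat N N (\<lambda>(j, k). omit_elem N x k (N - 1 - j))) = det ?L"
    using det_bialternant_factor[where N = N and n = n and x = x and c = c] by (simp cong: if_cong)
  also have "\<dots> = prod_list (diag_mat ?L)"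
  proof (rule det_lower_triangular)
    fix i j assume ij: "i < j" "j < N"
    have "(\<Prod>l<n i. x j - c i l) = 0"
      by (rule prod_zero) (use ij in \<open>auto simp: n_def c_def intro!: bexI[of _ "j - i - 1"]\<close>)
    with ij show "?L $$ (i, j) = 0" by simp
  qed simp
  also have "\<dots> = (\<Prod>i<N. \<Prod>l<n i. x i - c i l)"
    by (simp add: prod_list_diag_prod atLeast0LessThan)
  also have "\<dots> = (\<Prod>i<N. \<Prod>j=Suc i..<N. x i - x j)"
  proof (rule prod.cong)
    fix i assume "i \<in> {..<N}"
    show "(\<Prod>l<n i. x i - c i l) = (\<Prod>j=Suc i..<N. x i - x j)"
      by (rule prod.reindex_bij_witness[of _ "\<lambda>j. j - Suc i" "\<lambda>l. Suc i + l"])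
        (auto simp: n_def c_def)
  qed simp
  also have "\<dots> = (\<Prod>j<N. \<Prod>i<j. x i - x j)"
    by (induction N) (simp_all add: prod.distrib prod.atLeastLessThan_Suc)
  finally show ?thesis .
qed

text \<open>Row \<open>i\<close> of the bialternant matrix is trivial for \<open>i \<ge> l\<close>, so a Jacobi--Trudi
  determinant of fixed size \<open>l\<close> remains.\<close>

lemma det_bialternant:
  fixes x :: "nat \<Rightarrow> 'a::idom"
  assumes "l \<le> N" "\<And>i. l \<le> i \<Longrightarrow> p i = 0"
  shows "det (mat N N (\<lambda>(i, k). \<Prod>r<p i + (N - 1 - i). x k - c i r)) =
    det (mat l l (\<lambda>(i, j). if i \<le> p i + j
      then bialt_coeff N x (p i + (N - 1 - i)) (c i) (p i + j - i) else 0)) *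
    (\<Prod>j<N. \<Prod>i<j. x i - x j)"
proof -
  define n where "n i = p i + (N - 1 - i)" for i
  let ?A = "bialt_mat N x n c"
  let ?A1 = "mat l l (\<lambda>(i, j). if i \<le> p i + j
      then bialt_coeff N x (p i + (N - 1 - i)) (c i) (p i + j - i) else 0)"
  let ?A2 = "mat l (N - l) (\<lambda>(i, j). ?A $$ (i, j + l))"
  let ?A4 = "mat (N - l) (N - l) (\<lambda>(i, j). ?A $$ (i + l, j + l))"
  have "?A = four_block_mat ?A1 ?A2 (0\<^sub>m (N - l) l) ?A4"
  proof (rule eq_matI)
    fix i j assume "i < dim_row (four_block_mat ?A1 ?A2 (0\<^sub>m (N - l) l) ?A4)"
      "j < dim_col (four_block_mat ?A1 ?A2 (0\<^sub>m (N - l) l) ?A4)"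
    then have ij: "i < N" "j < N" using assms(1) by auto
    show "?A $$ (i, j) = four_block_mat ?A1 ?A2 (0\<^sub>m (N - l) l) ?A4 $$ (i, j)"
    proof (cases "i < l \<and> j < l")
      case True
      then have "N - 1 - j \<le> n i \<longleftrightarrow> i \<le> p i + j" "n i - (N - 1 - j) = p i + j - i"
        using ij by (auto simp: n_def)
      then show ?thesis using True ij assms(1) by (simp add: n_def)
    next
      case False
      then show ?thesis using ij assms by (auto simp: n_def)
    qed
  qed (use assms(1) in auto)
  then have "det ?A = det (four_block_mat ?A1 ?A2 (0\<^sub>m (N - l) l) ?A4)"
    by (rule arg_cong)
  also have "\<dots> = det ?A1 * det ?A4"
    by (rule det_four_block_mat_lower_left_zero[of _ l _ "N - l"]) auto
  also have "det ?A4 = 1"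
    by (rule det_upper_unitriangular[of _ "N - l"]) (auto simp: n_def assms bialt_coeff_0)
  finally have "det ?A = det ?A1" by simp
  then show ?thesis
    unfolding n_def using det_bialternant_factor[where N = N and n = n and x = x and c = c]
    by (simp only: det_omit_elem n_def)
qed

text \<open>With \<open>a i\<close> the power sum p_(i+1), this is Newton's identity n h_n = p_1
  h_(n-1) + ... + p_n h_0.\<close>

fun newton_seq :: "(nat \<Rightarrow> mpoly) \<Rightarrow> nat \<Rightarrow> mpoly" where
  "newton_seq a 0 = 1"
| "newton_seq a (Suc n) = Const (1 / of_nat (Suc n)) * (\<Sum>i\<le>n. a i * newton_seq a (n - i))"

lemma fps_nth_eq_newton_seq:
  assumes "fps_nth F 0 = 1" "fps_deriv F = Abs_fps a * F"
  shows "fps_nth F n = newton_seq a n"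
proof (induction n rule: less_induct)
  case (less n)
  show ?case
  proof (cases n)
    case 0
    with assms(1) show ?thesis by simp
  next
    case (Suc m)
    have "of_nat (Suc m) * fps_nth F (Suc m) = fps_nth (fps_deriv F) m"
      by simp
    also have "\<dots> = (\<Sum>i\<le>m. a i * fps_nth F (m - i))"
      unfolding assms(2) by (simp add: fps_mult_nth atLeast0AtMost)
    also have "\<dots> = (\<Sum>i\<le>m. a i * newton_seq a (m - i))"
      by (rule sum.cong) (auto simp: less Suc)
    finally have "newton_seq a (Suc m) =
        Const (1 / of_nat (Suc m)) * (of_nat (Suc m) * fps_nth F (Suc m))"
      by simp
    also have "\<dots> = Const (1 / of_nat (Suc m) * of_nat (Suc m)) * fps_nth F (Suc m)"
      by (simp only: Const.hom_mult Const.hom_of_nat mult.assoc)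
    finally show ?thesis using Suc by (simp del: of_nat_Suc)
  qed
qed

lemma fps_deriv_geo: "fps_deriv (fps_geo x) = (fps_const x * fps_geo x) * fps_geo (x::'a::comm_ring_1)"
proof -
  have "fps_deriv (fps_lin x * fps_geo x) = 0"
    by (simp add: fps_lin_mult_geo)
  then have "fps_lin x * fps_deriv (fps_geo x) = fps_const x * fps_geo x"
    by (simp add: fps_lin_def algebra_simps)
  then have eq: "fps_geo x * (fps_lin x * fps_deriv (fps_geo x)) = fps_geo x * (fps_const x * fps_geo x)"
    by (rule arg_cong)
  have "fps_deriv (fps_geo x) = (fps_lin x * fps_geo x) * fps_deriv (fps_geo x)"
    by (simp add: fps_lin_mult_geo)
  also have "\<dots> = fps_geo x * (fps_lin x * fps_deriv (fps_geo x))"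
    by (simp only: mult_ac)
  finally show ?thesis
    unfolding eq by (simp only: mult_ac)
qed

lemma fps_deriv_lin: "fps_deriv (fps_lin x) = (- (fps_const x * fps_geo x)) * fps_lin (x::'a::comm_ring_1)"
proof -
  have "(- (fps_const x * fps_geo x)) * fps_lin x = - (fps_const x * (fps_lin x * fps_geo x))"
    by (simp only: mult_minus_left mult.assoc mult.commute[of "fps_lin x" "fps_geo x"])
  then show ?thesis
    by (simp only: fps_lin_mult_geo) (simp add: fps_lin_def)
qed

lemma fps_deriv_prod_log:
  fixes F :: "'i \<Rightarrow> 'a::comm_ring_1 fps"
  assumes "\<And>i. i \<in> I \<Longrightarrow> fps_deriv (F i) = G i * F i"
  shows "fps_deriv (prod F I) = sum G I * prod F I"
  using assms by (induction I rule: infinite_finite_induct) (auto simp: algebra_simps)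

text \<open>The logarithmic derivative of 1/(1 - x u) is x/(1 - x u), with coefficients x^(k+1), and
  a factor 1 - c u contributes -c^(k+1). Newton's recursion is the resulting equation F' = A F read
  off coefficient by coefficient.\<close>

lemma bialt_coeff_eq_newton_seq:
  "bialt_coeff N x n c m = newton_seq (\<lambda>k. (\<Sum>l<N. x l ^ (k + 1)) - (\<Sum>l<n. c l ^ (k + 1))) m"
proof -
  let ?C = "\<Prod>l<n. fps_lin (c l)" and ?H = "\<Prod>l<N. fps_geo (x l)"
  have "fps_deriv (?C * ?H) = ((\<Sum>l<n. - (fps_const (c l) * fps_geo (c l))) * ?C) * ?H +
      ?C * ((\<Sum>l<N. fps_const (x l) * fps_geo (x l)) * ?H)"
    by (simp add: fps_deriv_prod_log[OF fps_deriv_lin] fps_deriv_prod_log[OF fps_deriv_geo])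
  also have "\<dots> = ((\<Sum>l<N. fps_const (x l) * fps_geo (x l)) -
      (\<Sum>l<n. fps_const (c l) * fps_geo (c l))) * (?C * ?H)"
    by (simp add: sum_negf algebra_simps)
  also have "(\<Sum>l<N. fps_const (x l) * fps_geo (x l)) - (\<Sum>l<n. fps_const (c l) * fps_geo (c l)) =
      Abs_fps (\<lambda>k. (\<Sum>l<N. x l ^ (k + 1)) - (\<Sum>l<n. c l ^ (k + 1)))"
    by (rule fps_ext) (simp add: fps_sum_nth fps_geo_def)
  finally show ?thesis
    unfolding bialt_coeff_def
    by (intro fps_nth_eq_newton_seq) (simp_all add: fps_nth_0_prod fps_lin_nth fps_geo_def)
qed

lemma subst_newton_seq: "subst f (newton_seq a n) = newton_seq (\<lambda>k. subst f (a k)) n"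
proof (induction n rule: less_induct)
  case (less n)
  show ?case
  proof (cases n)
    case (Suc m)
    have "subst f (\<Sum>i\<le>m. a i * newton_seq a (m - i)) =
        (\<Sum>i\<le>m. subst f (a i) * newton_seq (\<lambda>k. subst f (a k)) (m - i))"
      unfolding subst.hom_sum subst.hom_mult by (rule sum.cong) (simp_all add: less Suc)
    then show ?thesis
      by (simp only: Suc newton_seq.simps subst_Const_mult)
  qed simp
qed

text \<open>\<open>\<pi> i k\<close> is the power sum $p_{k+1}$ of the nodes in row \<open>i\<close>.\<close>

definition interp_det :: "nat list \<Rightarrow> (nat \<Rightarrow> nat \<Rightarrow> complex) \<Rightarrow> mpoly" where
  "interp_det \<mu> \<pi> = Determinant.det (mat (length \<mu>) (length \<mu>) (\<lambda>(i, j).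
     if i \<le> part \<mu> i + j
     then newton_seq (\<lambda>k. Var k - Const (\<pi> i k)) (part \<mu> i + j - i) else 0))"

lemma vandermonde_nonzero: "vandermonde N \<noteq> 0"
proof -
  have "Var i - Var j \<noteq> 0" if "i < j" for i j
  proof
    assume "Var i - Var j = 0"
    then have "eval_at (\<lambda>k. if k = i then 1 else 0) (Var i - Var j) = 0"
      by simp
    with that show False
      by (simp add: eval_at.hom_minus)
  qed
  then show ?thesis
    unfolding vandermonde_def by simp
qed

text \<open>The determinant keeps the size \<open>length \<mu>\<close> for all \<open>N\<close>; the
  number of variables enters only through the power sums of the variables and those of the nodes
  used in each row. This is what makes the limit accessible.\<close>

lemma interp_poly_eq:
  assumes "length \<mu> \<le> N"
  shows "interp_poly N \<mu> c = subst (psum {..<N})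
    (interp_det \<mu> (\<lambda>i k. \<Sum>l<part \<mu> i + (N - 1 - i). c l ^ (k + 1)))"
    (is "_ = subst _ (interp_det \<mu> ?\<pi>)")
proof -
  let ?l = "length \<mu>"
  let ?M = "mat ?l ?l (\<lambda>(i, j). if i \<le> part \<mu> i + j
      then bialt_coeff N Var (part \<mu> i + (N - 1 - i)) (\<lambda>r. Const (c r)) (part \<mu> i + j - i) else 0)"
  have "subst (psum {..<N}) (newton_seq (\<lambda>k. Var k - Const (?\<pi> i k)) m) =
      bialt_coeff N Var (part \<mu> i + (N - 1 - i)) (\<lambda>r. Const (c r)) m" for i m
    unfolding bialt_coeff_eq_newton_seq subst_newton_seq
    by (simp only: subst.hom_minus subst_Var subst_Const Const.hom_sum Const.hom_power
        subst.hom_sum subst.hom_power)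
  then have "subst (psum {..<N}) (interp_det \<mu> ?\<pi>) = Determinant.det ?M"
    unfolding interp_det_def subst.hom_det[symmetric]
    by (intro arg_cong[of _ _ Determinant.det] eq_matI) auto
  moreover have "Determinant.det (mat N N (\<lambda>(i, j). \<Prod>l<part \<mu> i + (N - 1 - i). Var j - Const (c l))) =
      Determinant.det ?M * vandermonde N"
    unfolding vandermonde_def
    by (rule det_bialternant[OF assms, where c = "\<lambda>_ r. Const (c r)"]) (simp add: part_def)
  ultimately show ?thesis
    unfolding interp_poly_def using vandermonde_nonzero[of N]
    by (intro the_equality) auto
qed

section \<open>Limits of interpolation polynomials\<close>

lemma det_mat_eq:
  fixes f :: "nat \<Rightarrow> nat \<Rightarrow> 'a::comm_ring_1"
  shows "Determinant.det (mat n n (\<lambda>(i, j). f i j)) =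
    (\<Sum>p | p permutes {0..<n}. signof p * (\<Prod>i = 0..<n. f i (p i)))"
proof -
  have "Determinant.det (mat n n (\<lambda>(i, j). f i j)) =
      (\<Sum>p | p permutes {0..<n}. signof p * (\<Prod>i = 0..<n. mat n n (\<lambda>(i, j). f i j) $$ (i, p i)))"
    by (rule det_def') simp
  also have "\<dots> = (\<Sum>p | p permutes {0..<n}. signof p * (\<Prod>i = 0..<n. f i (p i)))"
  proof (rule sum.cong)
    fix p assume "p \<in> {p. p permutes {0..<n}}"
    then have "p i < n" if "i < n" for i
      using that permutes_in_image[of p "{0..<n}" i] by auto
    then show "signof p * (\<Prod>i = 0..<n. mat n n (\<lambda>(i, j). f i j) $$ (i, p i)) =
        signof p * (\<Prod>i = 0..<n. f i (p i))"
      by (intro arg_cong2[where f = "(*)"] prod.cong) auto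
  qed simp
  finally show ?thesis .
qed

text \<open>The common finite support keeps all terms in one finite-dimensional space; convergence
  of each coefficient alone would not control values or integrals.\<close>

definition coeff_tendsto :: "(nat \<Rightarrow> mpoly) \<Rightarrow> mpoly \<Rightarrow> bool" where
  "coeff_tendsto P L \<longleftrightarrow> (\<exists>K. finite K \<and> (\<forall>n. Poly_Mapping.keys (P n) \<subseteq> K)) \<and>
     (\<forall>m. (\<lambda>n. Poly_Mapping.lookup (P n) m) \<longlonglongrightarrow> Poly_Mapping.lookup L m)"

lemma sum_singles_superset:
  fixes P :: mpoly
  assumes "finite K" "Poly_Mapping.keys P \<subseteq> K"
  shows "P = (\<Sum>m\<in>K. Poly_Mapping.single m (Poly_Mapping.lookup P m))"
proof (rule poly_mapping_eqI)
  fix m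
  have "m \<notin> K \<Longrightarrow> Poly_Mapping.lookup P m = 0"
    using assms(2) by (auto simp: in_keys_iff)
  then show "Poly_Mapping.lookup P m =
      Poly_Mapping.lookup (\<Sum>m\<in>K. Poly_Mapping.single m (Poly_Mapping.lookup P m)) m"
    using assms(1) by (simp add: lookup_sum lookup_single when_def)
qed

text \<open>\<open>f\<close> may fail to be injective: for a product it is the sum of two exponent
  vectors, where different pairs collide.\<close>

lemma coeff_tendsto_sum_singles:
  assumes "finite I" "\<And>n. P n = (\<Sum>i\<in>I. Poly_Mapping.single (f i) (a n i))"
    and "L = (\<Sum>i\<in>I. Poly_Mapping.single (f i) (b i))"
    and "\<And>i. i \<in> I \<Longrightarrow> (\<lambda>n. a n i) \<longlonglongrightarrow> b i"
  shows "coeff_tendsto P L"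
  unfolding coeff_tendsto_def
proof (intro conjI exI allI)
  show "finite (f ` I)" using assms(1) by simp
  show "Poly_Mapping.keys (P n) \<subseteq> f ` I" for n
  proof
    fix m assume "m \<in> Poly_Mapping.keys (P n)"
    then have "(\<Sum>i\<in>I. Poly_Mapping.lookup (Poly_Mapping.single (f i) (a n i)) m) \<noteq> 0"
      by (simp add: in_keys_iff assms(2) lookup_sum)
    then obtain i where "i \<in> I" "Poly_Mapping.lookup (Poly_Mapping.single (f i) (a n i)) m \<noteq> 0"
      by (meson sum.neutral)
    then show "m \<in> f ` I" by (auto simp: lookup_single when_def split: if_splits)
  qed
  show "(\<lambda>n. Poly_Mapping.lookup (P n) m) \<longlonglongrightarrow> Poly_Mapping.lookup L m" for m
    unfolding assms(2,3) lookup_sum lookup_single when_def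
    by (intro tendsto_sum) (auto intro: assms(4))
qed

lemma coeff_tendstoE:
  assumes "coeff_tendsto P L"
  obtains K where "finite K"
    "\<And>n. P n = (\<Sum>m\<in>K. Poly_Mapping.single m (Poly_Mapping.lookup (P n) m))"
    "L = (\<Sum>m\<in>K. Poly_Mapping.single m (Poly_Mapping.lookup L m))"
    "\<And>m. (\<lambda>n. Poly_Mapping.lookup (P n) m) \<longlonglongrightarrow> Poly_Mapping.lookup L m"
proof -
  obtain K where K: "finite K" "\<And>n. Poly_Mapping.keys (P n) \<subseteq> K"
    and lim: "\<And>m. (\<lambda>n. Poly_Mapping.lookup (P n) m) \<longlonglongrightarrow> Poly_Mapping.lookup L m"
    using assms unfolding coeff_tendsto_def by blast
  have "Poly_Mapping.keys L \<subseteq> K"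
  proof
    fix m assume m: "m \<in> Poly_Mapping.keys L"
    show "m \<in> K"
    proof (rule ccontr)
      assume "m \<notin> K"
      then have "Poly_Mapping.lookup (P n) m = 0" for n
        using K(2)[of n] by (auto simp: in_keys_iff)
      then have "(\<lambda>n. 0) \<longlonglongrightarrow> Poly_Mapping.lookup L m"
        using lim[of m] by simp
      then have "Poly_Mapping.lookup L m = 0"
        using LIMSEQ_unique[OF _ tendsto_const] by blast
      with m show False by (simp add: in_keys_iff)
    qed
  qed
  then show ?thesis
    using that[OF K(1) _ _ lim] sum_singles_superset[OF K(1)] K(2) by blast
qed

lemma coeff_tendsto_const: "coeff_tendsto (\<lambda>_. P) P"
  unfolding coeff_tendsto_def by (intro conjI exI[of _ "Poly_Mapping.keys P"]) auto

lemma coeff_tendsto_Const: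
  assumes "a \<longlonglongrightarrow> b"
  shows "coeff_tendsto (\<lambda>n. Const (a n)) (Const b)"
  by (rule coeff_tendsto_sum_singles[of "{()}" _ "\<lambda>_. 0" "\<lambda>n _. a n" _ "\<lambda>_. b"])
    (use assms in \<open>auto simp: Const_def\<close>)

lemma coeff_tendsto_add:
  assumes "coeff_tendsto P L" "coeff_tendsto Q M"
  shows "coeff_tendsto (\<lambda>n. P n + Q n) (L + M)"
  unfolding coeff_tendsto_def
proof (intro conjI)
  obtain K K' where "finite K" "\<And>n. Poly_Mapping.keys (P n) \<subseteq> K"
    "finite K'" "\<And>n. Poly_Mapping.keys (Q n) \<subseteq> K'"
    using assms unfolding coeff_tendsto_def by blast
  then show "\<exists>K. finite K \<and> (\<forall>n. Poly_Mapping.keys (P n + Q n) \<subseteq> K)"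
    by (intro exI[of _ "K \<union> K'"] conjI allI order_trans[OF Poly_Mapping.keys_add]) auto
  show "\<forall>m. (\<lambda>n. Poly_Mapping.lookup (P n + Q n) m) \<longlonglongrightarrow> Poly_Mapping.lookup (L + M) m"
    using assms unfolding coeff_tendsto_def lookup_add by (auto intro: tendsto_add)
qed

lemma coeff_tendsto_mult:
  assumes "coeff_tendsto P L" "coeff_tendsto Q M"
  shows "coeff_tendsto (\<lambda>n. P n * Q n) (L * M)"
proof -
  obtain K where K: "finite K"
    "\<And>n. P n = (\<Sum>m\<in>K. Poly_Mapping.single m (Poly_Mapping.lookup (P n) m))"
    "L = (\<Sum>m\<in>K. Poly_Mapping.single m (Poly_Mapping.lookup L m))"
    "\<And>m. (\<lambda>n. Poly_Mapping.lookup (P n) m) \<longlonglongrightarrow> Poly_Mapping.lookup L m"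
    using coeff_tendstoE[OF assms(1)] by blast
  obtain J where J: "finite J"
    "\<And>n. Q n = (\<Sum>m\<in>J. Poly_Mapping.single m (Poly_Mapping.lookup (Q n) m))"
    "M = (\<Sum>m\<in>J. Poly_Mapping.single m (Poly_Mapping.lookup M m))"
    "\<And>m. (\<lambda>n. Poly_Mapping.lookup (Q n) m) \<longlonglongrightarrow> Poly_Mapping.lookup M m"
    using coeff_tendstoE[OF assms(2)] by blast
  have prod: "A * B = (\<Sum>(m, m')\<in>K \<times> J. Poly_Mapping.single (m + m')
      (Poly_Mapping.lookup A m * Poly_Mapping.lookup B m'))"
    if "A = (\<Sum>m\<in>K. Poly_Mapping.single m (Poly_Mapping.lookup A m))"
      "B = (\<Sum>m\<in>J. Poly_Mapping.single m (Poly_Mapping.lookup B m))" for A B :: mpoly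
  proof -
    have "A * B = (\<Sum>m\<in>K. Poly_Mapping.single m (Poly_Mapping.lookup A m)) *
        (\<Sum>m\<in>J. Poly_Mapping.single m (Poly_Mapping.lookup B m))"
      using that by metis
    also have "\<dots> = (\<Sum>(m, m')\<in>K \<times> J. Poly_Mapping.single (m + m')
        (Poly_Mapping.lookup A m * Poly_Mapping.lookup B m'))"
      by (simp add: sum_product mult_single sum.cartesian_product)
    finally show ?thesis .
  qed
  show ?thesis
  proof (rule coeff_tendsto_sum_singles)
    show "finite (K \<times> J)" using K(1) J(1) by simp
    show "P n * Q n = (\<Sum>i\<in>K \<times> J. Poly_Mapping.single (fst i + snd i)
        (Poly_Mapping.lookup (P n) (fst i) * Poly_Mapping.lookup (Q n) (snd i)))" for n
      unfolding prod[OF K(2) J(2)] by (simp add: case_prod_unfold)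
    show "L * M = (\<Sum>i\<in>K \<times> J. Poly_Mapping.single (fst i + snd i)
        (Poly_Mapping.lookup L (fst i) * Poly_Mapping.lookup M (snd i)))"
      unfolding prod[OF K(3) J(3)] by (simp add: case_prod_unfold)
    show "(\<lambda>n. Poly_Mapping.lookup (P n) (fst i) * Poly_Mapping.lookup (Q n) (snd i))
        \<longlonglongrightarrow> Poly_Mapping.lookup L (fst i) * Poly_Mapping.lookup M (snd i)" for i
      by (intro tendsto_mult K(4) J(4))
  qed
qed

lemma coeff_tendsto_diff:
  assumes "coeff_tendsto P L" "coeff_tendsto Q M"
  shows "coeff_tendsto (\<lambda>n. P n - Q n) (L - M)"
  using coeff_tendsto_add[OF assms(1) coeff_tendsto_mult[OF coeff_tendsto_const[of "- 1"] assms(2)]]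
  by simp

lemma coeff_tendsto_sum:
  assumes "\<And>i. i \<in> I \<Longrightarrow> coeff_tendsto (\<lambda>n. P n i) (L i)"
  shows "coeff_tendsto (\<lambda>n. \<Sum>i\<in>I. P n i) (\<Sum>i\<in>I. L i)"
  using assms
  by (induction I rule: infinite_finite_induct) (auto intro: coeff_tendsto_add coeff_tendsto_const)

lemma coeff_tendsto_prod:
  assumes "\<And>i. i \<in> I \<Longrightarrow> coeff_tendsto (\<lambda>n. P n i) (L i)"
  shows "coeff_tendsto (\<lambda>n. \<Prod>i\<in>I. P n i) (\<Prod>i\<in>I. L i)"
  using assms
  by (induction I rule: infinite_finite_induct) (auto intro: coeff_tendsto_mult coeff_tendsto_const)

lemma coeff_tendsto_newton_seq:
  assumes "\<And>k. coeff_tendsto (\<lambda>n. a n k) (b k)"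
  shows "coeff_tendsto (\<lambda>n. newton_seq (a n) m) (newton_seq b m)"
proof (induction m rule: less_induct)
  case (less m)
  show ?case
  proof (cases m)
    case 0
    then show ?thesis by (simp add: coeff_tendsto_const)
  next
    case (Suc j)
    show ?thesis
      unfolding Suc newton_seq.simps
      by (intro coeff_tendsto_mult coeff_tendsto_sum coeff_tendsto_const assms less)
        (simp add: Suc)
  qed
qed

lemma coeff_tendsto_interp_det:
  assumes "\<And>i k. i < length \<mu> \<Longrightarrow> (\<lambda>n. \<pi> n i k) \<longlonglongrightarrow> \<pi>' i k"
  shows "coeff_tendsto (\<lambda>n. interp_det \<mu> (\<pi> n)) (interp_det \<mu> \<pi>')"
  unfolding interp_det_def det_mat_eq
proof (intro coeff_tendsto_sum coeff_tendsto_mult coeff_tendsto_prod coeff_tendsto_const)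
  fix p i assume "i \<in> {0..<length \<mu>}"
  then have "coeff_tendsto (\<lambda>n. newton_seq (\<lambda>k. Var k - Const (\<pi> n i k)) m)
      (newton_seq (\<lambda>k. Var k - Const (\<pi>' i k)) m)" for m
    by (intro coeff_tendsto_newton_seq coeff_tendsto_diff coeff_tendsto_const coeff_tendsto_Const assms)
      simp
  then show "coeff_tendsto (\<lambda>n. if i \<le> part \<mu> i + p i
      then newton_seq (\<lambda>k. Var k - Const (\<pi> n i k)) (part \<mu> i + p i - i) else 0)
    (if i \<le> part \<mu> i + p i
      then newton_seq (\<lambda>k. Var k - Const (\<pi>' i k)) (part \<mu> i + p i - i) else 0)"
    by (simp add: coeff_tendsto_const)
qed

lemma coeff_tendsto_imp_sym_of_tendsto:
  assumes "coeff_tendsto P L"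
  shows "(\<lambda>n. sym_of (P n) m) \<longlonglongrightarrow> sym_of L m"
proof -
  obtain K where K: "finite K"
    "\<And>n. P n = (\<Sum>m\<in>K. Poly_Mapping.single m (Poly_Mapping.lookup (P n) m))"
    "L = (\<Sum>m\<in>K. Poly_Mapping.single m (Poly_Mapping.lookup L m))"
    "\<And>m. (\<lambda>n. Poly_Mapping.lookup (P n) m) \<longlonglongrightarrow> Poly_Mapping.lookup L m"
    using coeff_tendstoE[OF assms] by blast
  have *: "sym_of Q m = (\<Sum>k\<in>K. Poly_Mapping.lookup Q k * sym_of (Poly_Mapping.single k 1) m)"
    if "Q = (\<Sum>m\<in>K. Poly_Mapping.single m (Poly_Mapping.lookup Q m))" for Q :: mpoly
  proof -
    have "sym_of Q m = sym_of (\<Sum>k\<in>K. Const (Poly_Mapping.lookup Q k) * Poly_Mapping.single k 1) m"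
      using that by (simp add: single_eq_Const_times[symmetric])
    then show ?thesis
      by (simp only: sym_of_sum sym_of_Const_mult)
  qed
  show ?thesis
    unfolding *[OF K(2)] *[OF K(3)] by (intro tendsto_sum tendsto_mult tendsto_const K(4))
qed

section \<open>Weights of the determinants\<close>

lemma deg_le_weight_newton_seq:
  assumes "\<And>k. deg_le weight (k + 1) (a k)"
  shows "deg_le weight n (newton_seq a n)"
proof (induction n rule: less_induct)
  case (less n)
  show ?case
  proof (cases n)
    case 0
    then show ?thesis using weight.deg_le_Const[of 0 1] by simp
  next
    case (Suc m)
    have "deg_le weight (Suc m) (a i * newton_seq a (m - i))" if "i \<le> m" for i
      using weight.deg_le_mult[OF assms[of i] less[of "m - i"]] that Suc by simp
    then show ?thesis
      unfolding Suc newton_seq.simps by (intro weight.deg_le_Const_mult deg_le_sum) simp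
  qed
qed

lemma deg_le_signof_mult: "deg_le g d P \<Longrightarrow> deg_le g d (signof p * P)"
  using deg_le_diff[of g d 0 P] by (simp add: sign_def)

lemma sum_list_eq_sum_part: "length \<mu> \<le> n \<Longrightarrow> sum_list \<mu> = (\<Sum>i<n. part \<mu> i)"
  unfolding sum_list_sum_nth atLeast0LessThan
  by (intro sum.mono_neutral_cong_left) (auto simp: part_def)

text \<open>A permutation preserves the sum of the indices. Hence all surviving terms of the
  Jacobi--Trudi determinant have the same total degree, which yields both the weight bound and the
  homogeneity under scaling.\<close>

lemma sum_row_degrees:
  assumes p: "p permutes {0..<length \<mu>}" and "\<And>i. i < length \<mu> \<Longrightarrow> i \<le> part \<mu> i + p i"
  shows "(\<Sum>i = 0..<length \<mu>. part \<mu> i + p i - i) = sum_list \<mu>"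
proof -
  let ?I = "{0..<length \<mu>}"
  have "(\<Sum>i\<in>?I. part \<mu> i + p i - i) + (\<Sum>i\<in>?I. i) = (\<Sum>i\<in>?I. part \<mu> i + p i)"
    unfolding sum.distrib[symmetric] using assms(2) by (intro sum.cong) auto
  also have "\<dots> = (\<Sum>i\<in>?I. part \<mu> i) + (\<Sum>i\<in>?I. i)"
    using sum.permute[OF p, of "\<lambda>i. i"] by (simp add: sum.distrib)
  finally show ?thesis
    using sum_list_eq_sum_part[of \<mu> "length \<mu>"] by (simp add: atLeast0LessThan)
qed

lemma deg_le_weight_interp_det: "deg_le weight (sum_list \<mu>) (interp_det \<mu> \<pi>)"
  unfolding interp_det_def det_mat_eq
proof (intro deg_le_sum deg_le_signof_mult)
  fix p assume "p \<in> {p. p permutes {0..<length \<mu>}}"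
  then have p: "p permutes {0..<length \<mu>}" by simp
  let ?f = "\<lambda>i. if i \<le> part \<mu> i + p i
    then newton_seq (\<lambda>k. Var k - Const (\<pi> i k)) (part \<mu> i + p i - i) else 0"
  show "deg_le weight (sum_list \<mu>) (\<Prod>i = 0..<length \<mu>. ?f i)"
  proof (cases "\<forall>i<length \<mu>. i \<le> part \<mu> i + p i")
    case True
    have "deg_le weight (\<Sum>i = 0..<length \<mu>. part \<mu> i + p i - i) (\<Prod>i = 0..<length \<mu>. ?f i)"
      by (intro weight.deg_le_prod)
        (auto intro!: deg_le_weight_newton_seq deg_le_diff deg_le_weight_Var weight.deg_le_Const
          simp del: add_Suc_right One_nat_def)
    then show ?thesis
      using sum_row_degrees[OF p] True by simp
  next
    case False
    then obtain i where "i < length \<mu>" "\<not> i \<le> part \<mu> i + p i" by blast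
    then have "(\<Prod>i = 0..<length \<mu>. ?f i) = 0"
      by (intro prod_zero) auto
    then show ?thesis by (simp only: deg_le_zero)
  qed
qed

lemma sym_converges_unique:
  assumes "sym_converges P F" "sym_converges P G"
  shows "F = G"
proof
  fix m
  have "\<forall>\<^sub>F d in sequentially. (\<forall>m. (\<lambda>N. sym_iota d N (P N) m) \<longlonglongrightarrow> F m) \<and>
      (\<forall>m. (\<lambda>N. sym_iota d N (P N) m) \<longlonglongrightarrow> G m)"
    using assms unfolding sym_converges_def by (auto elim: eventually_elim2)
  then obtain d where "(\<lambda>N. sym_iota d N (P N) m) \<longlonglongrightarrow> F m" "(\<lambda>N. sym_iota d N (P N) m) \<longlonglongrightarrow> G m"
    by (auto simp: eventually_sequentially)
  then show "F m = G m"
    by (rule LIMSEQ_unique)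
qed

text \<open>Serves \<open>I_A\<close> and \<open>I_BC\<close> alike: once the power sums of the
  nodes converge row by row, the determinants converge, and with them the symmetric
  functions.\<close>

lemma interp_limit:
  assumes "\<And>i k. i < length \<mu> \<Longrightarrow>
    (\<lambda>N. \<Sum>l<part \<mu> i + (N - 1 - i). c N l ^ (k + 1)) \<longlonglongrightarrow> \<pi> i k"
  shows "(THE F. F \<in> Sym \<and> sym_converges (\<lambda>N. interp_poly N \<mu> (c N)) F) = sym_of (interp_det \<mu> \<pi>)"
proof -
  define D where "D N = interp_det \<mu> (\<lambda>i k. \<Sum>l<part \<mu> i + (N - 1 - i). c N l ^ (k + 1))" for N
  let ?w = "sum_list \<mu>"
  have D: "deg_le weight ?w (D N)" for N
    unfolding D_def by (rule deg_le_weight_interp_det)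
  have L: "deg_le weight ?w (interp_det \<mu> \<pi>)"
    by (rule deg_le_weight_interp_det)
  have eq: "interp_poly N \<mu> (c N) = subst (psum {..<N}) (D N)" if "length \<mu> \<le> N" for N
    unfolding D_def using that by (rule interp_poly_eq)
  have lim: "coeff_tendsto D (interp_det \<mu> \<pi>)"
    unfolding D_def using assms by (rule coeff_tendsto_interp_det)
  have conv: "sym_converges (\<lambda>N. interp_poly N \<mu> (c N)) (sym_of (interp_det \<mu> \<pi>))"
    unfolding sym_converges_def
  proof (intro conjI exI)
    show "\<forall>\<^sub>F N in sequentially. interp_poly N \<mu> (c N) \<in> sym_poly_le N ?w"
      using eventually_ge_at_top[of "length \<mu>"]
      by eventually_elim (simp only: eq subst_psum_in_sym_poly_le[OF D])
    show "\<forall>\<^sub>F d in sequentially. sym_of (interp_det \<mu> \<pi>) \<in> Sym_le d \<and>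
        (\<forall>m. (\<lambda>N. sym_iota d N (interp_poly N \<mu> (c N)) m) \<longlonglongrightarrow> sym_of (interp_det \<mu> \<pi>) m)"
      using eventually_ge_at_top[of ?w]
    proof eventually_elim
      case (elim d)
      \<comment> \<open>\<open>N\<close> has to reach \<open>d\<close> for \<open>sym_iota\<close>
        to invert the restriction, and \<open>length \<mu>\<close> for the determinant
        formula.\<close>
      have "\<forall>\<^sub>F N in sequentially. sym_of (D N) m = sym_iota d N (interp_poly N \<mu> (c N)) m" for m
        using eventually_ge_at_top[of "max d (length \<mu>)"]
      proof eventually_elim
        case (elim N)
        then show ?case
          using sym_iota_subst_psum[OF deg_le_mono[OF D \<open>?w \<le> d\<close>], of N N] eq[of N] by simp
      qed
      then have "(\<lambda>N. sym_iota d N (interp_poly N \<mu> (c N)) m) \<longlonglongrightarrow> sym_of (interp_det \<mu> \<pi>) m" for m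
        by (rule Lim_transform_eventually[OF coeff_tendsto_imp_sym_of_tendsto[OF lim]])
      moreover have "sym_of (interp_det \<mu> \<pi>) \<in> Sym_le d"
        by (rule sym_of_in_Sym_le[OF deg_le_mono[OF L elim]])
      ultimately show ?case by blast
    qed
  qed
  show ?thesis
  proof (rule the_equality)
    show "sym_of (interp_det \<mu> \<pi>) \<in> Sym \<and>
        sym_converges (\<lambda>N. interp_poly N \<mu> (c N)) (sym_of (interp_det \<mu> \<pi>))"
      using conv sym_of_in_Sym_le[OF L] unfolding Sym_def by blast
  next
    fix F assume "F \<in> Sym \<and> sym_converges (\<lambda>N. interp_poly N \<mu> (c N)) F"
    then show "F = sym_of (interp_det \<mu> \<pi>)"
      using sym_converges_unique[OF _ conv] by blast
  qed
qed

text \<open>Limits of the mixed power sums $\sum_l (q^{N-1-l})^r (q^l)^s$ over the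
  $p + N - 1 - i$ nodes of row \<open>i\<close>.\<close>

definition mixed_lim :: "real \<Rightarrow> nat \<Rightarrow> nat \<Rightarrow> nat \<Rightarrow> nat \<Rightarrow> real" where
  "mixed_lim q p i r s =
     (if s = 0 then (q powi (int i + 1 - int p)) ^ r / (1 - q ^ r)
      else if r = 0 then 1 / (1 - q ^ s) else 0)"

lemma power_int_add_of_nat: "x \<noteq> 0 \<Longrightarrow> x powi (a + int l) = x powi a * x ^ l" for x :: real
  by (simp add: power_int_add)

text \<open>If \<open>r\<close> or \<open>s\<close> is zero, the sum is geometric. Otherwise each
  summand contains the product q^(N-1-l) q^l = q^(N-1) times a bounded factor, and a sum of about N
  such terms vanishes in the limit.\<close>

lemma mixed_sum_tendsto:
  fixes q :: real
  assumes q: "0 < q" "q < 1" and rs: "0 < r + s"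
  shows "(\<lambda>N. \<Sum>l<p + (N - 1 - i). (q powi (int N - 1 - int l)) ^ r * (q ^ l) ^ s)
    \<longlonglongrightarrow> mixed_lim q p i r s"
proof -
  have L: "filterlim (\<lambda>N. p + (N - 1 - i)) sequentially sequentially"
    by (rule filterlim_at_top_mono[OF filterlim_minus_const_nat_at_top[of "1 + i"]]) auto
  have geo: "(\<lambda>N. \<Sum>l<p + (N - 1 - i). (q ^ n) ^ l) \<longlonglongrightarrow> 1 / (1 - q ^ n)" if "0 < n" for n
  proof -
    have "norm (q ^ n) < 1"
      using q that by (simp add: power_abs power_less_one_iff)
    then have "(\<lambda>l. (q ^ n) ^ l) sums (1 / (1 - q ^ n))"
      by (rule geometric_sums)
    then show ?thesis
      unfolding sums_def by (rule filterlim_compose[OF _ L])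
  qed
  have big: "\<forall>\<^sub>F N in sequentially. i + 1 \<le> N" by (rule eventually_ge_at_top)
  consider "s = 0" "0 < r" | "r = 0" "0 < s" | "0 < r" "0 < s"
    using rs by auto
  then show ?thesis
  proof cases
    case 1
    let ?w = "q powi (int i + 1 - int p)"
    have "(\<Sum>l<p + (N - 1 - i). (q powi (int N - 1 - int l)) ^ r) =
        ?w ^ r * (\<Sum>l<p + (N - 1 - i). (q ^ r) ^ l)" if "i + 1 \<le> N" for N
    proof -
      \<comment> \<open>Read backwards, the exponents start at i + 1 - p, the exponent of the last
        node of the row, and this start is independent of \<open>N\<close>.\<close>
      have "(\<Sum>l<p + (N - 1 - i). (q powi (int N - 1 - int l)) ^ r) =
          (\<Sum>l<p + (N - 1 - i). (q powi (int N - 1 - int (p + (N - 1 - i) - Suc l))) ^ r)"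
        by (rule sum.nat_diff_reindex[symmetric])
      also have "\<dots> = (\<Sum>l<p + (N - 1 - i). ?w ^ r * (q ^ r) ^ l)"
      proof (rule sum.cong)
        fix l assume "l \<in> {..<p + (N - 1 - i)}"
        then have e: "int N - 1 - int (p + (N - 1 - i) - Suc l) = (int i + 1 - int p) + int l"
          using that by auto
        have "q powi (int N - 1 - int (p + (N - 1 - i) - Suc l)) = ?w * q ^ l"
          unfolding e by (rule power_int_add_of_nat) (use q in simp)
        then show "(q powi (int N - 1 - int (p + (N - 1 - i) - Suc l))) ^ r = ?w ^ r * (q ^ r) ^ l"
          by (simp only: power_mult_distrib power_mult[symmetric] mult.commute)
      qed simp
      finally show ?thesis by (simp only: sum_distrib_left)
    qed
    then have "\<forall>\<^sub>F N in sequentially. ?w ^ r * (\<Sum>l<p + (N - 1 - i). (q ^ r) ^ l) =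
        (\<Sum>l<p + (N - 1 - i). (q powi (int N - 1 - int l)) ^ r * (q ^ l) ^ s)"
      by (intro eventually_mono[OF big]) (simp only: 1 power_0 mult_1_right)
    moreover have "(\<lambda>N. ?w ^ r * (\<Sum>l<p + (N - 1 - i). (q ^ r) ^ l)) \<longlonglongrightarrow> ?w ^ r * (1 / (1 - q ^ r))"
      by (intro tendsto_mult tendsto_const geo 1)
    ultimately have "(\<lambda>N. \<Sum>l<p + (N - 1 - i). (q powi (int N - 1 - int l)) ^ r * (q ^ l) ^ s)
        \<longlonglongrightarrow> ?w ^ r * (1 / (1 - q ^ r))"
      by (rule Lim_transform_eventually[rotated])
    then show ?thesis
      using 1 by (simp add: mixed_lim_def)
  next
    case 2
    have "(q ^ l) ^ s = (q ^ s) ^ l" for l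
      by (metis power_mult mult.commute)
    then show ?thesis
      using geo[OF 2(2)] 2 by (simp add: mixed_lim_def)
  next
    case 3
    \<comment> \<open>For large \<open>p\<close> a row reaches nodes with l > N - 1, so the exponent
      of q may be negative, down to i + 1 - p.\<close>
    define B where "B = max 1 (q powi (int i + 1 - int p))"
    have bound: "norm (\<Sum>l<p + (N - 1 - i). (q powi (int N - 1 - int l)) ^ r * (q ^ l) ^ s) \<le>
        (real p + real N) * (B ^ (r - 1) * q ^ (N - 1))" if "i + 1 \<le> N" for N
    proof -
      have summand: "norm ((q powi (int N - 1 - int l)) ^ r * (q ^ l) ^ s) \<le> B ^ (r - 1) * q ^ (N - 1)"
        if l: "l < p + (N - 1 - i)" for l
      proof -
        let ?a = "q powi (int N - 1 - int l)"
        have "?a \<le> B"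
        proof -
          have "?a \<le> q powi (int i + 1 - int p)"
            by (rule power_int_decreasing) (use q l \<open>i + 1 \<le> N\<close> in auto)
          then show ?thesis by (simp add: B_def)
        qed
        have a0: "0 < ?a" using q by simp
        have ab: "?a * q ^ l = q ^ (N - 1)"
        proof -
          have "?a * q ^ l = q powi (int N - 1 - int l + int l)"
            by (rule power_int_add_of_nat[symmetric]) (use q in simp)
          also have "int N - 1 - int l + int l = int (N - 1)"
            using \<open>i + 1 \<le> N\<close> by simp
          finally show ?thesis by (simp only: power_int_of_nat)
        qed
        have "?a ^ r * (q ^ l) ^ s = (?a ^ (r - 1) * ?a) * (q ^ l * (q ^ l) ^ (s - 1))"
          using 3 by (simp only: power_minus_mult mult.commute[of "q ^ l"])
        also have "\<dots> = ?a ^ (r - 1) * (q ^ l) ^ (s - 1) * q ^ (N - 1)"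
          by (simp only: ab[symmetric] mult_ac)
        also have "\<dots> \<le> B ^ (r - 1) * 1 * q ^ (N - 1)"
          using q a0 \<open>?a \<le> B\<close>
          by (intro mult_right_mono mult_mono power_mono power_le_one) (auto simp: B_def)
        finally show ?thesis
          using q a0 by (simp add: abs_mult)
      qed
      have "norm (\<Sum>l<p + (N - 1 - i). (q powi (int N - 1 - int l)) ^ r * (q ^ l) ^ s) \<le>
          of_nat (card {..<p + (N - 1 - i)}) * (B ^ (r - 1) * q ^ (N - 1))"
        by (rule sum_norm_bound) (use summand in auto)
      also have "\<dots> \<le> (real p + real N) * (B ^ (r - 1) * q ^ (N - 1))"
        using q \<open>i + 1 \<le> N\<close> by (intro mult_right_mono mult_nonneg_nonneg) (auto simp: B_def)
      finally show ?thesis .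
    qed
    have "(\<lambda>N. (real p + real N) * (B ^ (r - 1) * q ^ (N - 1))) \<longlonglongrightarrow> 0"
    proof -
      have t1: "(\<lambda>N. real N * q ^ N) \<longlonglongrightarrow> 0"
        using powser_times_n_limit_0[of q] q by (simp add: mult.commute)
      have t2: "(\<lambda>N. q ^ N) \<longlonglongrightarrow> 0"
        using q by (intro LIMSEQ_realpow_zero) auto
      have "(\<lambda>N. (real p * q ^ N + real N * q ^ N) * (B ^ (r - 1) / q)) \<longlonglongrightarrow>
          (real p * 0 + 0) * (B ^ (r - 1) / q)"
        by (rule tendsto_mult[OF tendsto_add[OF tendsto_mult[OF tendsto_const t2] t1] tendsto_const])
      moreover have "\<forall>\<^sub>F N in sequentially. (real p * q ^ N + real N * q ^ N) * (B ^ (r - 1) / q) =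
          (real p + real N) * (B ^ (r - 1) * q ^ (N - 1))"
        using eventually_ge_at_top[of 1]
      proof eventually_elim
        case (elim N)
        then have "q ^ N = q ^ (N - 1) * q"
          by (intro power_minus_mult[symmetric]) simp
        then show ?case using q by (simp add: field_simps)
      qed
      ultimately show ?thesis
        using Lim_transform_eventually by fastforce
    qed
    with eventually_mono[OF big bound]
    have "(\<lambda>N. \<Sum>l<p + (N - 1 - i). (q powi (int N - 1 - int l)) ^ r * (q ^ l) ^ s) \<longlonglongrightarrow> 0"
      by (rule Lim_null_comparison)
    then show ?thesis
      using 3 by (simp add: mixed_lim_def)
  qed
qed

text \<open>The power sums $p_{k+1}$, in the limit $N \to \infty$, of the nodes
  $\alpha q^{N-1-l} + \beta q^l$ in row \<open>i\<close>, expanded binomially.\<close>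

definition node_psum :: "real \<Rightarrow> nat list \<Rightarrow> complex \<Rightarrow> complex \<Rightarrow> nat \<Rightarrow> nat \<Rightarrow> complex" where
  "node_psum q \<mu> \<alpha> \<beta> i k = (\<Sum>r\<le>k + 1. of_nat ((k + 1) choose r) * \<alpha> ^ r * \<beta> ^ (k + 1 - r) *
     of_real (mixed_lim q (part \<mu> i) i r (k + 1 - r)))"

lemma node_psum_tendsto:
  assumes q: "0 < q" "q < 1"
  shows "(\<lambda>N. \<Sum>l<part \<mu> i + (N - 1 - i).
      (\<alpha> * of_real (q powi (int N - 1 - int l)) + \<beta> * of_real (q ^ l)) ^ (k + 1))
    \<longlonglongrightarrow> node_psum q \<mu> \<alpha> \<beta> i k"
proof -
  have eq: "(\<Sum>l\<in>A. (\<alpha> * of_real (q powi (int N - 1 - int l)) + \<beta> * of_real (q ^ l)) ^ n) =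
      (\<Sum>r\<le>n. of_nat (n choose r) * \<alpha> ^ r * \<beta> ^ (n - r) *
        of_real (\<Sum>l\<in>A. (q powi (int N - 1 - int l)) ^ r * (q ^ l) ^ (n - r)))" for A N n
  proof -
    have "(\<Sum>l\<in>A. (\<alpha> * of_real (q powi (int N - 1 - int l)) + \<beta> * of_real (q ^ l)) ^ n) =
        (\<Sum>l\<in>A. \<Sum>r\<le>n. of_nat (n choose r) * \<alpha> ^ r * \<beta> ^ (n - r) *
          of_real ((q powi (int N - 1 - int l)) ^ r * (q ^ l) ^ (n - r)))"
      by (simp add: binomial_ring power_mult_distrib mult_ac)
    then show ?thesis
      by (subst (asm) sum.swap) (simp only: of_real_sum sum_distrib_left)
  qed
  show ?thesis
    unfolding eq node_psum_def
    by (intro tendsto_sum tendsto_mult tendsto_const tendsto_of_real mixed_sum_tendsto q) simp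
qed

lemma I_A_eq:
  assumes "0 < q" "q < 1"
  shows "I_A q \<mu> = sym_of (interp_det \<mu> (node_psum q \<mu> 1 0))"
  unfolding I_A_def
  by (rule interp_limit) (use node_psum_tendsto[OF assms, where \<alpha> = 1 and \<beta> = 0] in simp)

lemma I_BC_eq:
  assumes "0 < q" "q < 1"
  shows "I_BC q s \<mu> = sym_of (interp_det \<mu> (node_psum q \<mu> (inverse s) (- s)))"
  unfolding I_BC_def
  by (rule interp_limit) (use node_psum_tendsto[OF assms, where \<alpha> = "inverse s" and \<beta> = "- s"] in simp)

section \<open>Degeneration of the symmetric functions\<close>

lemma newton_seq_scale:
  "newton_seq (\<lambda>k. Const (r ^ (k + 1)) * a k) n = Const (r ^ n) * newton_seq a n"
proof (induction n rule: less_induct)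
  case (less n)
  show ?case
  proof (cases n)
    case 0
    then show ?thesis by simp
  next
    case (Suc m)
    have "Const (r ^ (i + 1)) * a i * newton_seq (\<lambda>k. Const (r ^ (k + 1)) * a k) (m - i) =
        Const (r ^ Suc m) * (a i * newton_seq a (m - i))" if "i \<le> m" for i
    proof -
      have "newton_seq (\<lambda>k. Const (r ^ (k + 1)) * a k) (m - i) = Const (r ^ (m - i)) * newton_seq a (m - i)"
        using less[of "m - i"] Suc by simp
      moreover have "Const (r ^ Suc m) = Const (r ^ (i + 1)) * Const (r ^ (m - i))"
        unfolding Const.hom_mult[symmetric] power_add[symmetric] using that by simp
      ultimately show ?thesis by (simp only: mult_ac)
    qed
    then have "(\<Sum>i\<le>m. Const (r ^ (i + 1)) * a i * newton_seq (\<lambda>k. Const (r ^ (k + 1)) * a k) (m - i)) =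
        Const (r ^ Suc m) * (\<Sum>i\<le>m. a i * newton_seq a (m - i))"
      unfolding sum_distrib_left by (intro sum.cong) auto
    then show ?thesis
      unfolding Suc newton_seq.simps by (simp only: mult_ac)
  qed
qed

abbreviation scale_vars :: "complex \<Rightarrow> mpoly \<Rightarrow> mpoly" where
  "scale_vars r \<equiv> subst (\<lambda>i. Const (r ^ (i + 1)) * Var i)"

text \<open>The determinant is homogeneous of degree |\<mu>| in the variables x_j and the nodes
  together, so scaling the x_j by \<open>r\<close> amounts to dividing the nodes by \<open>r\<close>
  and extracting a power of \<open>r\<close>.\<close>

lemma scale_vars_interp_det:
  assumes "r \<noteq> 0"
  shows "scale_vars r (interp_det \<mu> \<pi>) =
    Const (r ^ sum_list \<mu>) * interp_det \<mu> (\<lambda>i k. \<pi> i k / r ^ (k + 1))"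
proof -
  define X where "X i n = newton_seq (\<lambda>k. Var k - Const (\<pi> i k / r ^ (k + 1))) n" for i n
  have scale: "scale_vars r (newton_seq (\<lambda>k. Var k - Const (\<pi> i k)) n) = Const (r ^ n) * X i n" for i n
  proof -
    have "Const (r ^ (k + 1)) * Var k - Const (\<pi> i k) =
        Const (r ^ (k + 1)) * (Var k - Const (\<pi> i k / r ^ (k + 1)))" for k
      unfolding right_diff_distrib Const.hom_mult[symmetric] using assms by simp
    then show ?thesis
      unfolding X_def newton_seq_scale[symmetric] subst_newton_seq
      by (simp only: subst.hom_minus subst_Var subst_Const)
  qed
  have "(\<Prod>i = 0..<length \<mu>. scale_vars r (if i \<le> part \<mu> i + p i
        then newton_seq (\<lambda>k. Var k - Const (\<pi> i k)) (part \<mu> i + p i - i) else 0)) =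
      Const (r ^ sum_list \<mu>) *
        (\<Prod>i = 0..<length \<mu>. if i \<le> part \<mu> i + p i then X i (part \<mu> i + p i - i) else 0)"
    if p: "p permutes {0..<length \<mu>}" for p
  proof (cases "\<forall>i<length \<mu>. i \<le> part \<mu> i + p i")
    case True
    have "(\<Prod>i = 0..<length \<mu>. scale_vars r (if i \<le> part \<mu> i + p i
        then newton_seq (\<lambda>k. Var k - Const (\<pi> i k)) (part \<mu> i + p i - i) else 0)) =
      (\<Prod>i = 0..<length \<mu>. Const (r ^ (part \<mu> i + p i - i)) *
        (if i \<le> part \<mu> i + p i then X i (part \<mu> i + p i - i) else 0))"
    proof (rule prod.cong)
      fix i assume "i \<in> {0..<length \<mu>}"
      then have "i \<le> part \<mu> i + p i" using True by simp
      then show "scale_vars r (if i \<le> part \<mu> i + p i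
          then newton_seq (\<lambda>k. Var k - Const (\<pi> i k)) (part \<mu> i + p i - i) else 0) =
        Const (r ^ (part \<mu> i + p i - i)) *
          (if i \<le> part \<mu> i + p i then X i (part \<mu> i + p i - i) else 0)"
        by (simp only: if_True scale)
    qed simp
    also have "\<dots> = Const (r ^ (\<Sum>i = 0..<length \<mu>. part \<mu> i + p i - i)) *
        (\<Prod>i = 0..<length \<mu>. if i \<le> part \<mu> i + p i then X i (part \<mu> i + p i - i) else 0)"
      by (simp only: prod.distrib Const.hom_prod[symmetric] power_sum)
    finally show ?thesis
      using sum_row_degrees[OF p] True by simp
  next
    case False
    then obtain i where i: "i < length \<mu>" "\<not> i \<le> part \<mu> i + p i" by blast
    then have "(\<Prod>i = 0..<length \<mu>. if i \<le> part \<mu> i + p i then X i (part \<mu> i + p i - i) else 0) = 0"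
      by (intro prod_zero) auto
    moreover have "(\<Prod>i = 0..<length \<mu>. scale_vars r (if i \<le> part \<mu> i + p i
        then newton_seq (\<lambda>k. Var k - Const (\<pi> i k)) (part \<mu> i + p i - i) else 0)) = 0"
      using i by (intro prod_zero bexI[of _ i]) auto
    ultimately show ?thesis by (simp only: mult_zero_right)
  qed
  then show ?thesis
    unfolding interp_det_def det_mat_eq X_def[symmetric] subst.hom_sum sum_distrib_left
    by (intro sum.cong refl) (simp only: mem_Collect_eq subst.hom_mult subst.hom_signof subst.hom_prod mult.left_commute)
qed

lemma node_psum_scale:
  "node_psum q \<mu> (t * \<alpha>) (t * \<beta>) i k = t ^ (k + 1) * node_psum q \<mu> \<alpha> \<beta> i k"
proof -
  have "(t * \<alpha>) ^ r * (t * \<beta>) ^ (k + 1 - r) = t ^ (k + 1) * (\<alpha> ^ r * \<beta> ^ (k + 1 - r))"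
    if "r \<le> k + 1" for r
  proof -
    have "t ^ (k + 1) = t ^ r * t ^ (k + 1 - r)"
      unfolding power_add[symmetric] using that by simp
    then show ?thesis by (simp only: power_mult_distrib mult_ac)
  qed
  then show ?thesis
    unfolding node_psum_def sum_distrib_left by (intro sum.cong) (auto simp: mult.assoc)
qed

definition Phi_qR_poly ::
  "real \<Rightarrow> complex \<Rightarrow> complex \<Rightarrow> complex \<Rightarrow> complex \<Rightarrow> nat list \<Rightarrow> mpoly" where
  "Phi_qR_poly q s0 s1 s2 s3 \<nu> = (\<Sum>\<mu>\<in>subpartitions \<nu>.
     Const (sigma_qR q s0 s1 s2 s3 \<nu> \<mu>) * interp_det \<mu> (node_psum q \<mu> (inverse s0) (- s0)))"

text \<open>By homogeneity the function I^A_\<mu>(X c) is c^|\<mu>| times the determinant with the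
  nodes divided by c; hence the extra power of \<open>c\<close> and the argument
  \<open>inverse c\<close>.\<close>

definition Phi_bqJ_poly ::
  "real \<Rightarrow> real \<Rightarrow> real \<Rightarrow> complex \<Rightarrow> complex \<Rightarrow> nat list \<Rightarrow> mpoly" where
  "Phi_bqJ_poly q a b c d \<nu> = (\<Sum>\<mu>\<in>subpartitions \<nu>.
     Const (sigma_bqJ q a b c d \<nu> \<mu> * c ^ sum_list \<mu>) * interp_det \<mu> (node_psum q \<mu> (inverse c) 0))"

lemma Phi_qR_eq:
  assumes "0 < q" "q < 1"
  shows "Phi_qR q s0 s1 s2 s3 \<nu> = sym_of (Phi_qR_poly q s0 s1 s2 s3 \<nu>)"
  unfolding Phi_qR_def Phi_qR_poly_def
  by (rule ext) (simp only: sym_of_sum sym_of_Const_mult I_BC_eq[OF assms])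

lemma Phi_bqJ_eq:
  assumes "0 < q" "q < 1" "c \<noteq> 0"
  shows "Phi_bqJ q a b c d \<nu> = sym_of (Phi_bqJ_poly q a b c d \<nu>)"
proof -
  have "node_psum q \<mu> 1 0 i k / c ^ (k + 1) = node_psum q \<mu> (inverse c) 0 i k" for \<mu> i k
    using node_psum_scale[of q \<mu> "inverse c" 1 0 i k] by (simp add: field_simps)
  then have "scale_vars c (interp_det \<mu> (node_psum q \<mu> 1 0)) =
      Const (c ^ sum_list \<mu>) * interp_det \<mu> (node_psum q \<mu> (inverse c) 0)" for \<mu>
    by (simp only: scale_vars_interp_det[OF assms(3)])
  then show ?thesis
    unfolding Phi_bqJ_def Phi_bqJ_poly_def
    by (intro ext) (simp only: sym_of_sum sym_of_Const_mult I_A_eq[OF assms(1,2)] sym_scale_sym_of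
        Const.hom_mult mult.assoc)
qed

text \<open>The matrix entry of \<open>sigma_bqJ\<close>, named because the q-Racah entry differs
  from it by a single factor.\<close>

definition bqJ_entry ::
  "real \<Rightarrow> real \<Rightarrow> real \<Rightarrow> complex \<Rightarrow> complex \<Rightarrow> nat list \<Rightarrow> nat list \<Rightarrow> nat \<Rightarrow> nat \<Rightarrow> complex" where
  "bqJ_entry q a b c d \<nu> \<mu> j k =
     (let e = int (part \<mu> k) - int k;
           n = int (part \<nu> j) - int j - int (part \<mu> k) + int k;
           t = of_real (q powi (e + 1))
       in if n < 0 then 0
          else qpoch q (c / of_real a * t) (nat n) * qpoch q (c / of_real b * t) (nat n) /
               (of_real (q powi (e * n)) * qpoch q (of_real q) (nat n) *
                qpoch q (c * d / of_real (a * b) *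
                  of_real (q powi (int (part \<nu> j) + int (part \<mu> k) + 1 - int j - int k)))
                  (nat n)))"

lemma sigma_bqJ_eq:
  "sigma_bqJ q a b c d \<nu> \<mu> = c powi (- int (sum_list \<nu>)) *
     Determinant.det (mat (length \<nu>) (length \<nu>) (\<lambda>(j, k). bqJ_entry q a b c d \<nu> \<mu> j k))"
  unfolding sigma_bqJ_def bqJ_entry_def by (rule refl)

text \<open>With $s_0 s_2 = -qc/a$, $s_0 s_3 = -qc/b$ and $s_0 s_1 s_2 s_3 = q^2 cd/(ab)$ only the
  factor with $s_0 s_1 = \varepsilon^2 cd$ depends on \<open>\<epsilon>\<close>.\<close>

lemma sigma_qR_eq:
  fixes q a b \<epsilon> :: real
  assumes "q \<noteq> 0" "\<epsilon> \<noteq> 0"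
  shows "sigma_qR q (of_real \<epsilon> * c) (of_real \<epsilon> * d) (of_real (- q / (\<epsilon> * a))) (of_real (- q / (\<epsilon> * b))) \<nu> \<mu> =
    (of_real \<epsilon> * c) powi (int (sum_list \<mu>) - int (sum_list \<nu>)) *
    Determinant.det (mat (length \<nu>) (length \<nu>) (\<lambda>(j, k).
      qpoch q (- (of_real (\<epsilon>\<^sup>2) * c * d * of_real (q powi (int (part \<mu> k) - int k))))
        (nat (int (part \<nu> j) - int j - int (part \<mu> k) + int k)) * bqJ_entry q a b c d \<nu> \<mu> j k))"
proof -
  have e1: "- (of_real \<epsilon> * c) * (of_real \<epsilon> * d) * of_real t =
      - (of_real (\<epsilon>\<^sup>2) * c * d * of_real t)" for t
    by (simp add: power2_eq_square)
  \<comment> \<open>The factor q in s_2 and s_3 raises the exponent by one, which accounts for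
    \<open>e + 1\<close> in the big q-Jacobi entry.\<close>
  have e2: "- (of_real \<epsilon> * c) * of_real (- q / (\<epsilon> * x)) * of_real (q powi e) =
      c / of_real x * of_real (q powi (e + 1))" for x e
    using assms by (simp add: power_int_add)
  have e3: "of_real \<epsilon> * c * (of_real \<epsilon> * d) * of_real (- q / (\<epsilon> * a)) * of_real (- q / (\<epsilon> * b)) *
      of_real (q powi (u - 1 - v - w)) = c * d / of_real (a * b) * of_real (q powi (u + 1 - v - w))"
    for u v w :: int
  proof -
    have "u + 1 - v - w = (u - 1 - v - w) + int 2" by simp
    then have "q powi (u + 1 - v - w) = q powi (u - 1 - v - w) * q\<^sup>2"
      using power_int_add_of_nat[OF assms(1)] by metis
    then show ?thesis
      using assms(2) by (simp add: field_simps power2_eq_square)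
  qed
  have "(let e = int (part \<mu> k) - int k;
           n = int (part \<nu> j) - int j - int (part \<mu> k) + int k;
           t = of_real (q powi e)
       in if n < 0 then 0
          else qpoch q (- (of_real \<epsilon> * c) * (of_real \<epsilon> * d) * t) (nat n) *
               qpoch q (- (of_real \<epsilon> * c) * of_real (- q / (\<epsilon> * a)) * t) (nat n) *
               qpoch q (- (of_real \<epsilon> * c) * of_real (- q / (\<epsilon> * b)) * t) (nat n) /
               (of_real (q powi (e * n)) * qpoch q (of_real q) (nat n) *
                qpoch q (of_real \<epsilon> * c * (of_real \<epsilon> * d) * of_real (- q / (\<epsilon> * a)) * of_real (- q / (\<epsilon> * b)) *
                  of_real (q powi (int (part \<nu> j) + int (part \<mu> k) - 1 - int j - int k)))
                  (nat n))) =
      qpoch q (- (of_real (\<epsilon>\<^sup>2) * c * d * of_real (q powi (int (part \<mu> k) - int k))))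
        (nat (int (part \<nu> j) - int j - int (part \<mu> k) + int k)) * bqJ_entry q a b c d \<nu> \<mu> j k" for j k
    unfolding bqJ_entry_def Let_def e1 e2 e3 by (simp add: mult.assoc)
  then show ?thesis
    unfolding sigma_qR_def by (simp only:)
qed

lemma qpoch_zero [simp]: "qpoch q 0 n = 1"
  by (simp add: qpoch_def)

lemma tendsto_det_mat:
  fixes f :: "'i \<Rightarrow> nat \<Rightarrow> nat \<Rightarrow> complex"
  assumes "\<And>j k. ((\<lambda>M. f M j k) \<longlongrightarrow> g j k) F"
  shows "((\<lambda>M. Determinant.det (mat n n (\<lambda>(j, k). f M j k))) \<longlongrightarrow>
    Determinant.det (mat n n (\<lambda>(j, k). g j k))) F"
  unfolding det_mat_eq by (intro tendsto_sum tendsto_mult tendsto_prod tendsto_const assms)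

text \<open>The powers of \<epsilon> cancel, since |\<nu>| + (|\<mu>| - |\<nu>|) - |\<mu>| = 0, and
  the factor with \<epsilon>^2 c d left in each entry tends to 1.\<close>

lemma sigma_qR_tendsto:
  fixes q a b :: real and \<epsilon> :: "nat \<Rightarrow> real"
  assumes "q \<noteq> 0" "c \<noteq> 0" "\<And>M. \<epsilon> M \<noteq> 0" "\<epsilon> \<longlonglongrightarrow> 0"
  shows "(\<lambda>M. of_real (\<epsilon> M) ^ sum_list \<nu> * (sigma_qR q (of_real (\<epsilon> M) * c) (of_real (\<epsilon> M) * d)
      (of_real (- q / (\<epsilon> M * a))) (of_real (- q / (\<epsilon> M * b))) \<nu> \<mu> *
      inverse (of_real (\<epsilon> M)) ^ sum_list \<mu>))
    \<longlonglongrightarrow> sigma_bqJ q a b c d \<nu> \<mu> * c ^ sum_list \<mu>"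
proof -
  let ?det = "\<lambda>M. Determinant.det (mat (length \<nu>) (length \<nu>) (\<lambda>(j, k).
      qpoch q (- (of_real ((\<epsilon> M)\<^sup>2) * c * d * of_real (q powi (int (part \<mu> k) - int k))))
        (nat (int (part \<nu> j) - int j - int (part \<mu> k) + int k)) * bqJ_entry q a b c d \<nu> \<mu> j k))"
  let ?C = "c powi (- int (sum_list \<nu>)) * c ^ sum_list \<mu>"
  have eq: "of_real (\<epsilon> M) ^ sum_list \<nu> * (sigma_qR q (of_real (\<epsilon> M) * c) (of_real (\<epsilon> M) * d)
      (of_real (- q / (\<epsilon> M * a))) (of_real (- q / (\<epsilon> M * b))) \<nu> \<mu> *
      inverse (of_real (\<epsilon> M)) ^ sum_list \<mu>) = ?C * ?det M" for M
  proof -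
    have C: "of_real (\<epsilon> M) ^ sum_list \<nu> * (of_real (\<epsilon> M) * c) powi (int (sum_list \<mu>) - int (sum_list \<nu>)) *
        inverse (of_real (\<epsilon> M)) ^ sum_list \<mu> = ?C"
      using assms(2) assms(3)[of M]
      by (simp add: power_int_diff power_int_minus power_mult_distrib field_simps)
    show ?thesis
      unfolding sigma_qR_eq[OF assms(1,3)] C[symmetric] by (simp only: mult_ac)
  qed
  have lim: "?det \<longlonglongrightarrow> Determinant.det (mat (length \<nu>) (length \<nu>) (\<lambda>(j, k). bqJ_entry q a b c d \<nu> \<mu> j k))"
  proof (rule tendsto_det_mat)
    fix j k
    have "(\<lambda>M. qpoch q (- (of_real ((\<epsilon> M)\<^sup>2) * c * d * of_real t)) n) \<longlonglongrightarrow>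
        qpoch q (- (of_real (0\<^sup>2) * c * d * of_real t)) n" for t n
      unfolding qpoch_def by (intro tendsto_intros assms(4))
    then have "(\<lambda>M. qpoch q (- (of_real ((\<epsilon> M)\<^sup>2) * c * d * of_real t)) n) \<longlonglongrightarrow> 1" for t n
      by simp
    then have "(\<lambda>M. qpoch q (- (of_real ((\<epsilon> M)\<^sup>2) * c * d * of_real t)) n * E) \<longlonglongrightarrow> 1 * E" for t n E
      by (rule tendsto_mult_right)
    then show "(\<lambda>M. qpoch q (- (of_real ((\<epsilon> M)\<^sup>2) * c * d * of_real (q powi (int (part \<mu> k) - int k))))
        (nat (int (part \<nu> j) - int j - int (part \<mu> k) + int k)) * bqJ_entry q a b c d \<nu> \<mu> j k)
        \<longlonglongrightarrow> bqJ_entry q a b c d \<nu> \<mu> j k"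
      by (simp only: mult_1)
  qed
  show ?thesis
    unfolding eq sigma_bqJ_eq using tendsto_mult_left[OF lim, of ?C] by (simp only: mult_ac)
qed

text \<open>Its value at the scaled configuration is \<epsilon>^|\<nu>| times that of the q-Racah
  function at the original one, so its integral against the pushforward is known.\<close>

definition scaled_Phi_qR_poly ::
  "real \<Rightarrow> real \<Rightarrow> real \<Rightarrow> complex \<Rightarrow> complex \<Rightarrow> real \<Rightarrow> nat list \<Rightarrow> mpoly" where
  "scaled_Phi_qR_poly q a b c d \<epsilon> \<nu> = Const (of_real \<epsilon> ^ sum_list \<nu>) *
     scale_vars (inverse (of_real \<epsilon>)) (Phi_qR_poly q (of_real \<epsilon> * c) (of_real \<epsilon> * d)
       (of_real (- q / (\<epsilon> * a))) (of_real (- q / (\<epsilon> * b))) \<nu>)"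

lemma scaled_Phi_qR_poly_tendsto:
  fixes q a b :: real and \<epsilon> :: "nat \<Rightarrow> real"
  assumes "q \<noteq> 0" "c \<noteq> 0" "\<And>M. \<epsilon> M \<noteq> 0" "\<epsilon> \<longlonglongrightarrow> 0"
  shows "coeff_tendsto (\<lambda>M. scaled_Phi_qR_poly q a b c d (\<epsilon> M) \<nu>) (Phi_bqJ_poly q a b c d \<nu>)"
proof -
  let ?e = "\<lambda>M. complex_of_real (\<epsilon> M)"
  let ?\<sigma> = "\<lambda>M. sigma_qR q (?e M * c) (?e M * d) (of_real (- q / (\<epsilon> M * a))) (of_real (- q / (\<epsilon> M * b))) \<nu>"
  have e0: "?e M \<noteq> 0" for M using assms(3) by simp
  have node: "node_psum q \<mu> (inverse (?e M * c)) (- (?e M * c)) i k / inverse (?e M) ^ (k + 1) =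
      node_psum q \<mu> (inverse c) (- (?e M ^ 2 * c)) i k" for M \<mu> i k
  proof -
    have "node_psum q \<mu> (?e M * inverse (?e M * c)) (?e M * - (?e M * c)) i k =
        ?e M ^ (k + 1) * node_psum q \<mu> (inverse (?e M * c)) (- (?e M * c)) i k"
      by (rule node_psum_scale)
    moreover have "?e M * inverse (?e M * c) = inverse c" "?e M * - (?e M * c) = - (?e M ^ 2 * c)"
      using e0[of M] by (simp_all add: power2_eq_square)
    ultimately have "node_psum q \<mu> (inverse c) (- (?e M ^ 2 * c)) i k =
        ?e M ^ (k + 1) * node_psum q \<mu> (inverse (?e M * c)) (- (?e M * c)) i k"
      by (simp only:)
    then show ?thesis
      using e0[of M] by (simp add: field_simps)
  qed
  have scale: "scale_vars (inverse (?e M)) (interp_det \<mu> (node_psum q \<mu> (inverse (?e M * c)) (- (?e M * c)))) =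
      Const (inverse (?e M) ^ sum_list \<mu>) * interp_det \<mu> (node_psum q \<mu> (inverse c) (- (?e M ^ 2 * c)))"
    for M \<mu>
  proof -
    have "inverse (?e M) \<noteq> 0" using e0[of M] by simp
    from scale_vars_interp_det[OF this] show ?thesis
      by (simp only: node)
  qed
  have eq: "scaled_Phi_qR_poly q a b c d (\<epsilon> M) \<nu> = (\<Sum>\<mu>\<in>subpartitions \<nu>.
      Const (?e M ^ sum_list \<nu> * (?\<sigma> M \<mu> * inverse (?e M) ^ sum_list \<mu>)) *
      interp_det \<mu> (node_psum q \<mu> (inverse c) (- (?e M ^ 2 * c))))" for M
    unfolding scaled_Phi_qR_poly_def Phi_qR_poly_def subst.hom_sum subst_Const_mult scale sum_distrib_left
    by (simp only: Const.hom_mult mult.assoc)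
  have node_lim: "(\<lambda>M. node_psum q \<mu> (inverse c) (- (?e M ^ 2 * c)) i k) \<longlonglongrightarrow>
      node_psum q \<mu> (inverse c) 0 i k" for \<mu> i k
  proof -
    have "(\<lambda>M. - (?e M ^ 2 * c)) \<longlonglongrightarrow> - (of_real 0 ^ 2 * c)"
      by (intro tendsto_intros assms(4))
    then have "(\<lambda>M. - (?e M ^ 2 * c)) \<longlonglongrightarrow> 0" by simp
    then show ?thesis
      unfolding node_psum_def by (intro tendsto_sum tendsto_mult tendsto_power tendsto_const)
  qed
  show ?thesis
    unfolding eq Phi_bqJ_poly_def
    by (intro coeff_tendsto_sum coeff_tendsto_mult coeff_tendsto_Const coeff_tendsto_interp_det
        node_lim sigma_qR_tendsto assms)
qed

section \<open>Weights of the limit functions and the count of partitions\<close>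

lemma sum_list_subpartition_le:
  assumes "\<mu> \<in> subpartitions \<nu>"
  shows "sum_list \<mu> \<le> sum_list \<nu>"
proof -
  let ?n = "max (length \<mu>) (length \<nu>)"
  have "(\<Sum>i<?n. part \<mu> i) \<le> (\<Sum>i<?n. part \<nu> i)"
    using assms by (intro sum_mono) (auto simp: subpartitions_def)
  then show ?thesis
    using sum_list_eq_sum_part[of \<mu> ?n] sum_list_eq_sum_part[of \<nu> ?n] by simp
qed

lemma deg_le_weight_Phi_bqJ_poly: "deg_le weight (sum_list \<nu>) (Phi_bqJ_poly q a b c d \<nu>)"
  unfolding Phi_bqJ_poly_def
  by (intro deg_le_sum weight.deg_le_Const_mult deg_le_mono[OF deg_le_weight_interp_det]
      sum_list_subpartition_le)

lemma subpartitions_Nil: "subpartitions [] = {[]}"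
proof -
  have "\<mu> = []" if "is_partition \<mu>" "\<forall>i. part \<mu> i \<le> 0" for \<mu>
    using that by (cases \<mu>) (auto simp: is_partition_def part_def dest: spec[of _ 0])
  then show ?thesis
    by (auto simp: subpartitions_def part_def is_partition_def)
qed

lemma Phi_bqJ_poly_Nil: "Phi_bqJ_poly q a b c d [] = 1"
  by (simp add: Phi_bqJ_poly_def subpartitions_Nil sigma_bqJ_def interp_det_def)

interpretation mpoly: vector_space "\<lambda>c P. Const c * P"
  by unfold_locales (simp_all add: Const.hom_add Const.hom_mult algebra_simps)

text \<open>A monomial in the power sums is a product p_\<lambda>; this lists \<lambda>, with the
  part i + 1 repeated as often as the exponent of variable \<open>i\<close> says. Variables from
  index \<open>n\<close> on are ignored.\<close>

fun parts_of :: "nat \<Rightarrow> monom \<Rightarrow> nat list" where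
  "parts_of 0 m = []"
| "parts_of (Suc n) m = replicate (Poly_Mapping.lookup m n) (n + 1) @ parts_of n m"

lemma set_parts_of: "set (parts_of n m) \<subseteq> {1..n}"
  by (induction n) auto

lemma is_partition_parts_of: "is_partition (parts_of n m)"
proof (induction n)
  case (Suc n)
  have "sorted_wrt (\<ge>) (replicate k x)" for k and x :: nat
    by (induction k) auto
  with Suc show ?case
    using set_parts_of[of n m] unfolding is_partition_def by (force simp: sorted_wrt_append)
qed (simp add: is_partition_def)

lemma sum_list_parts_of: "sum_list (parts_of n m) = (\<Sum>i<n. (i + 1) * Poly_Mapping.lookup m i)"
  by (induction n) (simp_all add: sum_list_replicate)

lemma count_list_parts_of: "i < n \<Longrightarrow> count_list (parts_of n m) (i + 1) = Poly_Mapping.lookup m i"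
proof (induction n)
  case (Suc n)
  have rep: "count_list (replicate k x) y = (if x = y then k else 0)" for k and x y :: nat
    by (induction k) auto
  have "count_list (parts_of n m) (n + 1) = 0"
    using set_parts_of[of n m] by (intro count_notin) auto
  with Suc show ?case by (cases "i = n") (auto simp: rep)
qed simp

lemma keys_subset_of_weight:
  assumes "weight m \<le> d"
  shows "Poly_Mapping.keys m \<subseteq> {..<d}"
proof
  fix i assume i: "i \<in> Poly_Mapping.keys m"
  then have "(i + 1) * Poly_Mapping.lookup m i \<le> weight m"
    unfolding weight_def by (rule member_le_sum) auto
  moreover have "1 \<le> Poly_Mapping.lookup m i"
    using i by (simp add: in_keys_iff)
  then have "(i + 1) * 1 \<le> (i + 1) * Poly_Mapping.lookup m i"
    by (rule mult_le_mono2)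
  ultimately show "i \<in> {..<d}" using assms by simp
qed

lemma finite_partitions_le: "finite {\<nu>. is_partition \<nu> \<and> sum_list \<nu> \<le> d}"
proof (rule finite_subset)
  show "{\<nu>. is_partition \<nu> \<and> sum_list \<nu> \<le> d} \<subseteq> {xs. set xs \<subseteq> {..d} \<and> length xs \<le> d}"
  proof (rule subsetI, intro CollectI conjI)
    fix \<nu> assume \<nu>: "\<nu> \<in> {\<nu>. is_partition \<nu> \<and> sum_list \<nu> \<le> d}"
    show "set \<nu> \<subseteq> {..d}"
      using \<nu> member_le_sum_list[of _ \<nu>] by force
    have "0 \<notin> set \<nu> \<Longrightarrow> length \<nu> \<le> sum_list \<nu>"
      by (induction \<nu>) auto
    then show "length \<nu> \<le> d"
      using \<nu> by (auto simp: is_partition_def)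
  qed
  show "finite {xs. set xs \<subseteq> {..d} \<and> length xs \<le> d}"
    by (rule finite_lists_length_le) simp
qed

text \<open>Exponents are multiplicities of parts, so \<open>parts_of d\<close> is injective once
  all variable indices lie below \<open>d\<close>. The dimension count uses the inequality in this
  direction: no more monomials than partitions.\<close>

lemma monoms_le_partitions:
  "finite {m. weight m \<le> d}"
  "card {m. weight m \<le> d} \<le> card {\<nu>. is_partition \<nu> \<and> sum_list \<nu> \<le> d}"
proof -
  have inj: "inj_on (parts_of d) {m. weight m \<le> d}"
  proof (rule inj_onI, rule poly_mapping_eqI)
    fix m m' i assume m: "m \<in> {m. weight m \<le> d}" "m' \<in> {m. weight m \<le> d}"
      and eq: "parts_of d m = parts_of d m'"
    show "Poly_Mapping.lookup m i = Poly_Mapping.lookup m' i"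
    proof (cases "i < d")
      case True
      then show ?thesis using eq count_list_parts_of[OF True] by metis
    next
      case False
      then have "i \<notin> Poly_Mapping.keys m" "i \<notin> Poly_Mapping.keys m'"
        using m keys_subset_of_weight by blast+
      then show ?thesis by (simp add: in_keys_iff)
    qed
  qed
  have sub: "parts_of d ` {m. weight m \<le> d} \<subseteq> {\<nu>. is_partition \<nu> \<and> sum_list \<nu> \<le> d}"
  proof (intro subsetI CollectI conjI)
    fix \<nu> assume "\<nu> \<in> parts_of d ` {m. weight m \<le> d}"
    then obtain m where m: "weight m \<le> d" "\<nu> = parts_of d m" by blast
    show "is_partition \<nu>" using m(2) is_partition_parts_of by simp
    show "sum_list \<nu> \<le> d"
      using m weight_superset[OF _ keys_subset_of_weight[OF m(1)]] by (simp add: sum_list_parts_of)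
  qed
  show "finite {m. weight m \<le> d}"
    using finite_imageD[OF finite_subset[OF sub finite_partitions_le] inj] .
  show "card {m. weight m \<le> d} \<le> card {\<nu>. is_partition \<nu> \<and> sum_list \<nu> \<le> d}"
    using card_inj_on_le[OF inj sub finite_partitions_le] .
qed

text \<open>The polynomials of weight at most \<open>d\<close> have a basis of monomials indexed by the
  partitions of size at most \<open>d\<close>, so independence suffices for spanning.\<close>

lemma independent_family_spans:
  fixes \<Phi> :: "nat list \<Rightarrow> mpoly"
  assumes deg: "\<And>\<nu>. deg_le weight (sum_list \<nu>) (\<Phi> \<nu>)"
    and indep: "\<And>S w \<nu>. finite S \<Longrightarrow> S \<subseteq> {\<nu>. is_partition \<nu>} \<Longrightarrow>
      (\<Sum>\<nu>\<in>S. Const (w \<nu>) * \<Phi> \<nu>) = 0 \<Longrightarrow> \<nu> \<in> S \<Longrightarrow> w \<nu> = 0"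
  shows "\<exists>S w. finite S \<and> S \<subseteq> {\<nu>. is_partition \<nu>} \<and> Q = (\<Sum>\<nu>\<in>S. Const (w \<nu>) * \<Phi> \<nu>)"
proof -
  obtain d where d: "deg_le weight d Q"
    using ex_deg_le by blast
  define I where "I = {\<nu>. is_partition \<nu> \<and> sum_list \<nu> \<le> d}"
  define T where "T = (\<lambda>m. Poly_Mapping.single m (1::complex)) ` {m. weight m \<le> d}"
  have finI: "finite I" and I: "I \<subseteq> {\<nu>. is_partition \<nu>}"
    unfolding I_def using finite_partitions_le by auto
  have finT: "finite T" and cardT: "card T \<le> card I"
    unfolding T_def I_def using monoms_le_partitions[of d] card_image_le by (auto intro: order_trans)
  have span: "P \<in> mpoly.span T" if "deg_le weight d P" for P
  proof -
    have "P = (\<Sum>m\<in>Poly_Mapping.keys P. Const (Poly_Mapping.lookup P m) * Poly_Mapping.single m 1)"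
      unfolding single_eq_Const_times[symmetric] by (rule mpoly_sum_singles)
    also have "\<dots> \<in> mpoly.span T"
      using that by (intro mpoly.span_sum mpoly.span_scale mpoly.span_base)
        (auto simp: T_def deg_le_def)
    finally show ?thesis .
  qed
  \<comment> \<open>Two equal members would give a vanishing combination with coefficients 1 and
    -1.\<close>
  have inj: "inj_on \<Phi> I"
  proof (rule inj_onI, rule ccontr)
    fix \<nu> \<nu>' assume *: "\<nu> \<in> I" "\<nu>' \<in> I" "\<Phi> \<nu> = \<Phi> \<nu>'" "\<nu> \<noteq> \<nu>'"
    define w where "w \<kappa> = (if \<kappa> = \<nu> then 1 else - 1 :: complex)" for \<kappa>
    have "(\<Sum>\<kappa>\<in>{\<nu>, \<nu>'}. Const (w \<kappa>) * \<Phi> \<kappa>) = 0"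
      using * by (simp add: w_def Const.hom_uminus)
    from indep[OF _ _ this, of \<nu>] * I show False
      by (auto simp: w_def)
  qed
  have ind: "mpoly.independent (\<Phi> ` I)"
  proof (rule mpoly.independent_if_scalars_zero)
    fix f x assume "(\<Sum>x\<in>\<Phi> ` I. Const (f x) * x) = 0" and x: "x \<in> \<Phi> ` I"
    then have "(\<Sum>\<nu>\<in>I. Const (f (\<Phi> \<nu>)) * \<Phi> \<nu>) = 0"
      by (simp add: sum.reindex[OF inj])
    with x show "f x = 0"
      using indep[OF finI I, of "\<lambda>\<nu>. f (\<Phi> \<nu>)"] by blast
  qed (use finI in simp)
  have sub: "\<Phi> ` I \<subseteq> mpoly.span T"
    using span deg_le_mono[OF deg] by (auto simp: I_def)
  \<comment> \<open>A monomial outside the span could be adjoined, producing more than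
    \<open>card T\<close> independent vectors within the span of \<open>T\<close>.\<close>
  have "T \<subseteq> mpoly.span (\<Phi> ` I)"
  proof (rule ccontr)
    assume "\<not> T \<subseteq> mpoly.span (\<Phi> ` I)"
    then obtain x where x: "x \<in> T" "x \<notin> mpoly.span (\<Phi> ` I)" by blast
    have "mpoly.independent (insert x (\<Phi> ` I))"
      using mpoly.independent_insertI[OF x(2) ind] .
    moreover have "insert x (\<Phi> ` I) \<subseteq> mpoly.span T"
      using sub x(1) mpoly.span_base by auto
    ultimately have "card (insert x (\<Phi> ` I)) \<le> card T"
      using mpoly.independent_span_bound[OF finT] by blast
    moreover have "card (insert x (\<Phi> ` I)) = Suc (card I)"
      using x(2) finI mpoly.span_base by (subst card_insert_disjoint) (auto simp: card_image[OF inj])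
    ultimately show False using cardT by simp
  qed
  then have "mpoly.span T \<subseteq> mpoly.span (\<Phi> ` I)"
    by (rule mpoly.span_minimal) (rule mpoly.subspace_span)
  then have "Q \<in> mpoly.span (\<Phi> ` I)"
    using span[OF d] by (rule subsetD)
  also have "mpoly.span (\<Phi> ` I) = range (\<lambda>u. \<Sum>x\<in>\<Phi> ` I. Const (u x) * x)"
    by (rule mpoly.span_finite) (use finI in simp)
  finally obtain u where "Q = (\<Sum>x\<in>\<Phi> ` I. Const (u x) * x)"
    by (rule imageE)
  then have "Q = (\<Sum>\<nu>\<in>I. Const (u (\<Phi> \<nu>)) * \<Phi> \<nu>)"
    unfolding sum.reindex[OF inj] o_def .
  with finI I show ?thesis by (intro exI conjI)
qed

section \<open>Functions on the space of configurations\<close>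

definition conf_eval :: "mpoly \<Rightarrow> real set \<Rightarrow> complex" where
  "conf_eval Q X = eval_at (\<lambda>i. power_sum (i + 1) X) Q"

lemma has_sum_diff:
  fixes f g :: "'a \<Rightarrow> real"
  assumes "(f has_sum s) A" "(g has_sum t) A"
  shows "((\<lambda>x. f x - g x) has_sum (s - t)) A"
  using has_sum_add[OF assms(1) has_sum_cmult_right[OF assms(2), of "- 1"]] by simp

text \<open>Summability makes every power sum converge and lets the points accumulate at 0 only; as
  0 is excluded, each point is isolated.\<close>

locale conf_grid =
  fixes \<Delta> :: "real set"
  assumes summable: "(\<lambda>x. \<bar>x\<bar>) summable_on \<Delta>"
    and zero_notin: "0 \<notin> \<Delta>"
begin

text \<open>Indicators are extended by 0 to all reals, so that the type-class topology on functions
  applies; compactness is then Tychonoff's theorem.\<close>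

definition cube :: "(real \<Rightarrow> real) set" where
  "cube = PiE UNIV (\<lambda>x. if x \<in> \<Delta> then {0, 1} else {0})"

definition ind :: "real set \<Rightarrow> real \<Rightarrow> real" where
  "ind X = (\<lambda>x. if x \<in> X then 1 else 0)"

definition cube_psum :: "nat \<Rightarrow> (real \<Rightarrow> real) \<Rightarrow> real" where
  "cube_psum k \<phi> = (\<Sum>\<^sub>\<infinity>x\<in>\<Delta>. \<phi> x * x ^ k)"

lemma cube_iff: "\<phi> \<in> cube \<longleftrightarrow> (\<forall>x. \<phi> x = 0 \<or> x \<in> \<Delta> \<and> \<phi> x = 1)"
  by (auto simp: cube_def PiE_iff)

lemma ind_in_cube: "X \<subseteq> \<Delta> \<Longrightarrow> ind X \<in> cube"
  by (auto simp: cube_iff ind_def)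

lemma compact_cube: "compact cube"
proof -
  have "compactin (product_topology (\<lambda>_. euclidean) UNIV) cube"
    unfolding cube_def compactin_PiE by simp
  then show ?thesis
    by (simp only: euclidean_product_topology compactin_euclidean_iff)
qed

lemma sum_abs_le:
  assumes "finite F" "F \<subseteq> \<Delta>"
  shows "(\<Sum>x\<in>F. \<bar>x\<bar>) \<le> (\<Sum>\<^sub>\<infinity>x\<in>\<Delta>. \<bar>x\<bar>)"
  by (rule finite_sum_le_infsum[OF summable assms]) simp

lemma abs_le: "x \<in> \<Delta> \<Longrightarrow> \<bar>x\<bar> \<le> (\<Sum>\<^sub>\<infinity>x\<in>\<Delta>. \<bar>x\<bar>)"
  using sum_abs_le[of "{x}"] by simp

lemma finite_abs_ge:
  assumes "0 < c"
  shows "finite {x \<in> \<Delta>. c \<le> \<bar>x\<bar>}"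
proof (rule ccontr)
  assume inf: "infinite {x \<in> \<Delta>. c \<le> \<bar>x\<bar>}"
  define B where "B = (\<Sum>\<^sub>\<infinity>x\<in>\<Delta>. \<bar>x\<bar>)"
  obtain n :: nat where n: "B / c < real n"
    using reals_Archimedean2 by blast
  obtain F where F: "finite F" "card F = n" "F \<subseteq> {x \<in> \<Delta>. c \<le> \<bar>x\<bar>}"
    using infinite_arbitrarily_large[OF inf] by blast
  have "real n * c \<le> (\<Sum>x\<in>F. \<bar>x\<bar>)"
    using F sum_bounded_below[of F c abs] by auto
  also have "\<dots> \<le> B"
    unfolding B_def using F by (intro sum_abs_le) auto
  finally show False
    using n assms by (simp add: divide_less_eq)
qed

text \<open>Only finitely many points have absolute value at least |x|/2, and all others stay at
  distance at least |x|/2 from \<open>x\<close>.\<close>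

lemma isolated:
  assumes "x \<in> \<Delta>"
  shows "\<exists>\<delta>>0. \<forall>y\<in>\<Delta>. y \<noteq> x \<longrightarrow> \<delta> \<le> \<bar>y - x\<bar>"
proof -
  have x0: "x \<noteq> 0" using assms zero_notin by auto
  define A where "A = {y \<in> \<Delta>. \<bar>x\<bar> / 2 \<le> \<bar>y\<bar>} - {x}"
  have A: "finite A"
    unfolding A_def using finite_abs_ge[of "\<bar>x\<bar> / 2"] x0 by simp
  define \<delta> where "\<delta> = Min (insert (\<bar>x\<bar> / 2) ((\<lambda>y. \<bar>y - x\<bar>) ` A))"
  have "0 < \<delta>"
    unfolding \<delta>_def using A x0 by (subst Min_gr_iff) (auto simp: A_def)
  moreover have "\<delta> \<le> \<bar>y - x\<bar>" if "y \<in> \<Delta>" "y \<noteq> x" for y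
  proof (cases "y \<in> A")
    case True
    then show ?thesis unfolding \<delta>_def using A by (intro Min_le) auto
  next
    case False
    then have "\<bar>y\<bar> < \<bar>x\<bar> / 2" using that by (auto simp: A_def)
    then have "\<bar>x\<bar> / 2 \<le> \<bar>y - x\<bar>" by linarith
    moreover have "\<delta> \<le> \<bar>x\<bar> / 2" unfolding \<delta>_def using A by (intro Min_le) auto
    ultimately show ?thesis by linarith
  qed
  ultimately show ?thesis by blast
qed

section \<open>Power sums as functions on the cube\<close>

lemma summable_power:
  assumes "1 \<le> k"
  shows "(\<lambda>x. \<bar>x\<bar> ^ k) summable_on \<Delta>"
proof (rule summable_on_comparison_test)
  define B where "B = (\<Sum>\<^sub>\<infinity>x\<in>\<Delta>. \<bar>x\<bar>)"
  show "(\<lambda>x. B ^ (k - 1) * \<bar>x\<bar>) summable_on \<Delta>"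
    by (intro summable_on_cmult_right summable)
  show "\<bar>x\<bar> ^ k \<le> B ^ (k - 1) * \<bar>x\<bar>" if "x \<in> \<Delta>" for x
  proof -
    have "\<bar>x\<bar> ^ k = \<bar>x\<bar> ^ (k - 1) * \<bar>x\<bar>"
      using assms by (intro power_minus_mult[symmetric]) simp
    also have "\<dots> \<le> B ^ (k - 1) * \<bar>x\<bar>"
      unfolding B_def using abs_le[OF that] by (intro mult_right_mono power_mono) auto
    finally show ?thesis .
  qed
qed simp

lemma cube_term_le: "\<phi> \<in> cube \<Longrightarrow> norm (\<phi> x * x ^ k) \<le> \<bar>x\<bar> ^ k"
  by (cases "\<phi> x = 0") (auto simp: cube_iff power_abs dest: spec[of _ x])

lemma has_sum_cube_psum:
  assumes "1 \<le> k" "\<phi> \<in> cube"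
  shows "((\<lambda>x. \<phi> x * x ^ k) has_sum cube_psum k \<phi>) \<Delta>"
  unfolding cube_psum_def
proof (rule has_sum_infsum, rule abs_summable_summable)
  show "(\<lambda>x. norm (\<phi> x * x ^ k)) summable_on \<Delta>"
    by (rule summable_on_comparison_test[OF summable_power[OF assms(1)]])
      (use cube_term_le[OF assms(2)] in auto)
qed

text \<open>Finite partial sums depend on finitely many coordinates, and by the Weierstrass test
  with the bound |x|^k they converge uniformly.\<close>

lemma continuous_on_cube_psum:
  assumes "1 \<le> k"
  shows "continuous_on cube (cube_psum k)"
proof (rule uniform_limit_theorem)
  show "uniform_limit cube (\<lambda>F \<phi>. \<Sum>x\<in>F. \<phi> x * x ^ k) (cube_psum k) (finite_subsets_at_top \<Delta>)"
    unfolding cube_psum_def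
    by (rule Weierstrass_m_test_general[OF _ summable_power[OF assms]]) (rule cube_term_le)
  have "continuous_on cube (\<lambda>\<phi>. \<phi> x)" for x :: real
    by (rule continuous_on_subset[OF continuous_on_product_coordinates]) simp
  then show "\<forall>\<^sub>F F in finite_subsets_at_top \<Delta>. continuous_on cube (\<lambda>\<phi>. \<Sum>x\<in>F. \<phi> x * x ^ k)"
    by (intro always_eventually allI continuous_intros)
qed simp

lemma power_sum_eq:
  assumes "1 \<le> k" "X \<subseteq> \<Delta>"
  shows "power_sum k X = of_real (cube_psum k (ind X))"
proof -
  have "((\<lambda>x. complex_of_real (ind X x * x ^ k)) has_sum of_real (cube_psum k (ind X))) \<Delta>"
    by (rule has_sum_of_real[OF has_sum_cube_psum[OF assms(1) ind_in_cube[OF assms(2)]]])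
  then have "(\<Sum>\<^sub>\<infinity>x\<in>\<Delta>. complex_of_real (ind X x * x ^ k)) = of_real (cube_psum k (ind X))"
    by (rule infsumI)
  moreover have "(\<Sum>\<^sub>\<infinity>x\<in>X. of_real x ^ k) = (\<Sum>\<^sub>\<infinity>x\<in>\<Delta>. complex_of_real (ind X x * x ^ k))"
    using assms(2) by (intro infsum_cong_neutral) (auto simp: ind_def)
  ultimately show ?thesis
    by (simp add: power_sum_def)
qed

text \<open>If all moments agree, so do the integrals of all continuous functions, in particular of
  a bump around an isolated point of the grid.\<close>

lemma cube_psum_separates:
  assumes \<phi>: "\<phi> \<in> cube" and \<psi>: "\<psi> \<in> cube"
    and eq: "\<And>k. 1 \<le> k \<Longrightarrow> cube_psum k \<phi> = cube_psum k \<psi>"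
  shows "\<phi> = \<psi>"
proof (rule ccontr)
  assume "\<phi> \<noteq> \<psi>"
  then obtain x0 where x0: "\<phi> x0 \<noteq> \<psi> x0" by blast
  then have x0\<Delta>: "x0 \<in> \<Delta>" and w0: "\<bar>\<phi> x0 - \<psi> x0\<bar> = 1"
    using \<phi> \<psi> unfolding cube_iff by (auto dest!: spec[of _ x0])
  define w where "w x = \<phi> x - \<psi> x" for x
  define B where "B = (\<Sum>\<^sub>\<infinity>x\<in>\<Delta>. \<bar>x\<bar>)"
  have B0: "0 \<le> B" unfolding B_def by (rule infsum_nonneg) simp
  have w1: "\<bar>w x\<bar> \<le> 1" for x
  proof -
    have "\<phi> x \<in> {0, 1}" "\<psi> x \<in> {0, 1}" using \<phi> \<psi> unfolding cube_iff by auto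
    then show ?thesis by (auto simp: w_def)
  qed
  have mom: "((\<lambda>x. w x * x ^ k) has_sum 0) \<Delta>" if "1 \<le> k" for k
    using has_sum_diff[OF has_sum_cube_psum[OF that \<phi>] has_sum_cube_psum[OF that \<psi>]] eq[OF that]
    by (simp add: w_def left_diff_distrib)
  \<comment> \<open>The moments begin at k = 1, so a polynomial can be integrated against
    \<open>w\<close> only after multiplication by x.\<close>
  have poly: "((\<lambda>x. w x * x * (\<Sum>i\<le>n. a i * x ^ i)) has_sum 0) \<Delta>" for a and n :: nat
  proof (induction n)
    case 0
    have "((\<lambda>x. a 0 * (w x * x ^ 1)) has_sum a 0 * 0) \<Delta>"
      by (intro has_sum_cmult_right mom) simp
    then show ?case by (simp add: mult_ac)
  next
    case (Suc n)
    have "((\<lambda>x. a (Suc n) * (w x * x ^ (Suc n + 1))) has_sum a (Suc n) * 0) \<Delta>"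
      by (intro has_sum_cmult_right mom) simp
    from has_sum_add[OF Suc this] show ?case
      by (simp add: algebra_simps)
  qed
  obtain \<delta> where \<delta>: "0 < \<delta>" "\<And>y. y \<in> \<Delta> \<Longrightarrow> y \<noteq> x0 \<Longrightarrow> \<delta> \<le> \<bar>y - x0\<bar>"
    using isolated[OF x0\<Delta>] by blast
  define f where "f x = max 0 (1 - \<bar>x - x0\<bar> / \<delta>)" for x
  have f0: "f y = 0" if "y \<in> \<Delta>" "y \<noteq> x0" for y
    using \<delta>(2)[OF that] \<delta>(1) by (simp add: f_def field_simps max_def)
  have fx0: "f x0 = 1" by (simp add: f_def)
  have cont: "continuous_on {-B..B} f"
    unfolding f_def using \<delta>(1) by (intro continuous_intros) auto
  \<comment> \<open>The bump \<open>f\<close> leaves only the term at \<open>x0\<close>, its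
    approximating polynomial integrates to 0, and their difference costs at most \<open>e\<close>
    times the sum of all |x|.\<close>
  have small: "\<bar>x0\<bar> \<le> e * B" if "0 < e" for e
  proof -
    obtain g where g: "real_polynomial_function g" "\<And>x. x \<in> {-B..B} \<Longrightarrow> \<bar>f x - g x\<bar> < e"
      using Stone_Weierstrass_real_polynomial_function[OF compact_Icc cont \<open>0 < e\<close>] by metis
    obtain a n where an: "g = (\<lambda>x. \<Sum>i\<le>n. a i * x ^ i)"
      using real_polynomial_function_imp_sum[OF g(1)] by blast
    have gsum: "((\<lambda>x. w x * x * g x) has_sum 0) \<Delta>"
      unfolding an by (rule poly)
    have "((\<lambda>x. w x * x * f x) has_sum w x0 * x0) \<Delta>"
    proof -
      have "((\<lambda>x. w x * x * f x) has_sum (\<Sum>x\<in>{x0}. w x * x * f x)) {x0}"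
        by (rule has_sum_finite) simp
      then show ?thesis
        using has_sum_cong_neutral[of \<Delta> "{x0}" "\<lambda>x. w x * x * f x" "\<lambda>x. w x * x * f x"] x0\<Delta>
        by (simp add: f0 fx0)
    qed
    from has_sum_diff[OF this gsum]
    have hs: "((\<lambda>x. w x * x * (f x - g x)) has_sum w x0 * x0) \<Delta>"
      by (simp add: right_diff_distrib)
    have le: "norm (w x * x * (f x - g x)) \<le> e * \<bar>x\<bar>" if "x \<in> \<Delta>" for x
    proof -
      have "\<bar>x\<bar> \<le> B" unfolding B_def by (rule abs_le[OF that])
      then have "\<bar>f x - g x\<bar> \<le> e"
        by (intro less_imp_le g(2)) auto
      moreover have "\<bar>w x * x\<bar> \<le> \<bar>x\<bar>"
        using w1[of x] by (simp add: abs_mult mult_left_le_one_le)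
      ultimately have "\<bar>w x * x\<bar> * \<bar>f x - g x\<bar> \<le> \<bar>x\<bar> * e"
        by (intro mult_mono) auto
      then show ?thesis by (simp add: abs_mult mult_ac)
    qed
    have "((\<lambda>x. e * \<bar>x\<bar>) has_sum e * B) \<Delta>"
      unfolding B_def by (intro has_sum_cmult_right has_sum_infsum summable)
    then have "norm (w x0 * x0) \<le> e * B"
      using norm_infsum_le[OF hs _ le] by blast
    then show ?thesis
      using w0 by (simp add: w_def abs_mult)
  qed
  \<comment> \<open>This value of \<open>e\<close> turns the bound into |x0| \<le> |x0|/2; adding 1
    to \<open>B\<close> keeps the denominator positive.\<close>
  have "\<bar>x0\<bar> \<le> \<bar>x0\<bar> / (2 * (B + 1)) * B"
    using x0\<Delta> zero_notin B0 by (intro small divide_pos_pos) auto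
  also have "\<dots> = \<bar>x0\<bar> * (B / (2 * (B + 1)))" by simp
  also have "\<dots> \<le> \<bar>x0\<bar> * (1 / 2)"
    using B0 by (intro mult_left_mono) (auto simp: field_simps)
  finally show False
    using x0\<Delta> zero_notin by auto
qed

definition cube_eval :: "mpoly \<Rightarrow> (real \<Rightarrow> real) \<Rightarrow> complex" where
  "cube_eval Q \<phi> = eval_at (\<lambda>i. of_real (cube_psum (i + 1) \<phi>)) Q"

lemma continuous_on_cube_eval: "continuous_on cube (cube_eval Q)"
  unfolding cube_eval_def mp_eval_def
  by (intro continuous_intros continuous_on_cube_psum) simp

lemma conf_eval_eq: "X \<subseteq> \<Delta> \<Longrightarrow> conf_eval Q X = cube_eval Q (ind X)"
  unfolding conf_eval_def cube_eval_def by (intro eval_at_cong power_sum_eq) simp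

lemma conf_eval_bounded: "\<exists>C. \<forall>X\<subseteq>\<Delta>. norm (conf_eval Q X) \<le> C"
proof -
  have "bounded (cube_eval Q ` cube)"
    by (intro compact_imp_bounded compact_continuous_image continuous_on_cube_eval compact_cube)
  then obtain C where "\<And>\<phi>. \<phi> \<in> cube \<Longrightarrow> norm (cube_eval Q \<phi>) \<le> C"
    unfolding bounded_iff by blast
  then show ?thesis
    by (intro exI[of _ C]) (simp add: conf_eval_eq ind_in_cube)
qed

definition cube_emb :: "(real \<Rightarrow> real) \<Rightarrow> nat \<Rightarrow> real" where
  "cube_emb \<phi> = (\<lambda>i. cube_psum (i + 1) \<phi>)"

lemma inj_on_cube_emb: "inj_on cube_emb cube"
proof (rule inj_onI, rule cube_psum_separates)
  fix \<phi> \<psi> and k :: nat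
  assume "cube_emb \<phi> = cube_emb \<psi>" "1 \<le> k"
  then show "cube_psum k \<phi> = cube_psum k \<psi>"
    unfolding cube_emb_def fun_eq_iff by (auto dest: spec[of _ "k - 1"])
qed

lemma continuous_on_cube_emb: "continuous_on cube cube_emb"
  unfolding cube_emb_def
  by (intro continuous_on_coordinatewise_then_product continuous_on_cube_psum) simp

text \<open>Functions on an uncountable index type are not an instance of \<open>t2_space\<close>, which the
  Stone--Weierstrass theorem requires; it is applied on the compact image of the moment map.\<close>

lemma stone_weierstrass_cube:
  assumes "continuous_on cube g" "0 < e"
  shows "\<exists>Q. \<forall>\<phi>\<in>cube. norm (of_real (g \<phi>) - cube_eval Q \<phi>) < e"
proof -
  define K where "K = cube_emb ` cube"
  define ev where "ev Q y = eval_at (\<lambda>i. complex_of_real (y i)) Q" for Q and y :: "nat \<Rightarrow> real"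
  \<comment> \<open>Real functions represented by a polynomial with complex coefficients: real as
    Stone--Weierstrass demands, and already in the form in which the approximant is wanted.\<close>
  define R where "R = {u. \<exists>Q. \<forall>y. complex_of_real (u y) = ev Q y}"
  interpret function_ring_on R K
  proof
    show "compact K"
      unfolding K_def by (rule compact_continuous_image[OF continuous_on_cube_emb compact_cube])
    show "continuous_on K u" if u: "u \<in> R" for u
    proof -
      obtain Q where Q: "\<And>y. complex_of_real (u y) = ev Q y"
        using u unfolding R_def by blast
      have "continuous_on K (\<lambda>y. Re (ev Q y))"
        unfolding ev_def mp_eval_def
        by (intro continuous_intros continuous_on_subset[OF continuous_on_product_coordinates]) simp
      then show ?thesis
        unfolding Q[symmetric] Re_complex_of_real .
    qed
    show "(\<lambda>\<phi>. u \<phi> + v \<phi>) \<in> R" if uv: "u \<in> R" "v \<in> R" for u v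
    proof -
      obtain Q Q' where "\<And>y. complex_of_real (u y) = ev Q y" "\<And>y. complex_of_real (v y) = ev Q' y"
        using uv unfolding R_def by blast
      then have "\<forall>y. complex_of_real (u y + v y) = ev (Q + Q') y"
        by (simp add: ev_def eval_at.hom_add)
      then show ?thesis unfolding R_def by blast
    qed
    show "(\<lambda>\<phi>. u \<phi> * v \<phi>) \<in> R" if uv: "u \<in> R" "v \<in> R" for u v
    proof -
      obtain Q Q' where "\<And>y. complex_of_real (u y) = ev Q y" "\<And>y. complex_of_real (v y) = ev Q' y"
        using uv unfolding R_def by blast
      then have "\<forall>y. complex_of_real (u y * v y) = ev (Q * Q') y"
        by (simp add: ev_def eval_at.hom_mult)
      then show ?thesis unfolding R_def by blast
    qed
    show "(\<lambda>_. c) \<in> R" for c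
    proof -
      have "\<forall>y. complex_of_real c = ev (Const (of_real c)) y"
        by (simp add: ev_def)
      then show ?thesis unfolding R_def by blast
    qed
    show "\<exists>u\<in>R. u y \<noteq> u z" if yz: "y \<in> K" "z \<in> K" "y \<noteq> z" for y z
    proof -
      obtain i where "y i \<noteq> z i" using yz(3) by blast
      moreover have "(\<lambda>x. x i) \<in> R"
      proof -
        have "\<forall>x. complex_of_real (x i) = ev (Var i) x"
          by (simp add: ev_def)
        then have "\<exists>Q. \<forall>x. complex_of_real (x i) = ev Q x"
          by (rule exI)
        then show ?thesis
          unfolding R_def by (simp only: mem_Collect_eq)
      qed
      ultimately show ?thesis by (intro bexI[of _ "\<lambda>x. x i"])
    qed
  qed
  \<comment> \<open>A continuous injection of a compact set has a continuous inverse on its image;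
    it carries \<open>g\<close> over to \<open>K\<close>.\<close>
  have "continuous_on K (inv_into cube cube_emb)"
    unfolding K_def
    by (rule continuous_on_inv[OF continuous_on_cube_emb compact_cube])
      (simp add: inv_into_f_f[OF inj_on_cube_emb])
  moreover have "inv_into cube cube_emb ` K \<subseteq> cube"
    unfolding K_def by (rule image_subsetI) (rule inv_into_into)
  ultimately have "continuous_on K (\<lambda>y. g (inv_into cube cube_emb y))"
    by (rule continuous_on_compose2[OF assms(1)])
  from Stone_Weierstrass_basic[OF this assms(2)]
  obtain u where u: "u \<in> R" "\<And>y. y \<in> K \<Longrightarrow> \<bar>g (inv_into cube cube_emb y) - u y\<bar> < e"
    by blast
  then obtain Q where Q: "\<And>y. complex_of_real (u y) = ev Q y"
    unfolding R_def by blast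
  have "norm (of_real (g \<phi>) - cube_eval Q \<phi>) < e" if "\<phi> \<in> cube" for \<phi>
  proof -
    have "\<bar>g \<phi> - u (cube_emb \<phi>)\<bar> < e"
      using u(2)[of "cube_emb \<phi>"] inv_into_f_f[OF inj_on_cube_emb that] that by (simp add: K_def)
    moreover have "cube_eval Q \<phi> = of_real (u (cube_emb \<phi>))"
      unfolding Q ev_def cube_eval_def cube_emb_def by (rule refl)
    ultimately show ?thesis
      by (simp only: of_real_diff[symmetric] norm_of_real real_norm_def)
  qed
  then show ?thesis by blast
qed

section \<open>Topology and measurability on the space of configurations\<close>

lemma topspace_conf_topology: "topspace (conf_topology \<Delta>) = Pow \<Delta>"
  by (auto simp: conf_topology_def topspace_pullback_topology)

lemma continuous_map_conf_member:
  assumes "x \<in> \<Delta>"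
  shows "continuous_map (conf_topology \<Delta>) (discrete_topology UNIV) (\<lambda>X. x \<in> X)"
proof -
  have "continuous_map (conf_topology \<Delta>) (discrete_topology UNIV)
      ((\<lambda>h. h x) \<circ> (\<lambda>X. \<lambda>x\<in>\<Delta>. x \<in> X))"
    unfolding conf_topology_def
    by (rule continuous_map_pullback, rule continuous_map_product_projection) (rule assms)
  then show ?thesis
    using assms by (simp add: o_def)
qed

lemma continuous_map_into_conf:
  assumes "\<And>t. t \<in> topspace T \<Longrightarrow> g t \<subseteq> \<Delta>"
    and "\<And>x. x \<in> \<Delta> \<Longrightarrow> continuous_map T (discrete_topology UNIV) (\<lambda>t. x \<in> g t)"
  shows "continuous_map T (conf_topology \<Delta>) g"
  unfolding conf_topology_def
proof (rule continuous_map_pullback')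
  show "continuous_map T (product_topology (\<lambda>_. discrete_topology UNIV) \<Delta>)
      ((\<lambda>X. \<lambda>x\<in>\<Delta>. x \<in> X) \<circ> g)"
    unfolding continuous_map_componentwise
    using assms(2) by (auto simp: o_def)
  show "topspace T \<subseteq> g -` Pow \<Delta>"
    using assms(1) by auto
qed

text \<open>Together with its inverse in \<open>continuous_map_support\<close> this identifies the
  space of configurations with \<open>cube\<close>.\<close>

lemma continuous_map_ind: "continuous_map (conf_topology \<Delta>) (top_of_set cube) ind"
  unfolding continuous_map_in_subtopology
proof
  show "ind \<in> topspace (conf_topology \<Delta>) \<rightarrow> cube"
    unfolding topspace_conf_topology using ind_in_cube by auto
  have "continuous_map (conf_topology \<Delta>) (product_topology (\<lambda>_. euclidean) UNIV) ind"
    unfolding continuous_map_componentwise_UNIV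
  proof
    fix x
    show "continuous_map (conf_topology \<Delta>) euclidean (\<lambda>X. ind X x)"
    proof (cases "x \<in> \<Delta>")
      case True
      have "continuous_map (conf_topology \<Delta>) euclidean ((\<lambda>b. if b then 1 else 0 :: real) \<circ> (\<lambda>X. x \<in> X))"
        by (rule continuous_map_compose[OF continuous_map_conf_member[OF True]]) simp
      then show ?thesis by (simp add: o_def ind_def)
    next
      case False
      have "continuous_map (conf_topology \<Delta>) euclidean (\<lambda>X. 0 :: real)"
        by simp
      then show ?thesis
        by (rule continuous_map_eq) (use False in \<open>auto simp: topspace_conf_topology ind_def\<close>)
    qed
  qed
  then show "continuous_map (conf_topology \<Delta>) euclidean ind"
    by (simp only: euclidean_product_topology)
qed

lemma continuous_map_support:
  "continuous_map (top_of_set cube) (conf_topology \<Delta>) (\<lambda>\<phi>. {x \<in> \<Delta>. \<phi> x = 1})"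
proof (rule continuous_map_into_conf)
  fix x assume x: "x \<in> \<Delta>"
  show "continuous_map (top_of_set cube) (discrete_topology UNIV) (\<lambda>\<phi>. x \<in> {x \<in> \<Delta>. \<phi> x = 1})"
    unfolding continuous_map_def
  proof (intro conjI allI impI)
    fix U :: "bool set"
    \<comment> \<open>An open subset of the line that meets {0, 1} exactly in the codes of the truth
      values in \<open>U\<close>.\<close>
    define W where "W = (if True \<in> U then {1/2<..} else {}) \<union> (if False \<in> U then {..<1/2} else {} :: real set)"
    have "open W" by (auto simp: W_def)
    then have "open ((\<lambda>\<phi>::real \<Rightarrow> real. \<phi> x) -` W)"
      by (intro open_vimage continuous_on_product_coordinates)
    moreover have "{\<phi> \<in> topspace (top_of_set cube). (x \<in> {x \<in> \<Delta>. \<phi> x = 1}) \<in> U} =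
        cube \<inter> ((\<lambda>\<phi>. \<phi> x) -` W)"
    proof -
      have "(x \<in> {x \<in> \<Delta>. \<phi> x = 1}) \<in> U \<longleftrightarrow> \<phi> x \<in> W" if "\<phi> \<in> cube" for \<phi>
      proof -
        have "\<phi> x = 0 \<or> \<phi> x = 1" using that by (auto simp: cube_iff)
        then show ?thesis using x by (auto simp: W_def)
      qed
      then show ?thesis by auto
    qed
    ultimately show "openin (top_of_set cube) {\<phi> \<in> topspace (top_of_set cube). (x \<in> {x \<in> \<Delta>. \<phi> x = 1}) \<in> U}"
      by (simp add: openin_open_Int)
  qed auto
qed auto

lemma conf_approx:
  assumes "continuous_map (conf_topology \<Delta>) euclideanreal f" "0 < e"
  shows "\<exists>Q. \<forall>X\<subseteq>\<Delta>. norm (of_real (f X) - conf_eval Q X) < e"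
proof -
  have "continuous_map (top_of_set cube) euclideanreal (f \<circ> (\<lambda>\<phi>. {x \<in> \<Delta>. \<phi> x = 1}))"
    by (rule continuous_map_compose[OF continuous_map_support assms(1)])
  then have "continuous_on cube (\<lambda>\<phi>. f {x \<in> \<Delta>. \<phi> x = 1})"
    by (simp add: o_def)
  from stone_weierstrass_cube[OF this assms(2)]
  obtain Q where Q: "\<And>\<phi>. \<phi> \<in> cube \<Longrightarrow> norm (of_real (f {x \<in> \<Delta>. \<phi> x = 1}) - cube_eval Q \<phi>) < e"
    by blast
  have "norm (of_real (f X) - conf_eval Q X) < e" if "X \<subseteq> \<Delta>" for X
  proof -
    have "{x \<in> \<Delta>. ind X x = 1} = X" using that by (auto simp: ind_def)
    with Q[OF ind_in_cube[OF that]] show ?thesis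
      by (simp only: conf_eval_eq[OF that])
  qed
  then show ?thesis by blast
qed

lemma space_conf_borel: "space (conf_borel \<Delta>) = Pow \<Delta>"
  unfolding conf_borel_def
  by (rule space_measure_of) (use openin_subset topspace_conf_topology in blast)

lemma openin_in_sets_conf_borel:
  assumes "openin (conf_topology \<Delta>) U"
  shows "U \<in> sets (conf_borel \<Delta>)"
proof -
  have "{U. openin (conf_topology \<Delta>) U} \<subseteq> Pow (Pow \<Delta>)"
    using openin_subset topspace_conf_topology by blast
  with assms show ?thesis
    unfolding conf_borel_def by (simp add: sets_measure_of sigma_sets.Basic)
qed

lemma continuous_imp_borel_measurable:
  fixes f :: "real set \<Rightarrow> 'b::topological_space"
  assumes "continuous_map (conf_topology \<Delta>) euclidean f"
  shows "f \<in> borel_measurable (conf_borel \<Delta>)"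
proof (rule borel_measurableI)
  fix S :: "'b set" assume "open S"
  then have "openin (conf_topology \<Delta>) {X \<in> topspace (conf_topology \<Delta>). f X \<in> S}"
    using assms by (auto simp: continuous_map_def)
  moreover have "{X \<in> topspace (conf_topology \<Delta>). f X \<in> S} = f -` S \<inter> space (conf_borel \<Delta>)"
    by (auto simp: space_conf_borel topspace_conf_topology)
  ultimately show "f -` S \<inter> space (conf_borel \<Delta>) \<in> sets (conf_borel \<Delta>)"
    using openin_in_sets_conf_borel by simp
qed

lemma continuous_map_conf_eval: "continuous_map (conf_topology \<Delta>) euclidean (conf_eval Q)"
proof -
  have "continuous_map (top_of_set cube) euclidean (cube_eval Q)"
    using continuous_on_cube_eval by simp
  from continuous_map_compose[OF continuous_map_ind this]
  show ?thesis
    by (rule continuous_map_eq) (auto simp: topspace_conf_topology conf_eval_eq)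
qed

lemma integrable_conf_eval:
  assumes "conf_prob \<Delta> M"
  shows "integrable M (conf_eval Q)"
proof -
  interpret prob_space M using assms by (simp add: conf_prob_def)
  have sets: "sets M = sets (conf_borel \<Delta>)" using assms by (simp add: conf_prob_def)
  then have space: "space M = Pow \<Delta>"
    using sets_eq_imp_space_eq space_conf_borel by blast
  obtain C where C: "\<forall>X\<subseteq>\<Delta>. norm (conf_eval Q X) \<le> C"
    using conf_eval_bounded by blast
  show ?thesis
  proof (rule integrable_const_bound)
    show "AE X in M. norm (conf_eval Q X) \<le> C"
      using C space by (intro AE_I2) auto
    show "conf_eval Q \<in> borel_measurable M"
      using continuous_imp_borel_measurable[OF continuous_map_conf_eval]
      unfolding measurable_cong_sets[OF sets refl] .
  qed
qed

end

text \<open>Scaling is injective on points, so membership of a scaled point in the image is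
  membership of the original point in \<open>X\<close>; continuity follows coordinate by
  coordinate.\<close>

lemma measurable_scale_conf:
  assumes "conf_grid \<Delta>" "conf_grid ((\<lambda>x. x * \<epsilon>) ` \<Delta>)" "\<epsilon> \<noteq> 0"
  shows "(\<lambda>X. (\<lambda>x. x * \<epsilon>) ` X) \<in> conf_borel \<Delta> \<rightarrow>\<^sub>M conf_borel ((\<lambda>x. x * \<epsilon>) ` \<Delta>)"
    (is "?h \<in> _ \<rightarrow>\<^sub>M conf_borel ?\<Delta>")
proof -
  interpret A: conf_grid \<Delta> by fact
  interpret B: conf_grid ?\<Delta> by fact
  have "continuous_map (conf_topology \<Delta>) (conf_topology ?\<Delta>) ?h"
  proof (rule B.continuous_map_into_conf)
    fix X assume "X \<in> topspace (conf_topology \<Delta>)"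
    then show "?h X \<subseteq> ?\<Delta>" by (auto simp: A.topspace_conf_topology)
  next
    fix y assume "y \<in> ?\<Delta>"
    then obtain x where x: "x \<in> \<Delta>" "y = x * \<epsilon>" by blast
    have "y \<in> ?h X \<longleftrightarrow> x \<in> X" for X
      using x assms(3) by auto
    then show "continuous_map (conf_topology \<Delta>) (discrete_topology UNIV) (\<lambda>X. y \<in> ?h X)"
      using A.continuous_map_conf_member[OF x(1)] by simp
  qed
  then have pre: "openin (conf_topology \<Delta>) {X \<in> topspace (conf_topology \<Delta>). ?h X \<in> U}"
    if "openin (conf_topology ?\<Delta>) U" for U
    using that by (auto simp: continuous_map_def)
  show ?thesis
    unfolding conf_borel_def[of ?\<Delta>]
  proof (rule measurable_measure_of)
    show "{U. openin (conf_topology ?\<Delta>) U} \<subseteq> Pow (Pow ?\<Delta>)"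
      using openin_subset B.topspace_conf_topology by blast
    show "?h \<in> space (conf_borel \<Delta>) \<rightarrow> Pow ?\<Delta>"
      by (auto simp: A.space_conf_borel)
    fix U assume "U \<in> {U. openin (conf_topology ?\<Delta>) U}"
    then have "{X \<in> topspace (conf_topology \<Delta>). ?h X \<in> U} \<in> sets (conf_borel \<Delta>)"
      using pre A.openin_in_sets_conf_borel by blast
    moreover have "{X \<in> topspace (conf_topology \<Delta>). ?h X \<in> U} = ?h -` U \<inter> space (conf_borel \<Delta>)"
      by (auto simp: A.space_conf_borel A.topspace_conf_topology)
    ultimately show "?h -` U \<inter> space (conf_borel \<Delta>) \<in> sets (conf_borel \<Delta>)"
      by simp
  qed
qed

section \<open>The concrete grids\<close>

lemma summable_on_geometric_image:
  fixes q c :: real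
  assumes "0 < q" "q < 1" "c \<noteq> 0"
  shows "(\<lambda>x. \<bar>x\<bar>) summable_on {c * q ^ (i + 1) | i. True}"
proof -
  have "inj (\<lambda>i. c * q ^ (i + 1))"
  proof (rule injI)
    fix i j assume "c * q ^ (i + 1) = c * q ^ (j + 1)"
    then have "q ^ (i + 1) = q ^ (j + 1)" using assms(3) by simp
    then show "i = j"
      using assms power_strict_decreasing_iff[of q "i + 1" "j + 1"]
        power_strict_decreasing_iff[of q "j + 1" "i + 1"] by auto
  qed
  moreover have "summable (\<lambda>i. norm (\<bar>c * q ^ (i + 1)\<bar>))"
    using assms by (simp add: abs_mult power_abs summable_mult summable_geometric)
  then have "(\<lambda>i. \<bar>c * q ^ (i + 1)\<bar>) summable_on UNIV"
    by (rule norm_summable_imp_summable_on)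
  ultimately have "(\<lambda>x. \<bar>x\<bar>) summable_on range (\<lambda>i. c * q ^ (i + 1))"
    by (subst summable_on_reindex) (auto simp: o_def)
  moreover have "range (\<lambda>i. c * q ^ (i + 1)) = {c * q ^ (i + 1) | i. True}"
    by blast
  ultimately show ?thesis by simp
qed

lemma conf_grid_bqJ:
  assumes "0 < q" "q < 1" "b < 0" "0 < a"
  shows "conf_grid (grid_bqJ q a b)"
proof
  show "(\<lambda>x. \<bar>x\<bar>) summable_on grid_bqJ q a b"
    unfolding grid_bqJ_def
  proof (rule summable_on_Un_disjoint)
    show "{inverse b * q ^ (i + 1) | i. True} \<inter> {inverse a * q ^ (i + 1) | i. True} = {}"
    proof -
      have "inverse b * q ^ (i + 1) < 0" "0 < inverse a * q ^ (j + 1)" for i j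
        using assms by (auto intro!: mult_neg_pos mult_pos_pos)
      then have "inverse b * q ^ (i + 1) \<noteq> inverse a * q ^ (j + 1)" for i j
        by (metis less_asym)
      then show ?thesis by blast
    qed
  qed (rule summable_on_geometric_image; use assms in simp)+
  show "0 \<notin> grid_bqJ q a b"
    using assms by (auto simp: grid_bqJ_def)
qed

text \<open>Transfers the grid properties from the big q-Jacobi grid back to the q-Racah
  grids.\<close>

lemma conf_grid_scale:
  assumes "conf_grid ((\<lambda>x. x * \<epsilon>) ` \<Delta>)" "\<epsilon> \<noteq> 0"
  shows "conf_grid \<Delta>"
proof
  interpret conf_grid "(\<lambda>x. x * \<epsilon>) ` \<Delta>" by fact
  have "inj_on (\<lambda>x. x * \<epsilon>) \<Delta>" using assms(2) by (auto simp: inj_on_def)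
  then have "(\<lambda>x. \<bar>x * \<epsilon>\<bar>) summable_on \<Delta>"
    using summable by (simp add: summable_on_reindex o_def)
  then have "(\<lambda>x. \<bar>x * \<epsilon>\<bar> * inverse \<bar>\<epsilon>\<bar>) summable_on \<Delta>"
    by (rule summable_on_cmult_left)
  moreover have "\<bar>x * \<epsilon>\<bar> * inverse \<bar>\<epsilon>\<bar> = \<bar>x\<bar>" for x
    using assms(2) by (simp add: abs_mult mult.assoc)
  ultimately show "(\<lambda>x. \<bar>x\<bar>) summable_on \<Delta>"
    by (simp only:)
  show "0 \<notin> \<Delta>" using zero_notin by auto
qed

section \<open>Convergence of the measures\<close>

lemma conf_eval_sum: "conf_eval (\<Sum>i\<in>I. Q i) X = (\<Sum>i\<in>I. conf_eval (Q i) X)"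
  by (simp add: conf_eval_def eval_at.hom_sum)

lemma conf_eval_Const_mult: "conf_eval (Const a * Q) X = a * conf_eval Q X"
  by (simp add: conf_eval_def eval_at.hom_mult)

lemma power_sum_scale: "e \<noteq> 0 \<Longrightarrow> power_sum k ((\<lambda>x. x * e) ` X) = of_real e ^ k * power_sum k X"
proof -
  assume "e \<noteq> 0"
  then have "inj_on (\<lambda>x. x * e) X" by (simp add: inj_on_def)
  then show ?thesis
    unfolding power_sum_def
    by (subst infsum_reindex) (simp_all add: o_def power_mult_distrib infsum_cmult_left' mult.commute)
qed

lemma conf_eval_scaled_Phi_qR_poly:
  assumes "0 < q" "q < 1" "\<epsilon> \<noteq> 0"
  shows "conf_eval (scaled_Phi_qR_poly q a b c d \<epsilon> \<nu>) ((\<lambda>x. x * \<epsilon>) ` X) =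
    of_real \<epsilon> ^ sum_list \<nu> * sym_eval (Phi_qR q (of_real \<epsilon> * c) (of_real \<epsilon> * d)
      (of_real (- q / (\<epsilon> * a))) (of_real (- q / (\<epsilon> * b))) \<nu>) X"
proof -
  have "inverse (of_real \<epsilon>) ^ (i + 1) * power_sum (i + 1) ((\<lambda>x. x * \<epsilon>) ` X) = power_sum (i + 1) X" for i
  proof -
    have "inverse (complex_of_real \<epsilon>) ^ (i + 1) * of_real \<epsilon> ^ (i + 1) = 1"
      unfolding power_mult_distrib[symmetric] using assms(3) by simp
    then show ?thesis
      unfolding power_sum_scale[OF assms(3)] mult.assoc[symmetric] by (simp only: mult_1)
  qed
  then show ?thesis
    unfolding scaled_Phi_qR_poly_def conf_eval_Const_mult Phi_qR_eq[OF assms(1,2)] sym_eval_sym_of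
    by (simp only: conf_eval_def eval_at_subst eval_at.hom_mult eval_at_Const eval_at_Var)
qed

lemma sym_eval_Phi_bqJ:
  assumes "0 < q" "q < 1" "c \<noteq> 0"
  shows "sym_eval (Phi_bqJ q a b c d \<nu>) = conf_eval (Phi_bqJ_poly q a b c d \<nu>)"
  unfolding Phi_bqJ_eq[OF assms] sym_eval_sym_of conf_eval_def by (rule refl)

text \<open>A relation between the polynomials holds for their values on configurations; integrated
  against the conjugate of the member \<kappa>, it leaves \<open>w \<kappa>\<close> times a nonzero
  square norm.\<close>

lemma Phi_bqJ_poly_independent:
  assumes q: "0 < q" "q < 1" and c: "c \<noteq> 0"
    and M: "orthogonal_basis_L2 M {\<nu>. is_partition \<nu>} (\<lambda>\<nu>. sym_eval (Phi_bqJ q a b c d \<nu>))"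
    and S: "finite S" "S \<subseteq> {\<nu>. is_partition \<nu>}"
    and zero: "(\<Sum>\<nu>\<in>S. Const (w \<nu>) * Phi_bqJ_poly q a b c d \<nu>) = 0" and \<kappa>: "\<kappa> \<in> S"
  shows "w \<kappa> = 0"
proof -
  define f where "f \<nu> = conf_eval (Phi_bqJ_poly q a b c d \<nu>)" for \<nu>
  have meas: "f \<nu> \<in> borel_measurable M" and sq: "integrable M (\<lambda>x. (cmod (f \<nu> x))\<^sup>2)"
    and nz: "(LINT x|M. (cmod (f \<nu> x))\<^sup>2) \<noteq> 0" if "\<nu> \<in> S" for \<nu>
    using M that S(2) unfolding orthogonal_basis_L2_def sym_eval_Phi_bqJ[OF q c] f_def by auto
  have orth: "(LINT x|M. f \<nu> x * cnj (f \<kappa> x)) = 0" if "\<nu> \<in> S" "\<nu> \<noteq> \<kappa>" for \<nu>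
    using M that \<kappa> S(2) unfolding orthogonal_basis_L2_def sym_eval_Phi_bqJ[OF q c] f_def by blast
  have int: "integrable M (\<lambda>x. f \<nu> x * cnj (f \<kappa> x))" if "\<nu> \<in> S" for \<nu>
  proof (rule Bochner_Integration.integrable_bound)
    show "integrable M (\<lambda>x. (cmod (f \<nu> x))\<^sup>2 + (cmod (f \<kappa> x))\<^sup>2)"
      using sq[OF that] sq[OF \<kappa>] by (rule Bochner_Integration.integrable_add)
    show "(\<lambda>x. f \<nu> x * cnj (f \<kappa> x)) \<in> borel_measurable M"
      by (intro borel_measurable_times meas that \<kappa>
          borel_measurable_continuous_on[OF continuous_on_cnj[OF continuous_on_id]])
    have "norm (u * cnj v) \<le> norm ((cmod u)\<^sup>2 + (cmod v)\<^sup>2)" for u v :: complex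
    proof -
      have "2 * (cmod u * cmod v) \<le> (cmod u)\<^sup>2 + (cmod v)\<^sup>2"
        using sum_squares_bound[of "cmod u" "cmod v"] by simp
      moreover have "0 \<le> cmod u * cmod v" by simp
      ultimately have "cmod u * cmod v \<le> (cmod u)\<^sup>2 + (cmod v)\<^sup>2" by linarith
      then show ?thesis by (simp add: norm_mult)
    qed
    then show "AE x in M. norm (f \<nu> x * cnj (f \<kappa> x)) \<le> norm ((cmod (f \<nu> x))\<^sup>2 + (cmod (f \<kappa> x))\<^sup>2)"
      by simp
  qed
  have "(\<Sum>\<nu>\<in>S. w \<nu> * (f \<nu> x * cnj (f \<kappa> x))) = 0" for x
  proof -
    have "(\<Sum>\<nu>\<in>S. w \<nu> * f \<nu> x) = conf_eval (\<Sum>\<nu>\<in>S. Const (w \<nu>) * Phi_bqJ_poly q a b c d \<nu>) x"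
      unfolding f_def by (simp only: conf_eval_sum conf_eval_Const_mult)
    also have "\<dots> = 0"
      unfolding zero by (simp add: conf_eval_def)
    finally have "(\<Sum>\<nu>\<in>S. w \<nu> * f \<nu> x) * cnj (f \<kappa> x) = 0" by simp
    then show ?thesis
      by (simp add: sum_distrib_right mult.assoc)
  qed
  then have "0 = (LINT x|M. (\<Sum>\<nu>\<in>S. w \<nu> * (f \<nu> x * cnj (f \<kappa> x))))"
    by simp
  also have "\<dots> = (\<Sum>\<nu>\<in>S. w \<nu> * (LINT x|M. f \<nu> x * cnj (f \<kappa> x)))"
    using int by (subst Bochner_Integration.integral_sum) auto
  also have "\<dots> = w \<kappa> * (LINT x|M. f \<kappa> x * cnj (f \<kappa> x))"
    using orth by (subst sum.remove[OF S(1) \<kappa>]) (simp add: sum.neutral)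
  also have "(LINT x|M. f \<kappa> x * cnj (f \<kappa> x)) = of_real (LINT x|M. (cmod (f \<kappa> x))\<^sup>2)"
    unfolding complex_norm_square[symmetric] by (rule integral_complex_of_real)
  finally show ?thesis
    using nz[OF \<kappa>] by simp
qed

text \<open>The function of the empty partition is 1, so this is orthogonality to it.\<close>

lemma integral_Phi_bqJ:
  assumes q: "0 < q" "q < 1" and c: "c \<noteq> 0" and M: "is_bqJ_measure q a b c d M" and \<nu>: "is_partition \<nu>"
  shows "(LINT X|M. conf_eval (Phi_bqJ_poly q a b c d \<nu>) X) = (if \<nu> = [] then 1 else 0)"
proof -
  interpret prob_space M
    using M by (simp add: is_bqJ_measure_def conf_prob_def)
  have one: "conf_eval (Phi_bqJ_poly q a b c d []) X = 1" for X
    by (simp add: Phi_bqJ_poly_Nil conf_eval_def)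
  show ?thesis
  proof (cases "\<nu> = []")
    case True
    then show ?thesis by (simp add: one prob_space)
  next
    case False
    have "is_partition []" by (simp add: is_partition_def)
    then have "(LINT X|M. conf_eval (Phi_bqJ_poly q a b c d \<nu>) X *
        cnj (conf_eval (Phi_bqJ_poly q a b c d []) X)) = 0"
      using M False \<nu> unfolding is_bqJ_measure_def orthogonal_basis_L2_def sym_eval_Phi_bqJ[OF q c]
      by blast
    with False show ?thesis by (simp add: one)
  qed
qed

context conf_grid
begin

text \<open>The measures vary with \<open>n\<close> and are not assumed to converge. Each monomial
  is bounded on all configurations, hence its integrals are bounded uniformly in \<open>n\<close>,
  while the differences of the coefficients tend to 0.\<close>

lemma integral_conf_eval_diff_tendsto:
  assumes N: "\<And>n. conf_prob \<Delta> (N n)" and P: "coeff_tendsto P L"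
  shows "(\<lambda>n. (LINT X|N n. conf_eval (P n) X) - (LINT X|N n. conf_eval L X)) \<longlonglongrightarrow> 0"
proof -
  obtain K where K: "finite K"
    "\<And>n. P n = (\<Sum>m\<in>K. Poly_Mapping.single m (Poly_Mapping.lookup (P n) m))"
    "L = (\<Sum>m\<in>K. Poly_Mapping.single m (Poly_Mapping.lookup L m))"
    "\<And>m. (\<lambda>n. Poly_Mapping.lookup (P n) m) \<longlonglongrightarrow> Poly_Mapping.lookup L m"
    using coeff_tendstoE[OF P] by blast
  define J where "J n m = (LINT X|N n. conf_eval (Poly_Mapping.single m 1) X)" for n m
  have int: "(LINT X|N n. conf_eval Q X) = (\<Sum>m\<in>K. Poly_Mapping.lookup Q m * J n m)"
    if Q: "Q = (\<Sum>m\<in>K. Poly_Mapping.single m (Poly_Mapping.lookup Q m))" for Q n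
  proof -
    have "Q = (\<Sum>m\<in>K. Const (Poly_Mapping.lookup Q m) * Poly_Mapping.single m 1)"
      unfolding single_eq_Const_times[symmetric] by (rule Q)
    then have "conf_eval Q X = (\<Sum>m\<in>K. Poly_Mapping.lookup Q m * conf_eval (Poly_Mapping.single m 1) X)" for X
      by (metis (no_types, lifting) conf_eval_sum conf_eval_Const_mult sum.cong)
    then show ?thesis
      unfolding J_def by (simp add: integrable_conf_eval[OF N])
  qed
  have Jbound: "\<exists>C. \<forall>n. norm (J n m) \<le> C" for m
  proof -
    obtain C where C: "\<forall>X\<subseteq>\<Delta>. norm (conf_eval (Poly_Mapping.single m 1) X) \<le> C"
      using conf_eval_bounded by blast
    have "norm (J n m) \<le> C" for n
    proof -
      interpret prob_space "N n" using N by (simp add: conf_prob_def)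
      have "sets (N n) = sets (conf_borel \<Delta>)" using N by (simp add: conf_prob_def)
      then have space: "space (N n) = Pow \<Delta>"
        using sets_eq_imp_space_eq space_conf_borel by blast
      have "norm (J n m) \<le> (LINT X|N n. norm (conf_eval (Poly_Mapping.single m 1) X))"
        unfolding J_def by (rule integral_norm_bound)
      also have "\<dots> \<le> (LINT X|N n. C)"
        by (rule integral_mono_AE)
          (use C space integrable_conf_eval[OF N] in \<open>auto intro!: AE_I2 integrable_norm\<close>)
      also have "\<dots> = C" by (simp add: prob_space)
      finally show ?thesis .
    qed
    then show ?thesis by blast
  qed
  have "(\<lambda>n. \<Sum>m\<in>K. (Poly_Mapping.lookup (P n) m - Poly_Mapping.lookup L m) * J n m) \<longlonglongrightarrow> (\<Sum>m\<in>K. 0)"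
  proof (rule tendsto_sum)
    fix m
    obtain C where C: "\<And>n. norm (J n m) \<le> C" using Jbound by blast
    have "(\<lambda>n. Poly_Mapping.lookup (P n) m - Poly_Mapping.lookup L m) \<longlonglongrightarrow> 0"
      using K(4)[of m] by (simp add: LIM_zero)
    then have "(\<lambda>n. norm (Poly_Mapping.lookup (P n) m - Poly_Mapping.lookup L m) * C) \<longlonglongrightarrow> 0"
      by (intro tendsto_mult_left_zero tendsto_norm_zero)
    moreover have "norm ((Poly_Mapping.lookup (P n) m - Poly_Mapping.lookup L m) * J n m) \<le>
        norm (Poly_Mapping.lookup (P n) m - Poly_Mapping.lookup L m) * C" for n
      unfolding norm_mult by (intro mult_left_mono C norm_ge_zero)
    ultimately show "(\<lambda>n. (Poly_Mapping.lookup (P n) m - Poly_Mapping.lookup L m) * J n m) \<longlonglongrightarrow> 0"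
      by (rule Lim_null_comparison[OF always_eventually[OF allI], rotated])
  qed
  then show ?thesis
    unfolding int[OF K(2)] int[OF K(3)] by (simp add: left_diff_distrib sum_subtractf)
qed

text \<open>A uniform approximation of \<open>f\<close> by a polynomial in the power sums has the
  same error bound under every probability measure, so the usual division of the error into three
  parts applies.\<close>

lemma conf_weak_convI:
  assumes N: "\<And>n. conf_prob \<Delta> (N n)" and M: "conf_prob \<Delta> M"
    and lim: "\<And>Q. (\<lambda>n. LINT X|N n. conf_eval Q X) \<longlonglongrightarrow> (LINT X|M. conf_eval Q X)"
  shows "conf_weak_conv \<Delta> N M"
  unfolding conf_weak_conv_def
proof (intro allI impI)
  fix f assume f: "continuous_map (conf_topology \<Delta>) euclideanreal f"
  have approx: "norm (of_real (LINT X|\<mu>. f X) - (LINT X|\<mu>. conf_eval Q X)) \<le> e"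
    if \<mu>: "conf_prob \<Delta> \<mu>" and Q: "\<forall>X\<subseteq>\<Delta>. norm (of_real (f X) - conf_eval Q X) < e" for \<mu> Q e
  proof -
    interpret prob_space \<mu> using \<mu> by (simp add: conf_prob_def)
    have sets: "sets \<mu> = sets (conf_borel \<Delta>)" using \<mu> by (simp add: conf_prob_def)
    then have space: "space \<mu> = Pow \<Delta>"
      using sets_eq_imp_space_eq space_conf_borel by blast
    obtain C where C: "\<forall>X\<subseteq>\<Delta>. norm (conf_eval Q X) \<le> C"
      using conf_eval_bounded by blast
    have fC: "norm (f X) \<le> C + e" if "X \<subseteq> \<Delta>" for X
    proof -
      have "norm (complex_of_real (f X)) \<le> norm (conf_eval Q X) + norm (of_real (f X) - conf_eval Q X)"
        by (metis norm_triangle_sub)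
      then show ?thesis
        using Q[rule_format, OF that] C[rule_format, OF that] by simp
    qed
    have intf: "integrable \<mu> f"
    proof (rule integrable_const_bound)
      show "AE X in \<mu>. norm (f X) \<le> C + e"
        using fC space by (intro AE_I2) auto
      show "f \<in> borel_measurable \<mu>"
        using continuous_imp_borel_measurable[OF f]
        unfolding measurable_cong_sets[OF sets refl] .
    qed
    then have intc: "integrable \<mu> (\<lambda>X. complex_of_real (f X))" by simp
    have "of_real (LINT X|\<mu>. f X) - (LINT X|\<mu>. conf_eval Q X) = (LINT X|\<mu>. of_real (f X) - conf_eval Q X)"
      using intc integrable_conf_eval[OF \<mu>] by simp
    also have "norm \<dots> \<le> (LINT X|\<mu>. norm (of_real (f X) - conf_eval Q X))"
      by (rule integral_norm_bound)
    also have "\<dots> \<le> (LINT X|\<mu>. e)"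
    proof (rule integral_mono)
      show "integrable \<mu> (\<lambda>X. norm (of_real (f X) - conf_eval Q X))"
        by (intro integrable_norm Bochner_Integration.integrable_diff intc integrable_conf_eval[OF \<mu>])
      show "norm (of_real (f X) - conf_eval Q X) \<le> e" if "X \<in> space \<mu>" for X
        using Q[rule_format, of X] that unfolding space by simp
    qed simp
    also have "\<dots> = e" by (simp add: prob_space)
    finally show ?thesis .
  qed
  show "(\<lambda>n. integral\<^sup>L (N n) f) \<longlonglongrightarrow> integral\<^sup>L M f"
  proof (rule LIMSEQ_I)
    fix r :: real assume "0 < r"
    then obtain Q where Q: "\<forall>X\<subseteq>\<Delta>. norm (of_real (f X) - conf_eval Q X) < r / 3"
      using conf_approx[OF f, of "r / 3"] by auto
    obtain n0 where n0: "\<And>n. n \<ge> n0 \<Longrightarrow>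
        norm ((LINT X|N n. conf_eval Q X) - (LINT X|M. conf_eval Q X)) < r / 3"
      using LIMSEQ_D[OF lim[of Q], of "r / 3"] \<open>0 < r\<close> by auto
    have "norm (integral\<^sup>L (N n) f - integral\<^sup>L M f) < r" if "n \<ge> n0" for n
    proof -
      have *: "norm (x - y) < r" if "norm (x - u) \<le> r / 3" "norm (u - v) < r / 3" "norm (y - v) \<le> r / 3"
        for x y u v :: complex
      proof -
        have "x - y = (x - u) + (u - v) - (y - v)" by simp
        also have "norm \<dots> \<le> norm (x - u) + norm (u - v) + norm (y - v)"
          by (meson add_right_mono norm_triangle_ineq norm_triangle_ineq4 order_trans)
        finally show ?thesis using that by linarith
      qed
      have "norm (complex_of_real (integral\<^sup>L (N n) f) - of_real (integral\<^sup>L M f)) < r"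
        using *[OF approx[OF N Q] n0[OF that] approx[OF M Q]] .
      then show ?thesis
        by (simp only: of_real_diff[symmetric] norm_of_real real_norm_def)
    qed
    then show "\<exists>no. \<forall>n\<ge>no. norm (integral\<^sup>L (N n) f - integral\<^sup>L M f) < r" by blast
  qed
qed

end

theorem theorem4p9:
  fixes q a b :: real and c d :: complex
    and \<epsilon> :: "nat \<Rightarrow> real" and \<zeta> :: real
    and MqR :: "nat \<Rightarrow> real set measure" and MbqJ :: "real set measure"
  assumes "0 < q" "q < 1"
    and "admissible_bqJ q a b c d"
    and "\<And>M. \<epsilon> M = q ^ (M + 1) / sqrt (- (a * b))"
    and "\<zeta> = sqrt (- b / a)"
    and "\<And>M. is_qR_measure q \<zeta> (int M) (- int M)
            (of_real (\<epsilon> M) * c) (of_real (\<epsilon> M) * d)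
            (of_real (- q / (\<epsilon> M * a))) (of_real (- q / (\<epsilon> M * b))) (MqR M)"
    and "is_bqJ_measure q a b c d MbqJ"
  shows "conf_weak_conv (grid_bqJ q a b)
           (\<lambda>M. distr (MqR M) (conf_borel (grid_bqJ q a b)) (\<lambda>X. (\<lambda>x. x * \<epsilon> M) ` X))
           MbqJ"
proof -
  note q = assms(1,2)
  have ab: "b < 0" "0 < a"
    using assms(3) by (auto simp: admissible_bqJ_def)
  have c0: "c \<noteq> 0"
  proof
    assume "c = 0"
    \<comment> \<open>A non-real \<open>c\<close> is nonzero, and each admissible real interval lies
      strictly on one side of 0.\<close>
    moreover have "0 < a * q powi m" "b * q powi m < 0" for m
      using ab q by (simp_all add: mult_neg_pos)
    ultimately show False
      using assms(3) unfolding admissible_bqJ_def by (auto simp: not_less[symmetric] dest: less_trans)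
  qed
  let ?\<Delta> = "grid_bqJ q a b"
  let ?\<Delta>R = "\<lambda>M. grid_qR q \<zeta> (int M) (- int M)"
  let ?h = "\<lambda>M X. (\<lambda>x. x * \<epsilon> M) ` X"
  define N where "N M = distr (MqR M) (conf_borel ?\<Delta>) (?h M)" for M
  have \<epsilon>0: "\<epsilon> M \<noteq> 0" for M
    using assms(4) q ab by simp
  have \<epsilon>_lim: "\<epsilon> \<longlonglongrightarrow> 0"
  proof -
    have "(\<lambda>M. q ^ M * (q / sqrt (- (a * b)))) \<longlonglongrightarrow> 0 * (q / sqrt (- (a * b)))"
      using q by (intro tendsto_mult LIMSEQ_realpow_zero tendsto_const) auto
    then show ?thesis
      by (simp add: assms(4)[abs_def] mult_ac)
  qed
  interpret conf_grid ?\<Delta>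
    using q ab by (rule conf_grid_bqJ)
  have scaled: "?h M (?\<Delta>R M) = ?\<Delta>" for M
    unfolding assms(4,5) using q(1) ab by (rule grid_qR_scaled)
  have meas: "?h M \<in> MqR M \<rightarrow>\<^sub>M conf_borel ?\<Delta>" for M
  proof -
    have grid: "conf_grid (?h M (?\<Delta>R M))"
      unfolding scaled by (rule conf_grid_axioms)
    have "?h M \<in> conf_borel (?\<Delta>R M) \<rightarrow>\<^sub>M conf_borel (?h M (?\<Delta>R M))"
      using conf_grid_scale[OF grid \<epsilon>0] grid \<epsilon>0 by (rule measurable_scale_conf)
    moreover have "sets (MqR M) = sets (conf_borel (?\<Delta>R M))"
      using assms(6)[of M] by (simp add: is_qR_measure_def conf_prob_def)
    ultimately show ?thesis
      unfolding scaled by (simp cong: measurable_cong_sets)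
  qed
  have N: "conf_prob ?\<Delta> (N M)" for M
  proof -
    have "prob_space (MqR M)"
      using assms(6)[of M] by (simp add: is_qR_measure_def conf_prob_def)
    then show ?thesis
      unfolding N_def conf_prob_def using prob_space.prob_space_distr[OF _ meas] by simp
  qed
  let ?\<Phi> = "Phi_bqJ_poly q a b c d"
  have int_qR: "(LINT X|N M. conf_eval (scaled_Phi_qR_poly q a b c d (\<epsilon> M) \<nu>) X) = (if \<nu> = [] then 1 else 0)"
    if "is_partition \<nu>" for M \<nu>
  proof -
    let ?f = "sym_eval (Phi_qR q (of_real (\<epsilon> M) * c) (of_real (\<epsilon> M) * d)
        (of_real (- q / (\<epsilon> M * a))) (of_real (- q / (\<epsilon> M * b))) \<nu>)"
    have "(LINT X|N M. conf_eval (scaled_Phi_qR_poly q a b c d (\<epsilon> M) \<nu>) X) =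
        (LINT X|MqR M. conf_eval (scaled_Phi_qR_poly q a b c d (\<epsilon> M) \<nu>) (?h M X))"
      unfolding N_def
      by (rule integral_distr[OF meas continuous_imp_borel_measurable[OF continuous_map_conf_eval]])
    also have "\<dots> = of_real (\<epsilon> M) ^ sum_list \<nu> * (LINT X|MqR M. ?f X)"
      unfolding conf_eval_scaled_Phi_qR_poly[OF q \<epsilon>0] by (rule integral_mult_right_zero)
    also have "(LINT X|MqR M. ?f X) = (if \<nu> = [] then 1 else 0)"
      by (rule has_bochner_integral_integral_eq)
        (use assms(6)[of M] that in \<open>unfold is_qR_measure_def, blast\<close>)
    finally show ?thesis by simp
  qed
  \<comment> \<open>The scaled q-Racah functions have integral exactly 1 or 0 for every
    \<open>M\<close>; passing to their coefficientwise limit changes the integrals by a null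
    sequence.\<close>
  have lim_\<Phi>: "(\<lambda>M. LINT X|N M. conf_eval (?\<Phi> \<nu>) X) \<longlonglongrightarrow> (LINT X|MbqJ. conf_eval (?\<Phi> \<nu>) X)"
    if \<nu>: "is_partition \<nu>" for \<nu>
  proof -
    let ?\<delta> = "if \<nu> = [] then 1 else 0 :: complex"
    have "q \<noteq> 0" using q by simp
    then have "coeff_tendsto (\<lambda>M. scaled_Phi_qR_poly q a b c d (\<epsilon> M) \<nu>) (?\<Phi> \<nu>)"
      using c0 \<epsilon>0 \<epsilon>_lim by (rule scaled_Phi_qR_poly_tendsto)
    from integral_conf_eval_diff_tendsto[of N, OF N this]
    have "(\<lambda>M. ?\<delta> - (LINT X|N M. conf_eval (?\<Phi> \<nu>) X)) \<longlonglongrightarrow> 0"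
      unfolding int_qR[OF \<nu>] .
    from tendsto_diff[OF tendsto_const[of ?\<delta>] this]
    have "(\<lambda>M. LINT X|N M. conf_eval (?\<Phi> \<nu>) X) \<longlonglongrightarrow> ?\<delta>"
      by simp
    then show ?thesis
      unfolding integral_Phi_bqJ[OF q c0 assms(7) \<nu>] .
  qed
  have M: "conf_prob ?\<Delta> MbqJ"
    using assms(7) by (simp add: is_bqJ_measure_def)
  have lim: "(\<lambda>M. LINT X|N M. conf_eval Q X) \<longlonglongrightarrow> (LINT X|MbqJ. conf_eval Q X)" for Q
  proof -
    have basis: "orthogonal_basis_L2 MbqJ {\<nu>. is_partition \<nu>} (\<lambda>\<nu>. sym_eval (Phi_bqJ q a b c d \<nu>))"
      using assms(7) by (simp add: is_bqJ_measure_def)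
    obtain S w where S: "S \<subseteq> {\<nu>. is_partition \<nu>}" and Q: "Q = (\<Sum>\<nu>\<in>S. Const (w \<nu>) * ?\<Phi> \<nu>)"
    proof -
      have "\<exists>S w. finite S \<and> S \<subseteq> {\<nu>. is_partition \<nu>} \<and> Q = (\<Sum>\<nu>\<in>S. Const (w \<nu>) * ?\<Phi> \<nu>)"
      proof (rule independent_family_spans)
        show "deg_le weight (sum_list \<nu>) (?\<Phi> \<nu>)" for \<nu>
          by (rule deg_le_weight_Phi_bqJ_poly)
        show "w \<kappa> = 0" if "finite S" "S \<subseteq> {\<nu>. is_partition \<nu>}"
          "(\<Sum>\<nu>\<in>S. Const (w \<nu>) * ?\<Phi> \<nu>) = 0" "\<kappa> \<in> S" for S w \<kappa>
          using q c0 basis that by (rule Phi_bqJ_poly_independent)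
      qed
      then show thesis
        by (elim exE conjE) (rule that)
    qed
    have "(LINT X|\<mu>. conf_eval Q X) = (\<Sum>\<nu>\<in>S. w \<nu> * (LINT X|\<mu>. conf_eval (?\<Phi> \<nu>) X))"
      if "conf_prob ?\<Delta> \<mu>" for \<mu>
      unfolding Q conf_eval_sum conf_eval_Const_mult by (simp add: integrable_conf_eval[OF that])
    then show ?thesis
      using N M S by (auto intro!: tendsto_sum tendsto_mult lim_\<Phi>)
  qed
  show ?thesis
    using conf_weak_convI[OF N M lim] unfolding N_def .
qed

end
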